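(* Let $D$ be a dendron. For every topological group $G$ and every continuous action $G\curvearrowright D$, the dynamical $G$-system $D$ is Rosenthal representable (hence, also tame). It follows that the topological group $H(D)$ of all homeomorphisms of $D$ is Rosenthal representable.
   Context: A continuum is a compact connected Hausdorff space. A continuum $D$ is a dendron if every pair of distinct points $u,v\in D$ can be separated by a third point $w$, i.e. $D\setminus\{w\}=U\cup V$ with $U,V$ disjoint open, $u\in U$, $v\in V$. $H(D)$ carries the compact-open topology. For a Banach space $V$, $Is(V)$ is the topological group of all linear isometries of $V$ onto $V$ with the strong operator topology. $V$ is a Rosenthal Banach space if it contains no isomorphic copy of $\ell_1$. A representation of an action $G\curvearrowright X$ on $V$ is a pair $(h,\alpha)$ where $h:G\to Is(V)$ is a strongly continuous co-homomorphism ($h(g_1g_2)=h(g_2)h(g_1)$), and $\alpha:X\to V^*$ is a weak-star continuous bounded map with $\langle v,\alpha(gx)\rangle=\langle h(g)(v),\alpha(x)\rangle$ for all $v\in V$, $g\in G$, $x\in X$. The $G$-system $X$ is Rosenthal representable if there are a Rosenthal Banach space $V$ and a representation $(h,\alpha)$ on $V$ such that $\alpha$ is a topological embedding (for the weak-star topology). A topological group $G$ is Rosenthal representable if it is topologically isomorphic to a topological subgroup of $Is(V)$ for some Rosenthal Banach space $V$. Tame: a sequence $(f_n)_{n\in\mathbb{N}}$ of real-valued functions on a set $X$ is independent if there are real numbers $a<b$ such that $\bigcap_{n\in P}f_n^{-1}(-\infty,a)\cap\bigcap_{n\in M}f_n^{-1}(b,\infty)\neq\emptyset$ for all finite disjoint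 $P,M\subset\mathbb{N}$. A compact $G$-system $X$ is tame if for every continuous $f:X\to\mathbb{R}$ the family $fG=\{fg: g\in G\}$, where $(fg)(x)=f(gx)$, contains no independent sequence. *)

theory Defs
  imports "HOL-Analysis.Analysis" "HOL-Algebra.Group_Action" "HOL-Algebra.Module"
begin

section \<open>Dendrons\<close>

definition continuum :: "'a topology \<Rightarrow> bool" where
  "continuum D \<longleftrightarrow> compact_space D \<and> connected_space D \<and> Hausdorff_space D"

definition dendron :: "'a topology \<Rightarrow> bool" where
  "dendron D \<longleftrightarrow> continuum D \<and>
     (\<forall>u\<in>topspace D. \<forall>v\<in>topspace D. u \<noteq> v \<longrightarrow>
        (\<exists>w\<in>topspace D. \<exists>U V. openin D U \<and> openin D V \<and> U \<inter> V = {} \<and>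
           topspace D - {w} = U \<union> V \<and> u \<in> U \<and> v \<in> V))"

section \<open>Topological groups and continuous actions\<close>

definition topological_group :: "('g, 'm) monoid_scheme \<Rightarrow> 'g topology \<Rightarrow> bool" where
  "topological_group G T \<longleftrightarrow> Group.group G \<and> topspace T = carrier G \<and>
     continuous_map (prod_topology T T) T (\<lambda>(g, h). g \<otimes>\<^bsub>G\<^esub> h) \<and>
     continuous_map T T (\<lambda>g. inv\<^bsub>G\<^esub> g)"

definition continuous_action ::
  "('g, 'm) monoid_scheme \<Rightarrow> 'g topology \<Rightarrow> 'x topology \<Rightarrow> ('g \<Rightarrow> 'x \<Rightarrow> 'x) \<Rightarrow> bool" where
  "continuous_action G T X act \<longleftrightarrow> group_action G (topspace X) act \<and>
     continuous_map (prod_topology T X) X (\<lambda>(g, x). act g x)"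

definition homeo_group :: "'x topology \<Rightarrow> ('x \<Rightarrow> 'x) monoid" where
  "homeo_group X =
     (BijGroup (topspace X))\<lparr>carrier := {f \<in> Bij (topspace X). homeomorphic_map X X f}\<rparr>"

text \<open>As in \<^const>\<open>BijGroup\<close>, maps are represented by functions that are
  undefined off the space.\<close>

definition compact_open_topology :: "'x topology \<Rightarrow> 'y topology \<Rightarrow> ('x \<Rightarrow> 'y) topology" where
  "compact_open_topology X Y = topology_generated_by
     {{f \<in> extensional (topspace X). continuous_map X Y f \<and> f ` K \<subseteq> U} | K U.
        compactin X K \<and> openin Y U}"

definition homeo_group_topology :: "'x topology \<Rightarrow> ('x \<Rightarrow> 'x) topology" where
  "homeo_group_topology X = subtopology (compact_open_topology X X) (carrier (homeo_group X))"

section \<open>Real Banach spaces on a carrier set\<close>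

text \<open>HOL cannot quantify existentially over types, so Banach spaces are carrier-based:
  a module over the field of reals with a norm. The ring multiplication and unit that the
  \<open>module\<close> record inherits are not constrained.\<close>

definition real_ring :: "real ring" where
  "real_ring = \<lparr>carrier = UNIV, mult = (*), one = 1, zero = 0, add = (+)\<rparr>"

record 'v normed = "(real, 'v) module" +
  vnorm :: "'v \<Rightarrow> real"

definition normed_space :: "'v normed \<Rightarrow> bool" where
  "normed_space V \<longleftrightarrow> Module.module real_ring V \<and>
     (\<forall>x\<in>carrier V. 0 \<le> vnorm V x) \<and>
     (\<forall>x\<in>carrier V. vnorm V x = 0 \<longleftrightarrow> x = \<zero>\<^bsub>V\<^esub>) \<and>
     (\<forall>a. \<forall>x\<in>carrier V. vnorm V (a \<odot>\<^bsub>V\<^esub> x) = \<bar>a\<bar> * vnorm V x) \<and>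
     (\<forall>x\<in>carrier V. \<forall>y\<in>carrier V. vnorm V (x \<oplus>\<^bsub>V\<^esub> y) \<le> vnorm V x + vnorm V y)"

text \<open>The value \<open>0\<close> off the carrier is needed because \<^locale>\<open>Metric_space\<close> demands
  nonnegativity and symmetry on the whole type.\<close>

definition norm_dist :: "'v normed \<Rightarrow> 'v \<Rightarrow> 'v \<Rightarrow> real" where
  "norm_dist V x y =
     (if x \<in> carrier V \<and> y \<in> carrier V then vnorm V (x \<ominus>\<^bsub>V\<^esub> y) else 0)"

definition norm_topology :: "'v normed \<Rightarrow> 'v topology" where
  "norm_topology V = Metric_space.mtopology (carrier V) (norm_dist V)"

definition banach_space :: "'v normed \<Rightarrow> bool" where
  "banach_space V \<longleftrightarrow> normed_space V \<and> Metric_space.mcomplete (carrier V) (norm_dist V)"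

definition linear_map :: "'v normed \<Rightarrow> 'w normed \<Rightarrow> ('v \<Rightarrow> 'w) \<Rightarrow> bool" where
  "linear_map V W T \<longleftrightarrow> T \<in> carrier V \<rightarrow> carrier W \<and>
     (\<forall>x\<in>carrier V. \<forall>y\<in>carrier V. T (x \<oplus>\<^bsub>V\<^esub> y) = T x \<oplus>\<^bsub>W\<^esub> T y) \<and>
     (\<forall>a. \<forall>x\<in>carrier V. T (a \<odot>\<^bsub>V\<^esub> x) = a \<odot>\<^bsub>W\<^esub> T x)"

definition l1_space :: "(nat \<Rightarrow> real) normed" where
  "l1_space = \<lparr>carrier = {x. summable (\<lambda>n. \<bar>x n\<bar>)},
     mult = (\<lambda>x y n. x n * y n), one = (\<lambda>n. 1),
     zero = (\<lambda>n. 0), add = (\<lambda>x y n. x n + y n),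
     smult = (\<lambda>a x n. a * x n),
     vnorm = (\<lambda>x. \<Sum>n. \<bar>x n\<bar>)\<rparr>"

definition rosenthal_space :: "'v normed \<Rightarrow> bool" where
  "rosenthal_space V \<longleftrightarrow> banach_space V \<and>
     \<not> (\<exists>T. linear_map l1_space V T \<and> embedding_map (norm_topology l1_space) (norm_topology V) T)"

section \<open>The weak-star dual and the isometry group\<close>

definition dual :: "'v normed \<Rightarrow> ('v \<Rightarrow> real) set" where
  "dual V = {f \<in> extensional (carrier V).
     (\<forall>x\<in>carrier V. \<forall>y\<in>carrier V. f (x \<oplus>\<^bsub>V\<^esub> y) = f x + f y) \<and>
     (\<forall>a. \<forall>x\<in>carrier V. f (a \<odot>\<^bsub>V\<^esub> x) = a * f x) \<and>
     continuous_map (norm_topology V) euclideanreal f}"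

definition dual_norm :: "'v normed \<Rightarrow> ('v \<Rightarrow> real) \<Rightarrow> real" where
  "dual_norm V f = (SUP x\<in>{x \<in> carrier V. vnorm V x \<le> 1}. \<bar>f x\<bar>)"

definition weak_star_topology :: "'v normed \<Rightarrow> ('v \<Rightarrow> real) topology" where
  "weak_star_topology V =
     subtopology (product_topology (\<lambda>_. euclideanreal) (carrier V)) (dual V)"

definition isometry_group :: "'v normed \<Rightarrow> ('v \<Rightarrow> 'v) monoid" where
  "isometry_group V =
     (BijGroup (carrier V))\<lparr>carrier := {T \<in> Bij (carrier V). linear_map V V T \<and>
        (\<forall>x\<in>carrier V. vnorm V (T x) = vnorm V x)}\<rparr>"

definition strong_operator_group_topology :: "'v normed \<Rightarrow> ('v \<Rightarrow> 'v) topology" where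
  "strong_operator_group_topology V =
     subtopology (product_topology (\<lambda>_. norm_topology V) (carrier V))
       (carrier (isometry_group V))"

section \<open>Rosenthal representability\<close>

definition representation ::
  "('g, 'm) monoid_scheme \<Rightarrow> 'g topology \<Rightarrow> 'x topology \<Rightarrow> ('g \<Rightarrow> 'x \<Rightarrow> 'x) \<Rightarrow>
   'v normed \<Rightarrow> ('g \<Rightarrow> 'v \<Rightarrow> 'v) \<Rightarrow> ('x \<Rightarrow> 'v \<Rightarrow> real) \<Rightarrow> bool" where
  "representation G T X act V h \<alpha> \<longleftrightarrow>
     h \<in> carrier G \<rightarrow> carrier (isometry_group V) \<and>
     (\<forall>g\<^sub>1\<in>carrier G. \<forall>g\<^sub>2\<in>carrier G. h (g\<^sub>1 \<otimes>\<^bsub>G\<^esub> g\<^sub>2) = h g\<^sub>2 \<otimes>\<^bsub>isometry_group V\<^esub> h g\<^sub>1) \<and>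
     continuous_map T (strong_operator_group_topology V) h \<and>
     continuous_map X (weak_star_topology V) \<alpha> \<and>
     (\<exists>C. \<forall>x\<in>topspace X. dual_norm V (\<alpha> x) \<le> C) \<and>
     (\<forall>v\<in>carrier V. \<forall>g\<in>carrier G. \<forall>x\<in>topspace X. \<alpha> (act g x) v = \<alpha> x (h g v))"

text \<open>The type argument \<open>'v\<close> is the type whose subsets serve as underlying sets of the Banach
  spaces. For every choice of it the predicate implies representability on some
  Rosenthal Banach space.\<close>

definition rosenthal_representable_system ::
  "'v itself \<Rightarrow> ('g, 'm) monoid_scheme \<Rightarrow> 'g topology \<Rightarrow> 'x topology \<Rightarrow>
   ('g \<Rightarrow> 'x \<Rightarrow> 'x) \<Rightarrow> bool" where
  "rosenthal_representable_system (_ :: 'v itself) G T X act \<longleftrightarrow>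
     (\<exists>(V :: 'v normed) h \<alpha>. rosenthal_space V \<and> representation G T X act V h \<alpha> \<and>
        embedding_map X (weak_star_topology V) \<alpha>)"

definition rosenthal_representable_group ::
  "'v itself \<Rightarrow> ('g, 'm) monoid_scheme \<Rightarrow> 'g topology \<Rightarrow> bool" where
  "rosenthal_representable_group (_ :: 'v itself) G T \<longleftrightarrow> topological_group G T \<and>
     (\<exists>(V :: 'v normed) H \<psi>. rosenthal_space V \<and> subgroup H (isometry_group V) \<and>
        \<psi> \<in> iso G ((isometry_group V)\<lparr>carrier := H\<rparr>) \<and>
        homeomorphic_map T (subtopology (strong_operator_group_topology V) H) \<psi>)"

section \<open>Tameness\<close>

definition independent_sequence :: "'x set \<Rightarrow> (nat \<Rightarrow> 'x \<Rightarrow> real) \<Rightarrow> bool" where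
  "independent_sequence X f \<longleftrightarrow>
     (\<exists>a b. a < b \<and>
        (\<forall>P M. finite P \<and> finite M \<and> P \<inter> M = {} \<longrightarrow>
           {x \<in> X. (\<forall>n\<in>P. f n x < a) \<and> (\<forall>n\<in>M. b < f n x)} \<noteq> {}))"

definition tame_system ::
  "('g, 'm) monoid_scheme \<Rightarrow> 'x topology \<Rightarrow> ('g \<Rightarrow> 'x \<Rightarrow> 'x) \<Rightarrow> bool" where
  "tame_system G X act \<longleftrightarrow>
     (\<forall>f. continuous_map X euclideanreal f \<longrightarrow>
        \<not> (\<exists>F. range F \<subseteq> {\<lambda>x. f (act g x) | g. g \<in> carrier G} \<and>
              independent_sequence (topspace X) F))"

end

(*
  Call a component of D - {w} a half-space. Two half-spaces never cross, so their traces on a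
  finite set of points are nested, and the points can be listed x_1, ..., x_M in such a way that
  every half-space separates at most two of the pairs (x_i, x_{i+1}). Say that such a family of
  pairs is a pairing. Variations over pairings give homeomorphism-invariant notions of bounded
  variation and of quadratic variation. Urysohn functions built along chains of half-spaces have
  variation at most 2 and separate points.

  V is the closure of the continuous functions of bounded variation in the norm
  sup |f| + (quadratic variation), and G acts on it by composition. The orbit maps are continuous
  because the square of the quadratic variation is at most 2 sup |f| times the variation.
  V contains no copy of l_1: n functions bounded in V map D to a set in R^n that is covered by a
  number of balls of radius e * sqrt n independent of n, so some signed average of them is
  uniformly small; blocks of this kind that are uniformly small enough are almost orthogonal for
  the quadratic variation, and the average of m of them has norm of order 1 / sqrt m up to a small
  uniform error. This contradicts a lower l_1 estimate.
*)

theory Submission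
  imports Defs
begin

text \<open>Neither of the two obvious norms works, already for an arc. In the sup norm the
  functions of bounded variation are dense among all continuous functions, a space that contains
  l_1. In the variation norm the absolutely continuous functions form a copy of L^1 up to constants,
  and orbit maps can be discontinuous (the Cantor function under small translations). The
  intermediate norm is useful because uniform smallness together with a variation bound forces it to
  be small. That mechanism needs genuine bounded variation, hence the closure of such functions
  instead of all continuous functions of finite quadratic variation. The dendron is not assumed
  metrizable and arcs are never constructed: finite sets of points and half-spaces replace the order
  of an arc. The bound 2 for pairings comes from the two ends of an interval in a list. Tameness is
  obtained by a direct count rather than through the representation: independence of n translates
  needs 2^n points, while the available total variation is linear in n. Composition reverses the
  order of products, so the embedding of the homeomorphism group composes with inverses.\<close>

section \<open>Half-spaces of a dendron\<close>

definition halfspace_at :: "'a topology \<Rightarrow> 'a \<Rightarrow> 'a set \<Rightarrow> bool" where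
  "halfspace_at D w H \<longleftrightarrow> openin D H \<and> connectedin D H \<and> connectedin D (topspace D - H) \<and>
     w \<in> topspace D - H \<and> closedin D (insert w H)"

definition halfspace :: "'a topology \<Rightarrow> 'a set \<Rightarrow> bool" where
  "halfspace D H \<longleftrightarrow> (\<exists>w. halfspace_at D w H)"

lemma dendron_separate:
  assumes "dendron D" "u \<in> topspace D" "v \<in> topspace D" "u \<noteq> v"
  obtains w U V where "w \<in> topspace D" "openin D U" "openin D V" "U \<inter> V = {}"
    "topspace D - {w} = U \<union> V" "u \<in> U" "v \<in> V"
  using assms unfolding dendron_def by metis

text \<open>Adding \<open>V\<close> to the part that contains \<open>w\<close> turns a separation of
  \<open>insert w U\<close> into a separation of \<open>D\<close>.\<close>

lemma connectedin_insert_cut_point: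
  assumes D: "connected_space D" and U: "openin D U" and V: "openin D V" and "U \<inter> V = {}"
    and eq: "topspace D - {w} = U \<union> V" and w: "w \<in> topspace D"
  shows "connectedin D (insert w U)"
proof -
  have False_if: False if "openin D A" "openin D B" "insert w U \<subseteq> A \<union> B" "A \<inter> B \<inter> insert w U = {}"
    "A \<inter> insert w U \<noteq> {}" "w \<in> B" for A B
  proof (rule connected_spaceD [OF D])
    show "openin D (A \<inter> U)" "openin D (B \<union> V)" using U V that by auto
    show "topspace D \<subseteq> A \<inter> U \<union> (B \<union> V)" using eq that by blast
    show "A \<inter> U \<inter> (B \<union> V) = {}" using that assms(4) by blast
    show "A \<inter> U \<noteq> {}" using that by blast
    show "B \<union> V \<noteq> {}" using that by blast
  qed
  show ?thesis
    unfolding connectedin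
  proof (intro conjI notI, use w openin_subset [OF U] in blast, elim exE conjE)
    fix A B
    assume AB: "openin D A" "openin D B" "insert w U \<subseteq> A \<union> B" "A \<inter> B \<inter> insert w U = {}"
      "A \<inter> insert w U \<noteq> {}" "B \<inter> insert w U \<noteq> {}"
    then consider "w \<in> A" | "w \<in> B" by blast
    then show False
    proof cases
      case 1
      then show False using False_if [of B A] AB by (simp add: Int_commute Un_commute)
    next
      case 2
      then show False using False_if [of A B] AB by simp
    qed
  qed
qed

lemma connectedin_separation_subset:
  assumes "connectedin D C" "openin D U" "openin D V" "U \<inter> V = {}"
    "topspace D - {w} = U \<union> V" "w \<notin> C" "x \<in> C" "x \<in> U"
  shows "C \<subseteq> U"
proof (rule ccontr)
  assume "\<not> C \<subseteq> U"
  moreover have "C \<subseteq> U \<union> V"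
    using assms connectedin_subset_topspace by blast
  ultimately show False
    using assms unfolding connectedin by blast
qed

lemma connectedin_subset_halfspace:
  assumes H: "halfspace_at D w H" and C: "connectedin D C" "w \<notin> C" "x \<in> C" "x \<in> H"
  shows "C \<subseteq> H"
proof (rule connectedin_separation_subset [OF C(1) _ _ _ _ C(2-4)])
  show "openin D (topspace D - insert w H)"
    using H by (auto simp: halfspace_at_def)
qed (use H in \<open>auto simp: halfspace_at_def dest: openin_subset\<close>)

lemma connectedin_avoid_halfspace:
  assumes H: "halfspace_at D w H" and C: "connectedin D C" "w \<notin> C"
  shows "C \<subseteq> H \<or> C \<inter> H = {}"
  using connectedin_subset_halfspace [OF H C] by blast

text \<open>The cut point \<open>b\<close> of \<open>B\<close> lies in only one of the connected
  sets \<open>A\<close> and \<open>topspace D - A\<close>. The other one avoids \<open>b\<close>, so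
  it lies inside \<open>B\<close> or misses it; the two cases give the four alternatives.\<close>

lemma halfspace_laminar:
  assumes A: "halfspace D A" and B: "halfspace D B"
  shows "A \<inter> B = {} \<or> A \<subseteq> B \<or> B \<subseteq> A \<or> topspace D \<subseteq> A \<union> B"
proof -
  obtain b where b: "halfspace_at D b B"
    using B by (auto simp: halfspace_def)
  have con: "connectedin D A" "connectedin D (topspace D - A)" and "B \<subseteq> topspace D"
    using A b by (auto simp: halfspace_def halfspace_at_def dest: openin_subset)
  show ?thesis
  proof (cases "b \<in> A")
    case True
    then show ?thesis
      using connectedin_avoid_halfspace [OF b con(2)] \<open>B \<subseteq> topspace D\<close> by blast
  next
    case False
    then show ?thesis
      using connectedin_avoid_halfspace [OF b con(1) False] by blast
  qed
qed

lemma connectedin_insert_halfspace: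
  assumes "connected_space D" "halfspace_at D w H"
  shows "connectedin D (insert w H)"
  using assms openin_subset [of D H]
  by (intro connectedin_insert_cut_point [of D H "topspace D - insert w H"])
    (auto simp: halfspace_at_def)

text \<open>The point is that components of the complement of \<open>w\<close> are open, although
  local connectedness is not assumed. If \<open>z\<close> separates \<open>w\<close> from
  \<open>x\<close>, then the side of \<open>x\<close> together with \<open>z\<close> is connected
  and avoids \<open>w\<close>, so this side is a neighbourhood of \<open>x\<close> inside its
  component. The rest of the complement is then open as a union of components, and the cut-point
  lemma makes \<open>topspace D - C\<close> connected.\<close>

lemma halfspace_at_component:
  assumes D: "dendron D" and w: "w \<in> topspace D" and a: "a \<in> topspace D" "a \<noteq> w"
  defines "C \<equiv> connected_component_of_set (subtopology D (topspace D - {w})) a"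
  shows "halfspace_at D w C"
proof -
  define Y where "Y = subtopology D (topspace D - {w})"
  have con: "connected_space D" and T2: "Hausdorff_space D"
    using D by (auto simp: dendron_def continuum_def)
  have topY: "topspace Y = topspace D - {w}"
    by (auto simp: Y_def)
  have open_comp: "openin D (connected_component_of_set Y y)" for y
  proof (subst openin_subopen, intro ballI)
    fix x assume x: "x \<in> connected_component_of_set Y y"
    then have xD: "x \<in> topspace D" "x \<noteq> w"
      using connected_component_of_subset_topspace [of Y y] by (auto simp: topY)
    obtain z S T where z: "z \<in> topspace D" "openin D S" "openin D T" "S \<inter> T = {}"
        "topspace D - {z} = S \<union> T" "w \<in> S" "x \<in> T"
      using dendron_separate [OF D w xD(1)] xD(2) by (metis (no_types))
    have "connectedin D (insert z T)"
      using z by (intro connectedin_insert_cut_point [OF con, of T S]) auto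
    moreover have "w \<notin> insert z T" "insert z T \<subseteq> topspace D"
      using z openin_subset [of D T] by blast+
    ultimately have "connectedin Y (insert z T)"
      by (auto simp: Y_def connectedin_subtopology)
    then have "insert z T \<subseteq> connected_component_of_set Y x"
      using z by (intro connected_component_of_maximal) auto
    moreover have "connected_component_of_set Y x = connected_component_of_set Y y"
      using x by (metis connected_component_of_equiv mem_Collect_eq)
    ultimately show "\<exists>T. openin D T \<and> x \<in> T \<and> T \<subseteq> connected_component_of_set Y y"
      using z by blast
  qed
  have C: "C = connected_component_of_set Y a"
    by (simp add: C_def Y_def)
  have oC: "openin D C" using open_comp C by simp
  have wC: "w \<notin> C" and CD: "C \<subseteq> topspace D"
    using connected_component_of_subset_topspace [of Y a] by (auto simp: topY C)
  have oR: "openin D (topspace D - insert w C)"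
  proof (subst openin_subopen, intro ballI)
    fix x assume x: "x \<in> topspace D - insert w C"
    then have "x \<in> connected_component_of_set Y x"
      by (simp add: connected_component_of_refl topY)
    moreover have "disjnt (connected_component_of_set Y x) C"
      unfolding C connected_component_of_disjoint
      using x C connected_component_of_sym [of Y] by auto
    moreover have "connected_component_of_set Y x \<subseteq> topspace D - {w}"
      using connected_component_of_subset_topspace [of Y x] by (auto simp: topY)
    ultimately show "\<exists>T. openin D T \<and> x \<in> T \<and> T \<subseteq> topspace D - insert w C"
      using open_comp [of x] by (intro exI [of _ "connected_component_of_set Y x"]) (auto simp: disjnt_def)
  qed
  have "connectedin D C"
    using connectedin_connected_component_of [of Y a] by (auto simp: C Y_def connectedin_subtopology)
  moreover have "connectedin D (insert w (topspace D - insert w C))"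
    using w wC CD by (intro connectedin_insert_cut_point [OF con oR oC]) auto
  moreover have "insert w (topspace D - insert w C) = topspace D - C"
    using w wC by auto
  ultimately show ?thesis
    using oC oR w wC CD by (auto simp: halfspace_at_def closedin_def)
qed

text \<open>This is the density step of the chain: a point \<open>w\<close> separating
  \<open>a\<close> from \<open>b\<close> yields a half-space strictly between. \<open>w\<close> is
  not in \<open>A\<close>, since otherwise the connected complement of \<open>A\<close>, which
  contains \<open>a\<close> and \<open>b\<close>, would avoid \<open>w\<close>. For the last clause
  \<open>w\<close> is in \<open>B\<close>, since otherwise \<open>insert b B\<close> would join
  \<open>a\<close> to \<open>b\<close> while avoiding \<open>w\<close>.\<close>

lemma halfspace_extend:
  assumes D: "dendron D" and A: "halfspace_at D a A" and b: "b \<in> topspace D" "b \<notin> insert a A"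
  obtains w C where "halfspace_at D w C" "insert a A \<subseteq> C" "b \<notin> insert w C"
    "\<And>B. halfspace_at D b B \<Longrightarrow> insert a A \<subseteq> B \<Longrightarrow> insert w C \<subseteq> B"
proof -
  have con: "connected_space D"
    using D by (auto simp: dendron_def continuum_def)
  have aD: "a \<in> topspace D" "a \<notin> A" using A by (auto simp: halfspace_at_def)
  obtain w U V where w: "w \<in> topspace D" "openin D U" "openin D V" "U \<inter> V = {}"
      "topspace D - {w} = U \<union> V" "a \<in> U" "b \<in> V"
    using dendron_separate [OF D aD(1) b(1)] b(2) by (metis (no_types) insertI1)
  have wab: "w \<noteq> a" "w \<noteq> b" using w by blast+
  have "w \<notin> A"
  proof
    assume "w \<in> A"
    then have "topspace D - A \<subseteq> U"
      using A aD w by (intro connectedin_separation_subset [OF _ w(2-5)]) (auto simp: halfspace_at_def)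
    then show False using b w by blast
  qed
  define C where "C = connected_component_of_set (subtopology D (topspace D - {w})) a"
  have C: "halfspace_at D w C"
    unfolding C_def using D w aD wab by (intro halfspace_at_component) auto
  have conA: "connectedin D (insert a A)"
    using connectedin_insert_halfspace [OF con A] .
  have "connectedin (subtopology D (topspace D - {w})) (insert a A)"
    using conA connectedin_subset_topspace [OF conA] \<open>w \<notin> A\<close> wab by (auto simp: connectedin_subtopology)
  then have AC: "insert a A \<subseteq> C"
    unfolding C_def by (intro connected_component_of_maximal) auto
  have "C \<subseteq> U"
    using C AC w by (intro connectedin_separation_subset [OF _ w(2-5), of C a]) (auto simp: halfspace_at_def)
  then have bC: "b \<notin> insert w C" using w by blast
  moreover have "insert w C \<subseteq> B" if B: "halfspace_at D b B" "insert a A \<subseteq> B" for B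
  proof -
    have conB: "connectedin D (insert b B)"
      using connectedin_insert_halfspace [OF con B(1)] .
    have "w \<in> B"
    proof (rule ccontr)
      assume "w \<notin> B"
      then have "insert b B \<subseteq> U"
        using B w wab by (intro connectedin_separation_subset [OF conB w(2-5), of a]) auto
      then show False using w by blast
    qed
    then show ?thesis
      using connectedin_subset_halfspace [OF B(1) connectedin_insert_halfspace [OF con C] bC] by blast
  qed
  ultimately show thesis using that C AC by blast
qed

section \<open>Urysohn functions along chains of half-spaces\<close>

lemma dyadic_between:
  fixes x y :: real
  assumes "0 \<le> x" "x < y"
  obtains r where "r \<in> dyadics" "x < r" "r < y"
proof -
  obtain n where n: "(1/2) ^ n < y - x"
    using real_arch_pow_inv [of "y - x" "1/2"] assms by auto
  define k where "k = nat \<lfloor>x * 2 ^ n\<rfloor> + 1"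
  have k: "x * 2 ^ n < real k" "real k \<le> x * 2 ^ n + 1"
    using assms by (auto simp: k_def) linarith+
  have "x < real k / 2 ^ n" using k(1) by (simp add: field_simps)
  moreover have "real k / 2 ^ n < y"
  proof -
    have "real k / 2 ^ n \<le> (x * 2 ^ n + 1) / 2 ^ n" using k(2) by (simp add: divide_right_mono)
    also have "\<dots> = x + (1/2) ^ n" by (simp add: field_simps)
    finally show ?thesis using n by simp
  qed
  ultimately show thesis using that by (force simp: dyadics_def)
qed

text \<open>Urysohn's construction along a chain of half-spaces indexed by the dyadic rationals.\<close>

lemma dendron_halfspace_function:
  assumes D: "dendron D" and uv: "u \<in> topspace D" "v \<in> topspace D" "u \<noteq> v"
  obtains f :: "'a \<Rightarrow> real" and G :: "real \<Rightarrow> 'a set"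
  where "continuous_map D euclideanreal f" "f u = 0" "f v = 1" "\<And>x. f x \<in> {0..1}"
    "\<And>r. r \<in> dyadics \<inter> {0..1} \<Longrightarrow> halfspace D (G r)"
    "\<And>r x. r \<in> dyadics \<inter> {0..1} \<Longrightarrow> x \<in> G r \<Longrightarrow> f x \<le> r"
    "\<And>r x. r \<in> dyadics \<inter> {0..1} \<Longrightarrow> x \<notin> G r \<Longrightarrow> r \<le> f x"
proof -
  \<comment> \<open>The cut points are carried along because the nesting must be strict as in
    Urysohn's lemma: the closed set \<open>insert a A\<close> lies in the open set
    \<open>B\<close>.\<close>
  define R where "R = (\<lambda>(a, A) (b, B). halfspace_at D a A \<and> halfspace_at D b B \<and> insert a A \<subseteq> B)"
  obtain w U V where w: "w \<in> topspace D" "openin D U" "openin D V" "U \<inter> V = {}"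
      "topspace D - {w} = U \<union> V" "u \<in> U" "v \<in> V"
    by (rule dendron_separate [OF D uv])
  define A where "A = connected_component_of_set (subtopology D (topspace D - {w})) u"
  have wuv: "w \<noteq> u" "w \<noteq> v" using w by blast+
  have A: "halfspace_at D w A"
    unfolding A_def using D w uv wuv by (intro halfspace_at_component) auto
  have uA: "u \<in> A"
    using uv wuv by (simp add: A_def connected_component_of_refl)
  have "A \<subseteq> U"
    using A uA w by (intro connectedin_separation_subset [OF _ w(2-5), of A u]) (auto simp: halfspace_at_def)
  then have "v \<notin> insert w A" using w by blast
  then obtain w' B where B: "halfspace_at D w' B" "insert w A \<subseteq> B" "v \<notin> insert w' B"
    using halfspace_extend [OF D A uv(2)] by metis
  have "\<exists>F. F 0 = (w, A) \<and> F 1 = (w', B) \<and>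
     (\<forall>x \<in> dyadics \<inter> {0..1::real}. \<forall>y \<in> dyadics \<inter> {0..1}. x < y \<longrightarrow> R (F x) (F y))"
  proof (rule recursion_on_dyadic_fractions)
    show "R (w, A) (w', B)" using A B by (simp add: R_def)
    show "\<exists>z. R x z \<and> R z y" if xy: "R x y" for x y
    proof -
      obtain a X b Y where eq: "x = (a, X)" "y = (b, Y)" by (cases x, cases y) auto
      then have R: "halfspace_at D a X" "halfspace_at D b Y" "insert a X \<subseteq> Y"
        using xy by (auto simp: R_def)
      then have "b \<in> topspace D" "b \<notin> insert a X"
        by (auto simp: halfspace_at_def)
      then obtain c C where "halfspace_at D c C" "insert a X \<subseteq> C" "insert c C \<subseteq> Y"
        using halfspace_extend [OF D R(1)] R by metis
      then have "R x (c, C) \<and> R (c, C) y"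
        using R eq by (auto simp: R_def)
      then show ?thesis by blast
    qed
    show "R x z" if "R x y" "R y z" for x y z
      using that by (auto simp: R_def)
  qed
  then obtain F where F: "F 0 = (w, A)" "F 1 = (w', B)"
    "\<And>x y. x \<in> dyadics \<inter> {0..1::real} \<Longrightarrow> y \<in> dyadics \<inter> {0..1} \<Longrightarrow> x < y \<Longrightarrow> R (F x) (F y)"
    by blast
  define I where "I = dyadics \<inter> {0..1::real}"
  define G where "G r = snd (F r)" for r
  define c where "c r = fst (F r)" for r
  have I01: "0 \<in> I" "1 \<in> I"
    using real_in_dyadics [of 0] real_in_dyadics [of 1] by (auto simp: I_def)
  have GG: "insert (c r) (G r) \<subseteq> G s" if "r \<in> I" "s \<in> I" "r < s" for r s
    using F(3) [of r s] that by (auto simp: R_def I_def G_def c_def split: prod.splits)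
  \<comment> \<open>The recursion only yields facts about pairs, so an index below 1 is compared
    with 1, and the index 1 with 0.\<close>
  have half: "halfspace_at D (c r) (G r)" if r: "r \<in> I" for r
  proof (cases "r < 1")
    case True
    then show ?thesis
      using F(3) [of r 1] r I01 by (auto simp: R_def I_def G_def c_def split: prod.splits)
  next
    case False
    then show ?thesis
      using F(3) [of 0 r] r I01 by (auto simp: R_def I_def G_def c_def split: prod.splits)
  qed
  \<comment> \<open>The inserted 1 is the value at points outside every \<open>G r\<close>, and
    keeps the infimum over a nonempty set.\<close>
  define f where "f x = Inf (insert 1 {r \<in> I. x \<in> G r})" for x
  have bdd: "bdd_below {r \<in> I. x \<in> G r}" for x
    by (auto simp: bdd_below_def I_def)
  have f01: "f x \<in> {0..1}" for x
    using bdd [of x] unfolding f_def by (auto intro!: cInf_greatest cInf_lower simp: I_def)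
  have fle: "f x \<le> r" if "r \<in> I" "x \<in> G r" for r x
    using that bdd [of x] unfolding f_def by (auto intro!: cInf_lower)
  have fge: "r \<le> f x" if "r \<in> I" "x \<notin> G r" for r x
    unfolding f_def
  proof (rule cInf_greatest)
    fix s assume "s \<in> insert 1 {r \<in> I. x \<in> G r}"
    then show "r \<le> s"
      using that GG [of s r] I01 by (cases "s < r") (auto simp: I_def)
  qed auto
  have "f u = 0"
    using fle [OF I01(1), of u] uA f01 [of u] F by (auto simp: G_def)
  moreover have "f v = 1"
    using fge [OF I01(2), of v] B f01 [of v] F by (auto simp: G_def)
  moreover have "continuous_map D euclideanreal f"
    unfolding continuous_map_upper_lower_semicontinuous_lt
  proof (intro conjI allI)
    fix t
    show "openin D {x \<in> topspace D. t < f x}"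
    proof (subst openin_subopen, clarify)
      fix x assume x: "x \<in> topspace D" "t < f x"
      show "\<exists>T. openin D T \<and> x \<in> T \<and> T \<subseteq> {x \<in> topspace D. t < f x}"
      proof (cases "t < 0")
        case True
        then have "topspace D \<subseteq> {x \<in> topspace D. t < f x}"
          using f01 by (fastforce intro: less_le_trans)
        then show ?thesis using x by blast
      next
        case False
        \<comment> \<open>Two dyadics are chosen because \<open>G r\<close> is open: the open
          neighbourhood of \<open>x\<close> is the complement of the smaller closed set
          \<open>insert (c s) (G s)\<close>, on which \<open>f\<close> is at least
          \<open>s\<close>.\<close>
        then obtain r where r: "r \<in> dyadics" "t < r" "r < f x"
          using dyadic_between [of t "f x"] x by auto
        then obtain s where s: "s \<in> dyadics" "t < s" "s < r"
          using dyadic_between [of t r] False by auto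
        have rs: "r \<in> I" "s \<in> I"
          using r s False f01 [of x] by (auto simp: I_def)
        have "x \<notin> G r" using fle [OF rs(1), of x] r by auto
        then have "x \<in> topspace D - insert (c s) (G s)"
          using x GG [OF rs(2,1) s(3)] by auto
        moreover have "openin D (topspace D - insert (c s) (G s))"
          using half [OF rs(2)] by (auto simp: halfspace_at_def)
        moreover have "t < f y" if "y \<in> topspace D - insert (c s) (G s)" for y
          using fge [OF rs(2), of y] that s by auto
        ultimately show ?thesis by blast
      qed
    qed
    show "openin D {x \<in> topspace D. f x < t}"
    proof (subst openin_subopen, clarify)
      fix x assume x: "x \<in> topspace D" "f x < t"
      show "\<exists>T. openin D T \<and> x \<in> T \<and> T \<subseteq> {x \<in> topspace D. f x < t}"
      proof (cases "1 < t")
        case True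
        then have "topspace D \<subseteq> {x \<in> topspace D. f x < t}"
          using f01 by (fastforce intro: le_less_trans)
        then show ?thesis using x by blast
      next
        case False
        then obtain r where r: "r \<in> dyadics" "f x < r" "r < t"
          using dyadic_between [of "f x" t] x f01 [of x] by auto
        have rI: "r \<in> I"
          using r False f01 [of x] by (auto simp: I_def)
        have "x \<in> G r" using fge [OF rI, of x] r by auto
        moreover have "openin D (G r)" using half [OF rI] by (auto simp: halfspace_at_def)
        moreover have "f y < t" if "y \<in> G r" for y
          using fle [OF rI that] r by auto
        ultimately show ?thesis using openin_subset by blast
      qed
    qed
  qed
  ultimately show thesis
    using that [of f G] f01 half fle fge by (auto simp: I_def halfspace_def)
qed

section \<open>Pairings and variation\<close>

text \<open>The finite families of pairs over which variations are computed. Inside an arc, the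
  consecutive pairs of a partition form such a family.\<close>

definition pairings :: "'a topology \<Rightarrow> ('a \<times> 'a) set set" where
  "pairings D = {P. finite P \<and> P \<subseteq> topspace D \<times> topspace D \<and>
     (\<forall>H. halfspace D H \<longrightarrow> card {p \<in> P. (fst p \<in> H) \<noteq> (snd p \<in> H)} \<le> 2)}"

lemma finite_pairing: "P \<in> pairings D \<Longrightarrow> finite P"
  by (simp add: pairings_def)

lemma empty_pairing: "{} \<in> pairings D"
  by (simp add: pairings_def)

text \<open>Take a nonempty proper trace \<open>A\<close> of maximal size and list its points before
  the others, each group ordered by induction. Every other trace is disjoint from \<open>A\<close>,
  inside \<open>A\<close>, or strictly larger; in the last case maximality forces it to be all of
  \<open>X\<close>. So no trace has to be assembled from pieces of both groups unless it is
  everything.\<close>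

lemma laminar_interval_order:
  assumes "finite X"
    and "\<And>A B. A \<in> F \<Longrightarrow> B \<in> F \<Longrightarrow> A \<inter> B \<inter> X = {} \<or> A \<inter> X \<subseteq> B \<or> B \<inter> X \<subseteq> A"
  shows "\<exists>xs. distinct xs \<and> set xs = X \<and>
    (\<forall>A\<in>F. \<exists>us vs ws. xs = us @ vs @ ws \<and> set vs = A \<inter> X)"
  using assms
proof (induction X rule: finite_psubset_induct)
  case (psubset X)
  show ?case
  proof (cases "\<exists>A\<in>F. A \<inter> X \<noteq> {} \<and> A \<inter> X \<noteq> X")
    case False
    obtain xs where xs: "distinct xs" "set xs = X"
      using finite_distinct_list [OF psubset.hyps(1)] by blast
    have "\<exists>us vs ws. xs = us @ vs @ ws \<and> set vs = A \<inter> X" if "A \<in> F" for A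
    proof (cases "A \<inter> X = {}")
      case True
      then show ?thesis by (intro exI [of _ "[]"] exI [of _ xs]) auto
    next
      case nonempty: False
      then have "A \<inter> X = X" using False that by blast
      then show ?thesis using xs by (intro exI [of _ "[]"] exI [of _ xs]) auto
    qed
    then show ?thesis using xs by blast
  next
    case True
    define Q where "Q A \<longleftrightarrow> A \<in> F \<and> A \<inter> X \<noteq> {} \<and> A \<inter> X \<noteq> X" for A
    have "\<exists>A. Q A" using True by (auto simp: Q_def)
    moreover have "\<forall>A. Q A \<longrightarrow> card (A \<inter> X) < Suc (card X)"
      using psubset.hyps(1) by (auto intro: card_mono le_imp_less_Suc)
    ultimately obtain A where A: "Q A" and A_max: "\<And>B. Q B \<Longrightarrow> card (B \<inter> X) \<le> card (A \<inter> X)"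
      using ex_has_greatest_nat [of Q _ "\<lambda>A. card (A \<inter> X)" "Suc (card X)"] by blast
    have "A \<inter> X \<subset> X" "X - A \<subset> X" using A by (auto simp: Q_def)
    have lam: "B \<inter> C \<inter> Y = {} \<or> B \<inter> Y \<subseteq> C \<or> C \<inter> Y \<subseteq> B"
      if "B \<in> F" "C \<in> F" "Y \<subset> X" for B C Y
      using psubset.prems [OF that(1,2)] that(3) by blast
    have "\<exists>xs. distinct xs \<and> set xs = A \<inter> X \<and>
        (\<forall>B\<in>F. \<exists>us vs ws. xs = us @ vs @ ws \<and> set vs = B \<inter> (A \<inter> X))"
      by (rule psubset.IH [OF \<open>A \<inter> X \<subset> X\<close>], rule lam) (use \<open>A \<inter> X \<subset> X\<close> in auto)
    then obtain ys where ys: "distinct ys" "set ys = A \<inter> X"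
        "\<And>B. B \<in> F \<Longrightarrow> \<exists>us vs ws. ys = us @ vs @ ws \<and> set vs = B \<inter> (A \<inter> X)"
      by metis
    have "\<exists>xs. distinct xs \<and> set xs = X - A \<and>
        (\<forall>B\<in>F. \<exists>us vs ws. xs = us @ vs @ ws \<and> set vs = B \<inter> (X - A))"
      by (rule psubset.IH [OF \<open>X - A \<subset> X\<close>], rule lam) (use \<open>X - A \<subset> X\<close> in auto)
    then obtain zs where zs: "distinct zs" "set zs = X - A"
        "\<And>B. B \<in> F \<Longrightarrow> \<exists>us vs ws. zs = us @ vs @ ws \<and> set vs = B \<inter> (X - A)"
      by metis
    have "\<exists>us vs ws. ys @ zs = us @ vs @ ws \<and> set vs = B \<inter> X" if B: "B \<in> F" for B
    proof -
      consider "A \<inter> B \<inter> X = {}" | "B \<inter> X \<subseteq> A" | "A \<inter> X \<subset> B \<inter> X"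
        using psubset.prems [of A B] A B by (auto simp: Q_def)
      then show ?thesis
      proof cases
        case 1
        obtain us vs ws where eq: "zs = us @ vs @ ws" and vs: "set vs = B \<inter> (X - A)"
          using zs(3) [OF B] by blast
        have "set vs = B \<inter> X" unfolding vs using 1 by blast
        then show ?thesis using eq
          by (intro exI [of _ "ys @ us"] exI [of _ vs] exI [of _ ws]) simp
      next
        case 2
        obtain us vs ws where eq: "ys = us @ vs @ ws" and vs: "set vs = B \<inter> (A \<inter> X)"
          using ys(3) [OF B] by blast
        have "set vs = B \<inter> X" unfolding vs using 2 by blast
        then show ?thesis using eq
          by (intro exI [of _ us] exI [of _ vs] exI [of _ "ws @ zs"]) simp
      next
        case 3
        then have "card (A \<inter> X) < card (B \<inter> X)"
          using psubset.hyps(1) by (intro psubset_card_mono) auto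
        then have "\<not> Q B" using A_max [of B] by auto
        then have "B \<inter> X = X" using 3 B by (auto simp: Q_def)
        then show ?thesis using ys(2) zs(2)
          by (intro exI [of _ "[]"] exI [of _ "ys @ zs"]) auto
      qed
    qed
    moreover have "distinct (ys @ zs)" "set (ys @ zs) = X" using ys zs by auto
    ultimately show ?thesis by blast
  qed
qed

lemma nth_append_middle_iff:
  assumes "distinct (us @ vs @ ws)" and i: "i < length (us @ vs @ ws)"
  shows "(us @ vs @ ws) ! i \<in> set vs \<longleftrightarrow> length us \<le> i \<and> i < length us + length vs"
proof -
  have disj: "set us \<inter> set vs = {}" "set ws \<inter> set vs = {}" using assms(1) by auto
  consider "i < length us" | "length us \<le> i" "i < length us + length vs" | "length us + length vs \<le> i"
    by linarith
  then show ?thesis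
  proof cases
    case 1
    then have "(us @ vs @ ws) ! i \<in> set us" by (simp add: nth_append)
    then show ?thesis using 1 disj by auto
  next
    case 2
    then have "i - length us < length vs" by linarith
    then have "(us @ vs @ ws) ! i \<in> set vs" using 2 by (simp add: nth_append)
    then show ?thesis using 2 by auto
  next
    case 3
    then have "\<not> i - length us < length vs" "i - length us - length vs < length ws" using i by auto
    then have "(us @ vs @ ws) ! i \<in> set ws" using 3 i by (simp add: nth_append)
    then show ?thesis using 3 disj by auto
  qed
qed

text \<open>Orient every half-space away from one of the points: the resulting traces are laminar, so
  the points can be enumerated with every trace an interval, and consecutive points form a
  pairing.\<close>

lemma finite_set_pairing:
  assumes X: "finite X" "X \<subseteq> topspace D"
  obtains P where "P \<in> pairings D" "card P = card X - 1"
    "\<And>p. p \<in> P \<Longrightarrow> fst p \<in> X \<and> snd p \<in> X \<and> fst p \<noteq> snd p"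
proof (cases "X = {}")
  case True
  then show thesis using that [of "{}"] by (simp add: empty_pairing)
next
  case False
  then obtain x0 where x0: "x0 \<in> X" by blast
  \<comment> \<open>No set \<open>away H\<close> contains \<open>x0\<close>. Two half-spaces that
    cover \<open>D\<close> therefore have disjoint or nested orientations, which removes the fourth
    alternative of \<open>halfspace_laminar\<close>.\<close>
  define away where "away H = (if x0 \<in> H then topspace D - H else H)" for H
  define F where "F = away ` {H. halfspace D H}"
  have lam: "A \<inter> B \<inter> X = {} \<or> A \<inter> X \<subseteq> B \<or> B \<inter> X \<subseteq> A" if AB: "A \<in> F" "B \<in> F" for A B
  proof -
    obtain H K where H: "halfspace D H" "A = away H" and K: "halfspace D K" "B = away K"
      using AB by (auto simp: F_def)
    have "x0 \<in> topspace D" "H \<subseteq> topspace D" "K \<subseteq> topspace D"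
      using x0 X H K by (auto simp: halfspace_def halfspace_at_def dest: openin_subset)
    moreover have "H \<inter> K = {} \<or> H \<subseteq> K \<or> K \<subseteq> H \<or> topspace D \<subseteq> H \<union> K"
      using halfspace_laminar [OF H(1) K(1)] .
    ultimately show ?thesis
      unfolding H(2) K(2) away_def by (cases "x0 \<in> H"; cases "x0 \<in> K"; simp; blast)
  qed
  have "\<exists>xs. distinct xs \<and> set xs = X \<and>
      (\<forall>A\<in>F. \<exists>us vs ws. xs = us @ vs @ ws \<and> set vs = A \<inter> X)"
    by (rule laminar_interval_order [OF X(1)], rule lam)
  then obtain xs where xs: "distinct xs" "set xs = X"
    and int: "\<And>A. A \<in> F \<Longrightarrow> \<exists>us vs ws. xs = us @ vs @ ws \<and> set vs = A \<inter> X"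
    by metis
  define I where "I = {i. Suc i < length xs}"
  define e where "e i = (xs ! i, xs ! Suc i)" for i
  have I: "I = {..<length xs - 1}" by (auto simp: I_def)
  have inj: "inj_on e I"
    using xs(1) by (auto simp: inj_on_def e_def I_def nth_eq_iff_index_eq)
  have mem: "xs ! i \<in> X" if "i < length xs" for i
    using xs(2) that nth_mem by blast
  have "card {p \<in> e ` I. (fst p \<in> H) \<noteq> (snd p \<in> H)} \<le> 2" if H: "halfspace D H" for H
  proof -
    obtain us vs ws where uvw: "xs = us @ vs @ ws" "set vs = away H \<inter> X"
      using int [of "away H"] H by (auto simp: F_def)
    have away: "x \<in> away H \<longleftrightarrow> (x \<in> H \<longleftrightarrow> x0 \<notin> H)" if "x \<in> X" for x
      using that X by (auto simp: away_def)
    have iff: "xs ! i \<in> away H \<longleftrightarrow> length us \<le> i \<and> i < length us + length vs" if i: "i < length xs" for i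
    proof -
      have "xs ! i \<in> away H \<longleftrightarrow> xs ! i \<in> set vs" using uvw mem [OF i] by simp
      also have "\<dots> \<longleftrightarrow> length us \<le> i \<and> i < length us + length vs"
        using xs(1) i unfolding uvw(1) by (rule nth_append_middle_iff)
      finally show ?thesis .
    qed
    \<comment> \<open>Only the pairs straddling the two ends of the interval \<open>vs\<close> are
      separated. If \<open>us\<close> is empty, truncated subtraction gives the index 0, which
      merely enlarges the right-hand side.\<close>
    have "{p \<in> e ` I. (fst p \<in> H) \<noteq> (snd p \<in> H)} \<subseteq> e ` {length us - 1, length us + length vs - 1}"
    proof
      fix p assume "p \<in> {p \<in> e ` I. (fst p \<in> H) \<noteq> (snd p \<in> H)}"
      then obtain i where p: "p = e i" and i: "i \<in> I" "(fst (e i) \<in> H) \<noteq> (snd (e i) \<in> H)"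
        by blast
      then have "(xs ! i \<in> away H) \<noteq> (xs ! Suc i \<in> away H)"
        using away [OF mem, of i] away [OF mem, of "Suc i"] by (auto simp: e_def I_def)
      then have "i = length us - 1 \<or> i = length us + length vs - 1"
        using iff [of i] iff [of "Suc i"] i(1) by (auto simp: I_def)
      then show "p \<in> e ` {length us - 1, length us + length vs - 1}" using p by blast
    qed
    then have "card {p \<in> e ` I. (fst p \<in> H) \<noteq> (snd p \<in> H)} \<le> card (e ` {length us - 1, length us + length vs - 1})"
      by (intro card_mono) auto
    also have "\<dots> \<le> card {length us - 1, length us + length vs - 1}"
      by (intro card_image_le) auto
    also have "\<dots> \<le> 2" by (simp add: card_insert_if)
    finally show ?thesis .
  qed
  moreover have "e ` I \<subseteq> topspace D \<times> topspace D"
    using mem X(2) by (auto simp: e_def I_def subset_iff)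
  ultimately have "e ` I \<in> pairings D" by (simp add: pairings_def I)
  moreover have "card (e ` I) = card X - 1"
    using card_image [OF inj] distinct_card [OF xs(1)] xs(2) by (simp add: I)
  moreover have "fst p \<in> X \<and> snd p \<in> X \<and> fst p \<noteq> snd p" if "p \<in> e ` I" for p
    using that mem xs(1) by (auto simp: e_def I_def nth_eq_iff_index_eq)
  ultimately show thesis using that by blast
qed

text \<open>Measures the length of an interval by counting grid levels inside it, with error at most
  1. Applied to the two values of a function at a pair, it turns variation into a count of levels
  that separate the pair.\<close>

lemma card_multiples_between:
  fixes a b :: real
  assumes "0 \<le> a" "b \<le> 1" "0 < N"
  shows "real N * (b - a) - 1 \<le> card {k \<in> {..N}. a < real k / real N \<and> real k / real N < b}"
proof (cases "a < b")
  case False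
  then have "real N * (b - a) \<le> 0" by (simp add: mult_nonneg_nonpos)
  then show ?thesis by linarith
next
  case True
  define i j where "i = nat \<lfloor>N * a\<rfloor>" and "j = nat \<lceil>N * b\<rceil>"
  have i: "real i \<le> N * a" "N * a < real i + 1" and j: "N * b \<le> real j" "real j < N * b + 1"
    using assms True by (auto simp: i_def j_def) (linarith | simp add: of_nat_nat)+
  have "{i<..<j} \<subseteq> {k \<in> {..N}. a < real k / real N \<and> real k / real N < b}"
  proof clarify
    fix k assume "k \<in> {i<..<j}"
    then have "real i + 1 \<le> k" "real k + 1 \<le> j" by auto
    then have "N * a < k" "k < N * b" using i j by auto
    moreover have "real N * b \<le> real N * 1" using assms by (intro mult_left_mono) auto
    ultimately have "real k < N" and "N * a < k" "k < N * b" by linarith+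
    then show "k \<in> {..N} \<and> a < real k / real N \<and> real k / real N < b"
      using assms by (simp add: field_simps)
  qed
  then have "card {i<..<j} \<le> card {k \<in> {..N}. a < real k / real N \<and> real k / real N < b}"
    by (intro card_mono) auto
  moreover have "real N * (b - a) - 1 \<le> real (card {i<..<j})"
    using i j by (simp add: algebra_simps)
  ultimately show ?thesis by linarith
qed

section \<open>Variation over pairings, and functions for which it is bounded\<close>

definition variation :: "('a \<times> 'a) set \<Rightarrow> ('a \<Rightarrow> real) \<Rightarrow> real" where
  "variation P f = (\<Sum>p\<in>P. \<bar>f (fst p) - f (snd p)\<bar>)"

text \<open>The value 0 off the space gives every continuous function on \<open>D\<close> a single
  representative and lets suprema range over the whole type.\<close>

definition cfunctions :: "'a topology \<Rightarrow> ('a \<Rightarrow> real) set" where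
  "cfunctions D = {f. continuous_map D euclideanreal f \<and> (\<forall>x. x \<notin> topspace D \<longrightarrow> f x = 0)}"

definition bv_functions :: "'a topology \<Rightarrow> ('a \<Rightarrow> real) set" where
  "bv_functions D = {f \<in> cfunctions D. \<exists>M. \<forall>P\<in>pairings D. variation P f \<le> M}"

text \<open>Double counting of pairs against the levels k / 2^m, a discrete form of Banach's
  indicatrix formula. A pair whose values lie strictly on both sides of \<open>r\<close> is
  separated by \<open>G r\<close>, so each level meets at most two pairs. The N + 1 levels give N
  times the variation at most 2 N + 2 + \<open>card P\<close>; for fixed \<open>P\<close> the error
  vanishes as m grows.\<close>

lemma variation_halfspace_function:
  assumes P: "P \<in> pairings D" and f: "\<And>x. f x \<in> {0..1::real}"
    and G: "\<And>r. r \<in> dyadics \<inter> {0..1} \<Longrightarrow> halfspace D (G r)"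
    and le: "\<And>r x. r \<in> dyadics \<inter> {0..1} \<Longrightarrow> x \<in> G r \<Longrightarrow> f x \<le> r"
    and ge: "\<And>r x. r \<in> dyadics \<inter> {0..1} \<Longrightarrow> x \<notin> G r \<Longrightarrow> r \<le> f x"
  shows "variation P f \<le> 2"
proof -
  define S where "S = variation P f"
  have fin: "finite P" using P by (rule finite_pairing)
  have bound: "S \<le> 2 + (2 + card P) * (1/2) ^ m" for m
  proof -
    define N :: nat where "N = 2 ^ m"
    have N: "0 < N" by (simp add: N_def)
    define lo hi where "lo p = min (f (fst p)) (f (snd p))" and "hi p = max (f (fst p)) (f (snd p))" for p
    have "real N * \<bar>f (fst p) - f (snd p)\<bar> - 1 \<le> card {k \<in> {..N}. lo p < real k / real N \<and> real k / real N < hi p}" for p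
    proof -
      have "hi p - lo p = \<bar>f (fst p) - f (snd p)\<bar>" by (auto simp: hi_def lo_def)
      moreover have "0 \<le> lo p" "hi p \<le> 1" using f by (auto simp: hi_def lo_def)
      ultimately show ?thesis using card_multiples_between [OF _ _ N, of "lo p" "hi p"] by simp
    qed
    then have "(\<Sum>p\<in>P. real N * \<bar>f (fst p) - f (snd p)\<bar> - 1) \<le> (\<Sum>p\<in>P. real (card {k \<in> {..N}. lo p < real k / real N \<and> real k / real N < hi p}))"
      by (intro sum_mono)
    also have "\<dots> = real (\<Sum>k\<in>{..N}. card {p \<in> P. lo p < real k / real N \<and> real k / real N < hi p})"
      using sum_card_image [of P] sum.swap_restrict [OF fin, of "{..N}" "\<lambda>_ _. 1::nat" "\<lambda>p k. lo p < real k / real N \<and> real k / real N < hi p"]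
      by (simp flip: of_nat_sum)
    also have "(\<Sum>k\<in>{..N}. card {p \<in> P. lo p < real k / real N \<and> real k / real N < hi p}) \<le> (\<Sum>k\<in>{..N}. 2)"
    proof (intro sum_mono)
      fix k assume k: "k \<in> {..N}"
      define r where "r = real k / real N"
      have r: "r \<in> dyadics \<inter> {0..1}"
        using k N unfolding r_def N_def by (auto simp: dyadics_def)
      have sep: "(fst p \<in> G r) \<noteq> (snd p \<in> G r)" if "lo p < r" "r < hi p" for p
        using that le [OF r, of "fst p"] le [OF r, of "snd p"] ge [OF r, of "fst p"] ge [OF r, of "snd p"]
        by (auto simp: lo_def hi_def min_def max_def split: if_splits)
      have "card {p \<in> P. lo p < r \<and> r < hi p} \<le> card {p \<in> P. (fst p \<in> G r) \<noteq> (snd p \<in> G r)}"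
        using sep fin by (intro card_mono) auto
      also have "\<dots> \<le> 2" using P G [OF r] by (simp add: pairings_def)
      finally show "card {p \<in> P. lo p < real k / real N \<and> real k / real N < hi p} \<le> 2" by (simp add: r_def)
    qed
    finally have "(\<Sum>p\<in>P. real N * \<bar>f (fst p) - f (snd p)\<bar> - 1) \<le> 2 * real N + 2"
      by simp
    moreover have "(\<Sum>p\<in>P. real N * \<bar>f (fst p) - f (snd p)\<bar> - 1) = N * S - card P"
      by (simp add: S_def variation_def sum_subtractf sum_distrib_left)
    ultimately have "S \<le> (2 * real N + 2 + card P) / N"
      using N by (simp add: field_simps)
    also have "\<dots> = 2 + (2 + card P) * (1/2) ^ m"
      using N by (simp add: field_simps N_def)
    finally show ?thesis .
  qed
  have "(\<lambda>m. 2 + real (2 + card P) * (1/2) ^ m) \<longlonglongrightarrow> 2 + real (2 + card P) * 0"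
    by (intro tendsto_intros LIMSEQ_power_zero) auto
  then show ?thesis
    using bound LIMSEQ_le_const [of _ "2 + real (2 + card P) * 0" S] by (simp add: S_def)
qed

lemma bv_functions_separate:
  assumes D: "dendron D" and uv: "u \<in> topspace D" "v \<in> topspace D" "u \<noteq> v"
  obtains f where "f \<in> bv_functions D" "f u \<noteq> f v"
proof -
  obtain f and G :: "real \<Rightarrow> 'a set" where f: "continuous_map D euclideanreal f" "f u = 0" "f v = 1"
    and fG: "\<And>x. f x \<in> {0..1}"
    "\<And>r. r \<in> dyadics \<inter> {0..1} \<Longrightarrow> halfspace D (G r)"
    "\<And>r x. r \<in> dyadics \<inter> {0..1} \<Longrightarrow> x \<in> G r \<Longrightarrow> f x \<le> r"
    "\<And>r x. r \<in> dyadics \<inter> {0..1} \<Longrightarrow> x \<notin> G r \<Longrightarrow> r \<le> f x"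
    by (rule dendron_halfspace_function [OF D uv]) blast
  define g where "g x = (if x \<in> topspace D then f x else 0)" for x
  have "continuous_map D euclideanreal g"
    using f(1) by (rule continuous_map_eq) (simp add: g_def)
  moreover have "variation P g \<le> 2" if P: "P \<in> pairings D" for P
  proof -
    have "variation P g = variation P f"
      unfolding variation_def using P by (intro sum.cong) (auto simp: g_def pairings_def)
    then show ?thesis using variation_halfspace_function [OF P fG] by simp
  qed
  ultimately have "g \<in> bv_functions D"
    by (auto simp: bv_functions_def cfunctions_def g_def)
  moreover have "g u \<noteq> g v" using f uv by (simp add: g_def)
  ultimately show thesis using that by blast
qed

section \<open>Normed spaces of functions\<close>

text \<open>The common algebraic part of \<open>l1_space\<close> and \<open>bv_space\<close>:
  operations are pointwise, so facts about modules, metrics and linear maps are proved once for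
  both.\<close>

definition function_space :: "('b \<Rightarrow> real) normed \<Rightarrow> bool" where
  "function_space V \<longleftrightarrow>
     zero V = (\<lambda>t. 0) \<and> add V = (\<lambda>x y t. x t + y t) \<and> smult V = (\<lambda>a x t. a * x t) \<and>
     (\<lambda>t. 0) \<in> carrier V \<and>
     (\<forall>x\<in>carrier V. \<forall>y\<in>carrier V. (\<lambda>t. x t + y t) \<in> carrier V) \<and>
     (\<forall>a. \<forall>x\<in>carrier V. (\<lambda>t. a * x t) \<in> carrier V)"

lemma cring_real_ring: "cring real_ring"
proof (intro cringI abelian_groupI comm_monoidI)
  show "\<exists>y\<in>carrier real_ring. y \<oplus>\<^bsub>real_ring\<^esub> x = \<zero>\<^bsub>real_ring\<^esub>" for x
    by (intro bexI [of _ "- x"]) (auto simp: real_ring_def)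
qed (auto simp: real_ring_def algebra_simps)

lemma function_space_abelian_group:
  assumes "function_space V"
  shows "abelian_group V"
proof (rule abelian_groupI)
  show "\<exists>y\<in>carrier V. y \<oplus>\<^bsub>V\<^esub> x = \<zero>\<^bsub>V\<^esub>" if "x \<in> carrier V" for x
  proof
    show "(\<lambda>t. (-1) * x t) \<in> carrier V" using assms that unfolding function_space_def by blast
  qed (use assms in \<open>simp add: function_space_def\<close>)
qed (use assms in \<open>auto simp: function_space_def algebra_simps\<close>)

lemma function_space_module:
  assumes "function_space V"
  shows "Module.module real_ring V"
proof (rule moduleI)
  show "cring real_ring" by (rule cring_real_ring)
  show "abelian_group V" using assms by (rule function_space_abelian_group)
qed (use assms in \<open>auto simp: function_space_def real_ring_def algebra_simps\<close>)

lemma function_space_diff: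
  assumes V: "function_space V" and x: "x \<in> carrier V" and y: "y \<in> carrier V"
  shows "x \<ominus>\<^bsub>V\<^esub> y = (\<lambda>t. x t - y t)" "(\<lambda>t. x t - y t) \<in> carrier V"
proof -
  interpret abelian_group V using V by (rule function_space_abelian_group)
  have m: "(\<lambda>t. (-1) * y t) \<in> carrier V" using V y unfolding function_space_def by blast
  have "\<ominus>\<^bsub>V\<^esub> y = (\<lambda>t. (-1) * y t)"
    using V m y by (intro minus_equality) (auto simp: function_space_def)
  then show "x \<ominus>\<^bsub>V\<^esub> y = (\<lambda>t. x t - y t)"
    using V by (simp add: a_minus_def function_space_def)
  then show "(\<lambda>t. x t - y t) \<in> carrier V" using minus_closed [OF x y] by simp
qed

lemma function_space_dist:
  assumes "function_space V" "x \<in> carrier V" "y \<in> carrier V"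
  shows "norm_dist V x y = vnorm V (\<lambda>t. x t - y t)"
  using assms function_space_diff [OF assms] by (simp add: norm_dist_def)

lemma function_space_normedI:
  assumes V: "function_space V"
    and nonneg: "\<And>x. x \<in> carrier V \<Longrightarrow> 0 \<le> vnorm V x"
    and definite: "\<And>x. x \<in> carrier V \<Longrightarrow> vnorm V x = 0 \<Longrightarrow> x = (\<lambda>t. 0)"
    and scale: "\<And>a x. x \<in> carrier V \<Longrightarrow> vnorm V (\<lambda>t. a * x t) = \<bar>a\<bar> * vnorm V x"
    and triangle: "\<And>x y. x \<in> carrier V \<Longrightarrow> y \<in> carrier V \<Longrightarrow>
       vnorm V (\<lambda>t. x t + y t) \<le> vnorm V x + vnorm V y"
  shows "normed_space V"
proof -
  have "vnorm V (\<lambda>t. 0) = 0"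
    using scale [of "\<lambda>t. 0" 0] V by (simp add: function_space_def)
  then have "vnorm V x = 0 \<longleftrightarrow> x = (\<lambda>t. 0)" if "x \<in> carrier V" for x
    using definite that by blast
  then show ?thesis
    using V function_space_module [OF V] nonneg scale triangle
    by (simp add: normed_space_def function_space_def)
qed

lemma function_space_add_closed:
  assumes "function_space V" "x \<in> carrier V" "y \<in> carrier V"
  shows "(\<lambda>t. x t + y t) \<in> carrier V"
  using assms by (simp add: function_space_def)

lemma function_space_scale_closed:
  assumes "function_space V" "x \<in> carrier V"
  shows "(\<lambda>t. a * x t) \<in> carrier V"
  using assms by (simp add: function_space_def)

lemma linear_map_add:
  assumes "function_space W" "function_space V" "linear_map W V T" "x \<in> carrier W" "y \<in> carrier W"
  shows "T (\<lambda>t. x t + y t) = (\<lambda>s. T x s + T y s)"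
  using assms by (simp add: function_space_def linear_map_def)

lemma linear_map_scale:
  assumes "function_space W" "function_space V" "linear_map W V T" "x \<in> carrier W"
  shows "T (\<lambda>t. a * x t) = (\<lambda>s. a * T x s)"
  using assms by (simp add: function_space_def linear_map_def)

lemma function_space_scale:
  assumes "function_space V" "normed_space V" "x \<in> carrier V"
  shows "vnorm V (\<lambda>t. a * x t) = \<bar>a\<bar> * vnorm V x"
  using assms by (simp add: normed_space_def function_space_def)

lemma function_space_triangle:
  assumes "function_space V" "normed_space V" "x \<in> carrier V" "y \<in> carrier V"
  shows "vnorm V (\<lambda>t. x t + y t) \<le> vnorm V x + vnorm V y"
  using assms by (simp add: normed_space_def function_space_def)

lemma function_space_metric:
  assumes V: "function_space V" and N: "normed_space V"
  shows "Metric_space (carrier V) (norm_dist V)"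
proof
  have scale: "vnorm V (\<lambda>t. a * x t) = \<bar>a\<bar> * vnorm V x" if "x \<in> carrier V" for a x
    by (rule function_space_scale [OF V N that])
  have diff: "(\<lambda>t. x t - y t) \<in> carrier V" if "x \<in> carrier V" "y \<in> carrier V" for x y
    using function_space_diff(2) [OF V that] .
  show "0 \<le> norm_dist V x y" for x y
  proof (cases "x \<in> carrier V \<and> y \<in> carrier V")
    case True
    then show ?thesis
      using N diff by (simp add: function_space_dist [OF V] normed_space_def)
  qed (auto simp: norm_dist_def)
  show "norm_dist V x y = norm_dist V y x" for x y
  proof (cases "x \<in> carrier V \<and> y \<in> carrier V")
    case True
    then show ?thesis
      using scale [OF diff [of x y], of "-1"] by (simp add: function_space_dist [OF V])
  qed (auto simp: norm_dist_def)
  show "norm_dist V x y = 0 \<longleftrightarrow> x = y" if "x \<in> carrier V" "y \<in> carrier V" for x y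
  proof -
    have "norm_dist V x y = 0 \<longleftrightarrow> (\<lambda>t. x t - y t) = (\<lambda>t. 0)"
      using N V diff [OF that] that by (simp add: function_space_dist [OF V] normed_space_def function_space_def)
    then show ?thesis by (auto simp: fun_eq_iff)
  qed
  show "norm_dist V x z \<le> norm_dist V x y + norm_dist V y z"
    if xyz: "x \<in> carrier V" "y \<in> carrier V" "z \<in> carrier V" for x y z
  proof -
    have "vnorm V (\<lambda>t. (x t - y t) + (y t - z t)) \<le> vnorm V (\<lambda>t. x t - y t) + vnorm V (\<lambda>t. y t - z t)"
      by (rule function_space_triangle [OF V N diff diff]) (use xyz in auto)
    then show ?thesis using xyz by (simp add: function_space_dist [OF V])
  qed
qed

section \<open>Norm topology and bounds for linear maps\<close>

lemma function_space_topspace: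
  assumes "function_space V" "normed_space V"
  shows "topspace (norm_topology V) = carrier V"
  unfolding norm_topology_def
  using Metric_space.topspace_mtopology [OF function_space_metric [OF assms]] .

lemma continuous_map_norm_topology:
  assumes V: "function_space V" and N: "normed_space V" and f: "f \<in> topspace T \<rightarrow> carrier V"
  shows "continuous_map T (norm_topology V) f \<longleftrightarrow>
    (\<forall>x\<in>topspace T. \<forall>e>0. \<exists>U. openin T U \<and> x \<in> U \<and>
      (\<forall>y\<in>U. vnorm V (\<lambda>t. f x t - f y t) < e))"
proof -
  interpret M: Metric_space "carrier V" "norm_dist V"
    using V N by (rule function_space_metric)
  have "f y \<in> M.mball (f x) e \<longleftrightarrow> vnorm V (\<lambda>t. f x t - f y t) < e"
    if "x \<in> topspace T" "y \<in> topspace T" for x y e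
    using f that function_space_dist [OF V, of "f x" "f y"] by (auto simp: Pi_iff)
  moreover have "y \<in> topspace T" if "openin T U" "y \<in> U" for U y
    using that openin_subset by blast
  ultimately show ?thesis
    unfolding norm_topology_def M.continuous_map_to_metric by meson
qed

lemma continuous_map_real_norm_topology:
  assumes V: "function_space V" and N: "normed_space V"
    and \<phi>: "\<And>x y. x \<in> carrier V \<Longrightarrow> y \<in> carrier V \<Longrightarrow> \<bar>\<phi> x - \<phi> y\<bar> \<le> vnorm V (\<lambda>t. x t - y t)"
  shows "continuous_map (norm_topology V) euclideanreal \<phi>"
proof -
  interpret M: Metric_space "carrier V" "norm_dist V"
    using V N by (rule function_space_metric)
  show ?thesis
    unfolding norm_topology_def mtopology_is_euclidean [symmetric]
      M.metric_continuous_map [OF Met_TC.Metric_space_axioms]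
    using \<phi> by (force simp: function_space_dist [OF V] dist_real_def)
qed

lemma function_space_linear_sum:
  fixes T :: "('b \<Rightarrow> real) \<Rightarrow> 'c \<Rightarrow> real"
  assumes W: "function_space W" and V: "function_space V" and T: "linear_map W V T"
    and e: "\<And>i. e i \<in> carrier W"
  shows "(\<lambda>t. \<Sum>i<n. c i * e i t) \<in> carrier W \<and>
    T (\<lambda>t. \<Sum>i<(n::nat). c i * e i t) = (\<lambda>s. \<Sum>i<n. c i * T (e i) s)"
proof (induction n)
  case 0
  \<comment> \<open>Linearity does not list preservation of 0, so the empty sum is written as a
    vector scaled by 0.\<close>
  have "T (\<lambda>t. 0 * e 0 t) = (\<lambda>s. 0 * T (e 0) s)"
    using e by (rule linear_map_scale [OF W V T])
  then show ?case using W by (simp add: function_space_def)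
next
  case (Suc n)
  have c: "(\<lambda>t. c n * e n t) \<in> carrier W"
    using e by (rule function_space_scale_closed [OF W])
  have "(\<lambda>t. (\<Sum>i<n. c i * e i t) + c n * e n t) \<in> carrier W"
    using Suc c by (intro function_space_add_closed [OF W]) auto
  moreover have "T (\<lambda>t. (\<Sum>i<n. c i * e i t) + c n * e n t) =
      (\<lambda>s. T (\<lambda>t. \<Sum>i<n. c i * e i t) s + T (\<lambda>t. c n * e n t) s)"
    using Suc c by (intro linear_map_add [OF W V T]) auto
  moreover have "T (\<lambda>t. c n * e n t) = (\<lambda>s. c n * T (e n) s)"
    using e by (rule linear_map_scale [OF W V T])
  ultimately show ?case using Suc by simp
qed

text \<open>An embedding is open onto its image, so the image of the unit ball contains all image
  vectors of norm below some \<open>r\<close>. By injectivity \<open>vnorm V (T x) < r\<close>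
  forces \<open>vnorm W x < 1\<close>; scaling a vector to norm 1 gives the estimate.\<close>

lemma linear_embedding_lower_bound:
  fixes T :: "('b \<Rightarrow> real) \<Rightarrow> 'c \<Rightarrow> real"
  assumes W: "function_space W" "normed_space W" and V: "function_space V" "normed_space V"
    and T: "linear_map W V T" and emb: "embedding_map (norm_topology W) (norm_topology V) T"
  obtains \<delta> where "0 < \<delta>" "\<And>x. x \<in> carrier W \<Longrightarrow> \<delta> * vnorm W x \<le> vnorm V (T x)"
proof -
  interpret W: Metric_space "carrier W" "norm_dist W" using W by (rule function_space_metric)
  interpret V: Metric_space "carrier V" "norm_dist V" using V by (rule function_space_metric)
  have 0: "(\<lambda>t. 0) \<in> carrier W" using W by (simp add: function_space_def)
  have T0: "T (\<lambda>t. 0) = (\<lambda>s. 0)"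
    using function_space_linear_sum [OF W(1) V(1) T, of "\<lambda>_ _. 0" _ 0] 0 by simp
  have TV: "T x \<in> carrier V" if "x \<in> carrier W" for x
    using T that by (auto simp: linear_map_def)
  have hom: "homeomorphic_map (norm_topology W) (subtopology (norm_topology V) (T ` carrier W)) T"
    using emb by (simp add: embedding_map_def function_space_topspace [OF W])
  have inj: "inj_on T (carrier W)"
    using homeomorphic_imp_injective_map [OF hom] by (simp add: function_space_topspace [OF W])
  define B where "B = W.mball (\<lambda>t. 0) 1"
  have "openin (norm_topology W) B" by (simp add: norm_topology_def B_def)
  then have "openin (subtopology (norm_topology V) (T ` carrier W)) (T ` B)"
    using homeomorphic_imp_open_map [OF hom] by (simp add: open_map_def)
  then obtain U where U: "openin (norm_topology V) U" "T ` B = U \<inter> T ` carrier W"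
    by (auto simp: openin_subtopology)
  have "T (\<lambda>t. 0) \<in> T ` B" using 0 by (auto simp: B_def)
  then have "(\<lambda>s. 0) \<in> U" using U T0 by auto
  then obtain r where r: "0 < r" "V.mball (\<lambda>s. 0) r \<subseteq> U"
    using U(1) V.openin_mtopology by (auto simp: norm_topology_def)
  have lt1: "vnorm W x < 1" if x: "x \<in> carrier W" "vnorm V (T x) < r" for x
  proof -
    have neg: "vnorm V (\<lambda>s. - T x s) = vnorm V (T x)"
    proof -
      have "vnorm V (\<lambda>s. (-1) * T x s) = \<bar>-1\<bar> * vnorm V (T x)"
        by (rule function_space_scale [OF V TV [OF x(1)]])
      then show ?thesis by simp
    qed
    have "(\<lambda>s. 0) \<in> carrier V" using V by (simp add: function_space_def)
    then have "T x \<in> V.mball (\<lambda>s. 0) r"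
      using x TV neg by (simp add: function_space_dist [OF V(1)])
    then have "T x \<in> T ` B" using r U x by blast
    then obtain y where y: "y \<in> B" "T x = T y" by blast
    then have "y \<in> carrier W" by (auto simp: B_def)
    then have "x = y" using inj x(1) y(2) by (meson inj_onD)
    then have "norm_dist W x (\<lambda>t. 0) < 1" using y W.commute by (auto simp: B_def)
    then show ?thesis using x 0 by (simp add: function_space_dist [OF W(1)])
  qed
  have "r / 2 * vnorm W x \<le> vnorm V (T x)" if x: "x \<in> carrier W" for x
  proof (rule ccontr)
    assume neg: "\<not> ?thesis"
    have nn: "0 \<le> vnorm V (T x)" "0 \<le> vnorm W x"
      using V W TV [OF x] x by (auto simp: normed_space_def)
    then have pos: "0 < vnorm W x" using neg r(1) by (cases "vnorm W x = 0") auto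
    define a where "a = 1 / vnorm W x"
    have ax: "(\<lambda>t. a * x t) \<in> carrier W" using W x by (auto simp: function_space_def)
    have "T (\<lambda>t. a * x t) = (\<lambda>s. a * T x s)"
      using x by (rule linear_map_scale [OF W(1) V(1) T])
    moreover have "vnorm V (\<lambda>s. a * T x s) = \<bar>a\<bar> * vnorm V (T x)"
      by (rule function_space_scale [OF V TV [OF x]])
    ultimately have "vnorm V (T (\<lambda>t. a * x t)) = a * vnorm V (T x)"
      using pos by (simp add: a_def)
    also have "\<dots> < r"
    proof -
      have "vnorm V (T x) < r * vnorm W x" using neg pos r(1) mult_pos_pos [OF r(1) pos] by linarith
      then show ?thesis using pos by (simp add: a_def field_simps)
    qed
    finally have "vnorm W (\<lambda>t. a * x t) < 1" using lt1 [OF ax] by blast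
    moreover have "vnorm W (\<lambda>t. a * x t) = \<bar>a\<bar> * vnorm W x"
      by (rule function_space_scale [OF W x])
    ultimately show False using pos by (simp add: a_def)
  qed
  then show thesis using that [of "r / 2"] r(1) by auto
qed

lemma linear_continuous_upper_bound:
  fixes T :: "('b \<Rightarrow> real) \<Rightarrow> 'c \<Rightarrow> real"
  assumes W: "function_space W" "normed_space W" and V: "function_space V" "normed_space V"
    and T: "linear_map W V T" and cont: "continuous_map (norm_topology W) (norm_topology V) T"
  obtains C where "\<And>x. x \<in> carrier W \<Longrightarrow> vnorm W x \<le> 1 \<Longrightarrow> vnorm V (T x) \<le> C"
proof -
  interpret W: Metric_space "carrier W" "norm_dist W" using W by (rule function_space_metric)
  have 0: "(\<lambda>t. 0) \<in> carrier W" using W by (simp add: function_space_def)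
  have T0: "T (\<lambda>t. 0) = (\<lambda>s. 0)"
    using function_space_linear_sum [OF W(1) V(1) T, of "\<lambda>_ _. 0" _ 0] 0 by simp
  have TV: "T \<in> carrier W \<rightarrow> carrier V"
    using T by (auto simp: linear_map_def)
  have scale: "vnorm V (\<lambda>s. a * v s) = \<bar>a\<bar> * vnorm V v" if "v \<in> carrier V" for a v
    by (rule function_space_scale [OF V that])
  have scaleW: "vnorm W (\<lambda>s. a * v s) = \<bar>a\<bar> * vnorm W v" if "v \<in> carrier W" for a v
    by (rule function_space_scale [OF W that])
  obtain U where U: "openin (norm_topology W) U" "(\<lambda>t. 0) \<in> U"
      "\<And>y. y \<in> U \<Longrightarrow> vnorm V (\<lambda>s. T (\<lambda>t. 0) s - T y s) < 1"
    using cont 0 TV by (subst (asm) continuous_map_norm_topology [OF V])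
      (auto simp: function_space_topspace [OF W], metis zero_less_one)
  then obtain r where r: "0 < r" "W.mball (\<lambda>t. 0) r \<subseteq> U"
    using W.openin_mtopology by (auto simp: norm_topology_def)
  have "vnorm V (T x) \<le> 2 / r" if x: "x \<in> carrier W" "vnorm W x \<le> 1" for x
  proof -
    \<comment> \<open>The minus sign is there because continuity at 0 bounds
      \<open>T 0 - T y\<close>, which thereby becomes \<open>r / 2\<close> times
      \<open>T x\<close>.\<close>
    define y where "y = (\<lambda>t. - (r / 2) * x t)"
    have y: "y \<in> carrier W"
      unfolding y_def using x(1) by (rule function_space_scale_closed [OF W(1)])
    have Ty: "T y = (\<lambda>s. - (r / 2) * T x s)"
      unfolding y_def using x(1) by (rule linear_map_scale [OF W(1) V(1) T])
    have "(\<lambda>t. 0 - y t) = (\<lambda>t. (r / 2) * x t)" by (auto simp: y_def)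
    then have "vnorm W (\<lambda>t. 0 - y t) = r / 2 * vnorm W x"
      using scaleW [OF x(1), of "r / 2"] r by simp
    also have "\<dots> \<le> r / 2" using x r by (simp add: mult_left_le)
    also have "\<dots> < r" using r by simp
    finally have "y \<in> W.mball (\<lambda>t. 0) r"
      using 0 y by (simp add: function_space_dist [OF W(1)])
    then have "vnorm V (\<lambda>s. T (\<lambda>t. 0) s - T y s) < 1" using r U(3) by blast
    moreover have "(\<lambda>s. T (\<lambda>t. 0) s - T y s) = (\<lambda>s. r / 2 * T x s)"
      by (auto simp: T0 Ty)
    ultimately have "r / 2 * vnorm V (T x) < 1"
      using scale [of "T x" "r / 2"] TV x r by (simp add: Pi_iff)
    then show ?thesis using r by (simp add: field_simps)
  qed
  then show thesis using that by blast
qed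

section \<open>The sequence space l_1\<close>

lemma l1_function_space: "function_space l1_space"
proof -
  have "summable (\<lambda>n. \<bar>x n + y n\<bar>)" if "summable (\<lambda>n. \<bar>x n :: real\<bar>)" "summable (\<lambda>n. \<bar>y n\<bar>)" for x y
    by (rule summable_comparison_test' [OF summable_add [OF that], of 0]) (simp add: abs_triangle_ineq)
  then show ?thesis by (auto simp: function_space_def l1_space_def abs_mult intro: summable_mult)
qed

lemma l1_normed_space: "normed_space l1_space"
proof (rule function_space_normedI [OF l1_function_space])
  fix x y :: "nat \<Rightarrow> real" and a :: real
  assume x: "x \<in> carrier l1_space"
  then have sx: "summable (\<lambda>n. \<bar>x n\<bar>)" by (simp add: l1_space_def)
  show "0 \<le> vnorm l1_space x" using sx by (simp add: l1_space_def suminf_nonneg)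
  show "x = (\<lambda>t. 0)" if "vnorm l1_space x = 0"
    using that sx by (auto simp: l1_space_def suminf_eq_zero_iff)
  show "vnorm l1_space (\<lambda>t. a * x t) = \<bar>a\<bar> * vnorm l1_space x"
    using sx by (simp add: l1_space_def abs_mult suminf_mult)
  assume "y \<in> carrier l1_space"
  then have sy: "summable (\<lambda>n. \<bar>y n\<bar>)" by (simp add: l1_space_def)
  have "(\<lambda>t. x t + y t) \<in> carrier l1_space"
    using l1_function_space x \<open>y \<in> carrier l1_space\<close> by (simp add: function_space_def)
  then have "summable (\<lambda>n. \<bar>x n + y n\<bar>)" by (simp add: l1_space_def)
  then have "(\<Sum>n. \<bar>x n + y n\<bar>) \<le> (\<Sum>n. \<bar>x n\<bar> + \<bar>y n\<bar>)"
    by (intro suminf_le summable_add sx sy) (auto simp: abs_triangle_ineq)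
  then show "vnorm l1_space (\<lambda>t. x t + y t) \<le> vnorm l1_space x + vnorm l1_space y"
    using suminf_add [OF sx sy] by (simp add: l1_space_def)
qed

lemma l1_unit_vectors:
  fixes e :: "nat \<Rightarrow> nat \<Rightarrow> real"
  defines "e \<equiv> \<lambda>i t. if t = i then 1 else 0"
  shows "e i \<in> carrier l1_space" "vnorm l1_space (e i) = 1"
    "vnorm l1_space (\<lambda>t. \<Sum>i<n. c i * e i t) = (\<Sum>i<n. \<bar>c i\<bar>)"
proof -
  have norm: "(\<lambda>t. \<bar>\<Sum>i<n. c i * e i t\<bar>) sums (\<Sum>i<n. \<bar>c i\<bar>)" for n and c :: "nat \<Rightarrow> real"
  proof -
    have "(\<lambda>t. \<bar>\<Sum>i<n. c i * e i t\<bar>) = (\<lambda>t. if t \<in> {..<n} then \<bar>c t\<bar> else 0)"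
      by (auto simp: e_def if_distrib [of "\<lambda>u. _ * u"] sum.delta cong: if_cong)
    then show ?thesis using sums_If_finite_set [of "{..<n}" "\<lambda>t. \<bar>c t\<bar>"] by simp
  qed
  then show "vnorm l1_space (\<lambda>t. \<Sum>i<n. c i * e i t) = (\<Sum>i<n. \<bar>c i\<bar>)"
    by (simp add: l1_space_def sums_iff)
  have "(\<lambda>t. \<bar>e i t\<bar>) = (\<lambda>t. if t \<in> {i} then 1 else 0)" by (auto simp: e_def)
  then have "(\<lambda>t. \<bar>e i t\<bar>) sums 1" using sums_If_finite_set [of "{i}" "\<lambda>t. 1::real"] by simp
  then show "e i \<in> carrier l1_space" "vnorm l1_space (e i) = 1"
    by (auto simp: l1_space_def sums_iff)
qed

section \<open>The space of functions of quadratic variation\<close>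

definition qvariation :: "('a \<times> 'a) set \<Rightarrow> ('a \<Rightarrow> real) \<Rightarrow> real" where
  "qvariation P f = L2_set (\<lambda>p. f (fst p) - f (snd p)) P"

text \<open>The assertion that the norm is finite and at most \<open>C\<close>. It is kept apart
  from \<open>bv_norm\<close> because a real supremum carries no information when the set is
  unbounded. Letting \<open>x\<close> range over the whole type keeps the supremum nonempty even for
  an empty space.\<close>

definition bv_bounded :: "'a topology \<Rightarrow> ('a \<Rightarrow> real) \<Rightarrow> real \<Rightarrow> bool" where
  "bv_bounded D f C \<longleftrightarrow> (\<forall>x. \<forall>P\<in>pairings D. \<bar>f x\<bar> + qvariation P f \<le> C)"

definition bv_norm :: "'a topology \<Rightarrow> ('a \<Rightarrow> real) \<Rightarrow> real" where
  "bv_norm D f = (SUP (x, P)\<in>UNIV \<times> pairings D. \<bar>f x\<bar> + qvariation P f)"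

text \<open>The carrier expresses closure through \<open>bv_bounded\<close>, so that membership
  already includes finiteness of the distance to the approximants.\<close>

definition bv_space :: "'a topology \<Rightarrow> ('a \<Rightarrow> real) normed" where
  "bv_space D = \<lparr>carrier = {f \<in> cfunctions D. \<forall>e>0. \<exists>b\<in>bv_functions D. bv_bounded D (\<lambda>x. f x - b x) e},
     mult = (\<lambda>x y t. x t * y t), one = (\<lambda>t. 1), zero = (\<lambda>t. 0), add = (\<lambda>x y t. x t + y t),
     smult = (\<lambda>a x t. a * x t), vnorm = bv_norm D\<rparr>"

lemma qvariation_nonneg: "0 \<le> qvariation P f"
  by (simp add: qvariation_def)

lemma qvariation_add: "qvariation P (\<lambda>t. f t + g t) \<le> qvariation P f + qvariation P g"
  unfolding qvariation_def
  using L2_set_triangle_ineq [of "\<lambda>p. f (fst p) - f (snd p)" "\<lambda>p. g (fst p) - g (snd p)" P]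
  by (simp add: algebra_simps)

lemma qvariation_scale: "qvariation P (\<lambda>t. a * f t) = \<bar>a\<bar> * qvariation P f"
proof -
  have "(\<Sum>p\<in>P. (a * f (fst p) - a * f (snd p))\<^sup>2) = a\<^sup>2 * (\<Sum>p\<in>P. (f (fst p) - f (snd p))\<^sup>2)"
    unfolding sum_distrib_left by (intro sum.cong) (auto simp: power2_eq_square algebra_simps)
  then show ?thesis by (simp add: qvariation_def L2_set_def real_sqrt_mult)
qed

lemma qvariation_square: "(qvariation P f)\<^sup>2 = (\<Sum>p\<in>P. (f (fst p) - f (snd p))\<^sup>2)"
  by (simp add: qvariation_def L2_set_def sum_nonneg)

lemma variation_add: "variation P (\<lambda>t. f t + g t) \<le> variation P f + variation P g"
  unfolding variation_def sum.distrib [symmetric] by (intro sum_mono) linarith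

lemma variation_scale: "variation P (\<lambda>t. a * f t) = \<bar>a\<bar> * variation P f"
  unfolding variation_def sum_distrib_left
  by (simp add: abs_mult [symmetric] algebra_simps)

text \<open>Every increment is at most \<open>2 * s\<close>, so its square is at most
  \<open>2 * s\<close> times itself. This gives finiteness of the norm on
  \<open>bv_functions\<close> as well as continuity of the orbit maps.\<close>

lemma qvariation_square_le:
  assumes s: "\<And>x. \<bar>f x\<bar> \<le> s"
  shows "(qvariation P f)\<^sup>2 \<le> 2 * s * variation P f"
  unfolding qvariation_square variation_def sum_distrib_left
proof (intro sum_mono)
  fix p
  have "\<bar>f (fst p) - f (snd p)\<bar> \<le> 2 * s" using s [of "fst p"] s [of "snd p"] by linarith
  then have "\<bar>f (fst p) - f (snd p)\<bar> * \<bar>f (fst p) - f (snd p)\<bar> \<le> 2 * s * \<bar>f (fst p) - f (snd p)\<bar>"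
    by (intro mult_right_mono) auto
  then show "(f (fst p) - f (snd p))\<^sup>2 \<le> 2 * s * \<bar>f (fst p) - f (snd p)\<bar>"
    by (simp add: power2_eq_square)
qed

lemma bv_bounded_abs:
  assumes "bv_bounded D f C"
  shows "\<bar>f x\<bar> \<le> C"
proof -
  have "\<bar>f x\<bar> + qvariation {} f \<le> C"
    using assms empty_pairing unfolding bv_bounded_def by blast
  then show ?thesis using qvariation_nonneg [of "{}" f] by linarith
qed

lemma bv_bounded_abs_diff: "bv_bounded D (\<lambda>t. f t - g t) C \<Longrightarrow> \<bar>f x - g x\<bar> \<le> C"
  using bv_bounded_abs [of D "\<lambda>t. f t - g t" C x] by simp

lemma bv_bounded_qvariation:
  assumes "bv_bounded D f C" "P \<in> pairings D"
  shows "qvariation P f \<le> C"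
proof -
  have "\<bar>f undefined\<bar> + qvariation P f \<le> C"
    using assms unfolding bv_bounded_def by blast
  then show ?thesis by linarith
qed

lemma bv_bounded_nonneg: "bv_bounded D f C \<Longrightarrow> 0 \<le> C"
  using bv_bounded_abs [of D f C undefined] by linarith

lemma bv_bounded_mono: "bv_bounded D f C \<Longrightarrow> C \<le> C' \<Longrightarrow> bv_bounded D f C'"
  unfolding bv_bounded_def by (meson order_trans)

lemma bv_boundedI:
  assumes "\<And>x. \<bar>f x\<bar> \<le> A" "\<And>P. P \<in> pairings D \<Longrightarrow> qvariation P f \<le> B"
  shows "bv_bounded D f (A + B)"
  using assms by (auto simp: bv_bounded_def intro!: add_mono)

lemma bv_bounded_add:
  assumes "bv_bounded D f A" "bv_bounded D g B"
  shows "bv_bounded D (\<lambda>t. f t + g t) (A + B)"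
  unfolding bv_bounded_def
proof (intro allI ballI)
  fix x P assume "P \<in> pairings D"
  then have "\<bar>f x\<bar> + qvariation P f \<le> A" "\<bar>g x\<bar> + qvariation P g \<le> B"
    using assms by (auto simp: bv_bounded_def)
  then show "\<bar>f x + g x\<bar> + qvariation P (\<lambda>t. f t + g t) \<le> A + B"
    using qvariation_add [of P f g] abs_triangle_ineq [of "f x" "g x"] by linarith
qed

lemma bv_bounded_scale:
  assumes "bv_bounded D f A"
  shows "bv_bounded D (\<lambda>t. a * f t) (\<bar>a\<bar> * A)"
  unfolding bv_bounded_def
proof (intro allI ballI)
  fix x P assume "P \<in> pairings D"
  then have "\<bar>a\<bar> * (\<bar>f x\<bar> + qvariation P f) \<le> \<bar>a\<bar> * A"
    using assms by (intro mult_left_mono) (auto simp: bv_bounded_def)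
  then show "\<bar>a * f x\<bar> + qvariation P (\<lambda>t. a * f t) \<le> \<bar>a\<bar> * A"
    by (simp add: abs_mult qvariation_scale distrib_left)
qed

lemma bv_norm_le:
  assumes "bv_bounded D f C"
  shows "bv_norm D f \<le> C"
  unfolding bv_norm_def using assms empty_pairing [of D]
  by (intro cSUP_least) (auto simp: bv_bounded_def)

lemma bv_bounded_norm:
  assumes "bv_bounded D f C"
  shows "bv_bounded D f (bv_norm D f)"
  unfolding bv_bounded_def
proof (intro allI ballI)
  fix x P assume P: "P \<in> pairings D"
  have "bdd_above ((\<lambda>(x, P). \<bar>f x\<bar> + qvariation P f) ` (UNIV \<times> pairings D))"
    using assms by (intro bdd_aboveI [of _ C]) (auto simp: bv_bounded_def)
  then show "\<bar>f x\<bar> + qvariation P f \<le> bv_norm D f"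
    unfolding bv_norm_def using P cSUP_upper [of "(x, P)" "UNIV \<times> pairings D" "\<lambda>(x, P). \<bar>f x\<bar> + qvariation P f"]
    by auto
qed

lemma cfunctions_add: "f \<in> cfunctions D \<Longrightarrow> g \<in> cfunctions D \<Longrightarrow> (\<lambda>t. f t + g t) \<in> cfunctions D"
  by (auto simp: cfunctions_def intro: continuous_map_add)

lemma cfunctions_scale: "f \<in> cfunctions D \<Longrightarrow> (\<lambda>t. a * f t) \<in> cfunctions D"
  by (auto simp: cfunctions_def intro: continuous_map_real_mult_left)

lemma bv_functions_add:
  assumes "f \<in> bv_functions D" "g \<in> bv_functions D"
  shows "(\<lambda>t. f t + g t) \<in> bv_functions D"
proof -
  obtain M N where "\<forall>P\<in>pairings D. variation P f \<le> M" "\<forall>P\<in>pairings D. variation P g \<le> N"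
    using assms by (auto simp: bv_functions_def)
  then have "\<forall>P\<in>pairings D. variation P (\<lambda>t. f t + g t) \<le> M + N"
    using variation_add by (fastforce intro: order_trans add_mono)
  then show ?thesis using assms by (auto simp: bv_functions_def cfunctions_add)
qed

lemma bv_functions_scale:
  assumes "f \<in> bv_functions D"
  shows "(\<lambda>t. a * f t) \<in> bv_functions D"
proof -
  obtain M where "\<forall>P\<in>pairings D. variation P f \<le> M"
    using assms by (auto simp: bv_functions_def)
  then have "\<forall>P\<in>pairings D. variation P (\<lambda>t. a * f t) \<le> \<bar>a\<bar> * M"
    by (auto simp: variation_scale intro: mult_left_mono)
  then show ?thesis using assms by (auto simp: bv_functions_def cfunctions_scale)
qed

lemma cfunctions_bounded:
  assumes D: "compact_space D" and f: "f \<in> cfunctions D"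
  obtains M where "\<And>x. \<bar>f x\<bar> \<le> M"
proof -
  have "compactin euclideanreal (f ` topspace D)"
    using D f by (intro image_compactin [of D]) (auto simp: cfunctions_def compact_space_def)
  then have "bounded (f ` topspace D)" by (simp add: compact_imp_bounded)
  then obtain M where M: "\<forall>y\<in>f ` topspace D. \<bar>y\<bar> \<le> M"
    by (auto simp: bounded_real)
  have "\<bar>f x\<bar> \<le> max 0 M" for x
    using M f by (cases "x \<in> topspace D") (auto simp: cfunctions_def max_def)
  then show thesis using that by blast
qed

lemma bv_functions_bounded:
  assumes D: "compact_space D" and f: "f \<in> bv_functions D"
  shows "\<exists>C. bv_bounded D f C"
proof -
  obtain M where M: "\<And>P. P \<in> pairings D \<Longrightarrow> variation P f \<le> M"
    using f by (auto simp: bv_functions_def)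
  obtain s where s: "\<And>x. \<bar>f x\<bar> \<le> s"
    using cfunctions_bounded [OF D, of f] f by (auto simp: bv_functions_def)
  have s0: "0 \<le> s" using s [of undefined] by linarith
  have "qvariation P f \<le> sqrt (2 * s * M)" if "P \<in> pairings D" for P
  proof (rule real_le_rsqrt)
    have "(qvariation P f)\<^sup>2 \<le> 2 * s * variation P f" using s by (rule qvariation_square_le)
    also have "\<dots> \<le> 2 * s * M" using M [OF that] s0 by (intro mult_left_mono) auto
    finally show "(qvariation P f)\<^sup>2 \<le> 2 * s * M" .
  qed
  then show ?thesis using bv_boundedI [of f s D "sqrt (2 * s * M)"] s by blast
qed

lemma zero_bv_function: "(\<lambda>t. 0) \<in> bv_functions D"
  by (auto simp: bv_functions_def cfunctions_def variation_def)

lemma bv_bounded_zero: "0 \<le> e \<Longrightarrow> bv_bounded D (\<lambda>t. 0) e"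
  by (simp add: bv_bounded_def qvariation_def L2_set_def)

lemma bv_space_carrier:
  "carrier (bv_space D) = {f \<in> cfunctions D. \<forall>e>0. \<exists>b\<in>bv_functions D. bv_bounded D (\<lambda>x. f x - b x) e}"
  by (simp add: bv_space_def)

lemma bv_space_sel [simp]:
  "zero (bv_space D) = (\<lambda>t. 0)" "add (bv_space D) = (\<lambda>x y t. x t + y t)"
  "smult (bv_space D) = (\<lambda>a x t. a * x t)" "vnorm (bv_space D) = bv_norm D"
  by (simp_all add: bv_space_def)

lemma bv_space_approximable:
  assumes "f \<in> carrier (bv_space D)" "0 < e"
  obtains b where "b \<in> bv_functions D" "bv_bounded D (\<lambda>x. f x - b x) e"
  using assms by (auto simp: bv_space_carrier)

lemma bv_functions_subset_space: "bv_functions D \<subseteq> carrier (bv_space D)"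
proof
  fix f assume f: "f \<in> bv_functions D"
  then have "\<exists>b\<in>bv_functions D. bv_bounded D (\<lambda>x. f x - b x) e" if "0 < e" for e
    using bv_bounded_zero [of e D] that by (intro bexI [of _ f]) auto
  then show "f \<in> carrier (bv_space D)" using f by (simp add: bv_space_carrier bv_functions_def)
qed

lemma bv_space_function_space: "function_space (bv_space D)"
proof -
  have "(\<lambda>t. x t + y t) \<in> carrier (bv_space D)"
    if x: "x \<in> carrier (bv_space D)" and y: "y \<in> carrier (bv_space D)" for x y
  proof -
    have "\<exists>b\<in>bv_functions D. bv_bounded D (\<lambda>t. x t + y t - b t) e" if "0 < e" for e
    proof -
      have "0 < e / 2" using that by simp
      obtain a where "a \<in> bv_functions D" "bv_bounded D (\<lambda>t. x t - a t) (e / 2)"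
        using bv_space_approximable [OF x \<open>0 < e / 2\<close>] .
      moreover obtain b where "b \<in> bv_functions D" "bv_bounded D (\<lambda>t. y t - b t) (e / 2)"
        using bv_space_approximable [OF y \<open>0 < e / 2\<close>] .
      ultimately show ?thesis
        using bv_bounded_add [of D "\<lambda>t. x t - a t" "e / 2" "\<lambda>t. y t - b t" "e / 2"]
        by (intro bexI [of _ "\<lambda>t. a t + b t"] bv_functions_add) (auto simp: algebra_simps)
    qed
    then show ?thesis using x y by (auto simp: bv_space_carrier intro: cfunctions_add)
  qed
  moreover have "(\<lambda>t. a * x t) \<in> carrier (bv_space D)" if x: "x \<in> carrier (bv_space D)" for a x
  proof -
    have "\<exists>b\<in>bv_functions D. bv_bounded D (\<lambda>t. a * x t - b t) e" if e: "0 < e" for e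
    proof -
      have "0 < e / (\<bar>a\<bar> + 1)" using e by simp
      obtain b where b: "b \<in> bv_functions D" "bv_bounded D (\<lambda>t. x t - b t) (e / (\<bar>a\<bar> + 1))"
        using bv_space_approximable [OF x \<open>0 < e / (\<bar>a\<bar> + 1)\<close>] .
      have "\<bar>a\<bar> * (e / (\<bar>a\<bar> + 1)) \<le> e" using e by (simp add: field_simps)
      with bv_bounded_scale [OF b(2), of a] have "bv_bounded D (\<lambda>t. a * (x t - b t)) e"
        by (rule bv_bounded_mono)
      then show ?thesis
        using b by (intro bexI [of _ "\<lambda>t. a * b t"] bv_functions_scale) (auto simp: algebra_simps)
    qed
    then show ?thesis using x by (auto simp: bv_space_carrier intro: cfunctions_scale)
  qed
  moreover have "(\<lambda>t. 0) \<in> carrier (bv_space D)"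
    using bv_functions_subset_space zero_bv_function by blast
  ultimately show ?thesis unfolding function_space_def by simp
qed

text \<open>Some function of bounded variation, which has finite norm on a compact space, is within
  1 of \<open>f\<close>. Hence the supremum defining \<open>bv_norm\<close> is a genuine
  bound.\<close>

lemma bv_space_bounded:
  assumes D: "compact_space D" and f: "f \<in> carrier (bv_space D)"
  shows "bv_bounded D f (bv_norm D f)"
proof -
  obtain b where b: "b \<in> bv_functions D" "bv_bounded D (\<lambda>x. f x - b x) 1"
    using bv_space_approximable [OF f zero_less_one] .
  obtain C where C: "bv_bounded D b C" using bv_functions_bounded [OF D b(1)] by blast
  have "bv_bounded D f (1 + C)" using bv_bounded_add [OF b(2) C] by simp
  then show ?thesis by (rule bv_bounded_norm)
qed

lemma bv_space_normed_space:
  assumes D: "compact_space D"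
  shows "normed_space (bv_space D)"
proof (rule function_space_normedI [OF bv_space_function_space])
  fix x y :: "'a \<Rightarrow> real" and a :: real
  assume x: "x \<in> carrier (bv_space D)"
  have bx: "bv_bounded D x (bv_norm D x)" using bv_space_bounded [OF D x] .
  show "0 \<le> vnorm (bv_space D) x" using bv_bounded_nonneg [OF bx] by simp
  show "x = (\<lambda>t. 0)" if "vnorm (bv_space D) x = 0"
    using bv_bounded_abs [OF bx] that by (auto simp: fun_eq_iff)
  show "vnorm (bv_space D) (\<lambda>t. a * x t) = \<bar>a\<bar> * vnorm (bv_space D) x"
  proof (cases "a = 0")
    case True
    then show ?thesis
      using bv_norm_le [OF bv_bounded_zero [of 0 D]]
        bv_bounded_nonneg [OF bv_bounded_norm [OF bv_bounded_zero [of 0 D]]] by simp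
  next
    case False
    have ax: "bv_bounded D (\<lambda>t. a * x t) (\<bar>a\<bar> * bv_norm D x)"
      using bv_bounded_scale [OF bx] .
    have "bv_bounded D (\<lambda>t. (1 / a) * (a * x t)) (\<bar>1 / a\<bar> * bv_norm D (\<lambda>t. a * x t))"
      using bv_bounded_scale [OF bv_bounded_norm [OF ax], of "1 / a"] .
    then have "bv_norm D x \<le> \<bar>1 / a\<bar> * bv_norm D (\<lambda>t. a * x t)"
      using False by (intro bv_norm_le) simp
    then show ?thesis using bv_norm_le [OF ax] False by (simp add: field_simps)
  qed
  assume y: "y \<in> carrier (bv_space D)"
  show "vnorm (bv_space D) (\<lambda>t. x t + y t) \<le> vnorm (bv_space D) x + vnorm (bv_space D) y"
    using bv_norm_le [OF bv_bounded_add [OF bx bv_space_bounded [OF D y]]] by simp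
qed

lemma bv_space_diff_bounded:
  assumes D: "compact_space D" and f: "f \<in> carrier (bv_space D)" and g: "g \<in> carrier (bv_space D)"
  shows "bv_bounded D (\<lambda>t. f t - g t) (bv_norm D (\<lambda>t. f t - g t))"
  using bv_space_bounded [OF D function_space_diff(2) [OF bv_space_function_space f g]] .

text \<open>For a fixed pairing only finitely many values enter, so pointwise convergence suffices;
  an infinite index set makes both sides 0.\<close>

lemma tendsto_qvariation:
  assumes "\<And>t. (\<lambda>n. f n t) \<longlonglongrightarrow> g t"
  shows "(\<lambda>n. qvariation P (f n)) \<longlonglongrightarrow> qvariation P g"
  unfolding qvariation_def L2_set_def using assms by (intro tendsto_intros)

text \<open>For a fixed point and pairing the Cauchy estimate survives the pointwise limit, so the
  convergence holds in norm. It is in particular uniform, which makes the limit continuous, and an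
  approximant of a late term also approximates the limit.\<close>

lemma bv_space_banach:
  assumes D: "compact_space D"
  shows "banach_space (bv_space D)"
proof -
  note V = bv_space_function_space [of D] and N = bv_space_normed_space [OF D]
  interpret M: Metric_space "carrier (bv_space D)" "norm_dist (bv_space D)"
    using V N by (rule function_space_metric)
  have "\<exists>f. limitin M.mtopology \<sigma> f sequentially" if \<sigma>: "M.MCauchy \<sigma>" for \<sigma>
  proof -
    have \<sigma>V: "\<sigma> n \<in> carrier (bv_space D)" for n
      using \<sigma> unfolding M.MCauchy_def by blast
    have dist: "norm_dist (bv_space D) (\<sigma> n) (\<sigma> m) = bv_norm D (\<lambda>t. \<sigma> n t - \<sigma> m t)" for n m
      using function_space_dist [OF V \<sigma>V \<sigma>V] by simp
    have cau: "\<exists>N. \<forall>n\<ge>N. \<forall>m\<ge>N. bv_bounded D (\<lambda>t. \<sigma> n t - \<sigma> m t) e" if e: "0 < e" for e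
    proof -
      obtain N where N: "\<And>n m. N \<le> n \<Longrightarrow> N \<le> m \<Longrightarrow> bv_norm D (\<lambda>t. \<sigma> n t - \<sigma> m t) < e"
        using \<sigma> e unfolding M.MCauchy_def dist by blast
      then show ?thesis
        using bv_space_diff_bounded [OF D \<sigma>V \<sigma>V] by (meson bv_bounded_mono less_imp_le)
    qed
    have "Cauchy (\<lambda>n. \<sigma> n t)" for t
    proof (rule metric_CauchyI)
      fix e :: real assume "0 < e"
      then have "0 < e / 2" by simp
      from cau [OF this] obtain N
        where N: "\<forall>n\<ge>N. \<forall>m\<ge>N. bv_bounded D (\<lambda>t. \<sigma> n t - \<sigma> m t) (e / 2)" by (elim exE)
      have "\<bar>\<sigma> n t - \<sigma> m t\<bar> \<le> e / 2" if "N \<le> n" "N \<le> m" for n m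
        using N that bv_bounded_abs_diff [of D "\<sigma> n" "\<sigma> m" "e / 2" t] by simp
      then show "\<exists>N. \<forall>m\<ge>N. \<forall>n\<ge>N. dist (\<sigma> m t) (\<sigma> n t) < e"
        using \<open>0 < e\<close> by (intro exI [of _ N]) (fastforce simp: dist_real_def)
    qed
    then have "\<exists>l. (\<lambda>n. \<sigma> n t) \<longlonglongrightarrow> l" for t
      by (metis Cauchy_convergent convergent_def)
    then obtain f where f: "\<And>t. (\<lambda>n. \<sigma> n t) \<longlonglongrightarrow> f t" by metis
    have lim: "\<exists>N. \<forall>n\<ge>N. bv_bounded D (\<lambda>t. \<sigma> n t - f t) e" if e: "0 < e" for e
    proof -
      obtain N where N: "\<And>n m. N \<le> n \<Longrightarrow> N \<le> m \<Longrightarrow> bv_bounded D (\<lambda>t. \<sigma> n t - \<sigma> m t) e"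
        using cau [OF e] by blast
      have "bv_bounded D (\<lambda>t. \<sigma> n t - f t) e" if n: "N \<le> n" for n
        unfolding bv_bounded_def
      proof (intro allI ballI)
        fix x P assume P: "P \<in> pairings D"
        have "(\<lambda>m. \<bar>\<sigma> n x - \<sigma> m x\<bar> + qvariation P (\<lambda>t. \<sigma> n t - \<sigma> m t)) \<longlonglongrightarrow>
            \<bar>\<sigma> n x - f x\<bar> + qvariation P (\<lambda>t. \<sigma> n t - f t)"
          by (intro tendsto_intros tendsto_qvariation f)
        moreover have "\<forall>m\<ge>N. \<bar>\<sigma> n x - \<sigma> m x\<bar> + qvariation P (\<lambda>t. \<sigma> n t - \<sigma> m t) \<le> e"
          using N [OF n] P by (simp add: bv_bounded_def)
        ultimately show "\<bar>\<sigma> n x - f x\<bar> + qvariation P (\<lambda>t. \<sigma> n t - f t) \<le> e"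
          by (blast intro: LIMSEQ_le_const2)
      qed
      then show ?thesis by blast
    qed
    have "continuous_map D Met_TC.mtopology f"
    proof (rule Met_TC.continuous_map_uniform_limit [where F = sequentially and f = \<sigma>])
      show "\<forall>\<^sub>F n in sequentially. continuous_map D Met_TC.mtopology (\<sigma> n)"
        using \<sigma>V by (auto simp: bv_space_carrier cfunctions_def)
      show "\<forall>\<^sub>F n in sequentially. \<forall>x\<in>topspace D. f x \<in> UNIV \<and> dist (\<sigma> n x) (f x) < e"
        if e: "0 < e" for e
      proof -
        obtain N where "\<forall>n\<ge>N. bv_bounded D (\<lambda>t. \<sigma> n t - f t) (e / 2)"
          using lim [OF half_gt_zero [OF e]] by blast
        then have "\<forall>n\<ge>N. \<forall>x. dist (\<sigma> n x) (f x) \<le> e / 2"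
          using bv_bounded_abs_diff [of D "\<sigma> _" f "e / 2"] unfolding dist_real_def by simp
        moreover have "e / 2 < e" using e by simp
        ultimately show ?thesis
          unfolding eventually_sequentially by (meson UNIV_I le_less_trans)
      qed
    qed auto
    moreover have "f x = 0" if "x \<notin> topspace D" for x
      using f [of x] \<sigma>V that LIMSEQ_unique [of "\<lambda>n. 0" "f x" 0] by (simp add: bv_space_carrier cfunctions_def)
    ultimately have "f \<in> cfunctions D" by (simp add: cfunctions_def)
    moreover have "\<exists>b\<in>bv_functions D. bv_bounded D (\<lambda>x. f x - b x) e" if e: "0 < e" for e
    proof -
      obtain n where n: "bv_bounded D (\<lambda>t. \<sigma> n t - f t) (e / 2)"
        using lim [OF half_gt_zero [OF e]] by blast
      obtain b where b: "b \<in> bv_functions D" "bv_bounded D (\<lambda>t. \<sigma> n t - b t) (e / 2)"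
        using bv_space_approximable [OF \<sigma>V, of "e / 2" n] e by auto
      have "bv_bounded D (\<lambda>t. - 1 * (\<sigma> n t - f t) + (\<sigma> n t - b t)) (\<bar>-1\<bar> * (e / 2) + e / 2)"
        by (intro bv_bounded_add bv_bounded_scale n b)
      then show ?thesis using b(1) by (intro bexI [of _ b]) auto
    qed
    ultimately have fV: "f \<in> carrier (bv_space D)" by (simp add: bv_space_carrier)
    have "limitin M.mtopology \<sigma> f sequentially"
      unfolding M.limitin_metric
    proof (intro conjI allI impI fV)
      fix e :: real assume "0 < e"
      then obtain N where N: "\<forall>n\<ge>N. bv_bounded D (\<lambda>t. \<sigma> n t - f t) (e / 2)"
        using lim [of "e / 2"] by auto
      have "norm_dist (bv_space D) (\<sigma> n) f < e" if "N \<le> n" for n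
        using bv_norm_le [of D "\<lambda>t. \<sigma> n t - f t" "e / 2"] N that \<open>0 < e\<close>
          function_space_dist [OF V \<sigma>V fV, of n] by fastforce
      then show "\<forall>\<^sub>F n in sequentially. \<sigma> n \<in> carrier (bv_space D) \<and> norm_dist (bv_space D) (\<sigma> n) f < e"
        using \<sigma>V unfolding eventually_sequentially by blast
    qed
    then show ?thesis by blast
  qed
  then show ?thesis using N unfolding banach_space_def M.mcomplete_def by blast
qed

section \<open>The space contains no copy of \<open>\<ell>\<^sub>1\<close>\<close>

text \<open>A greedy substitute for averaging over random signs: each new sign is chosen to make the
  cross term nonpositive.\<close>

lemma balanced_signs:
  fixes w :: "nat \<Rightarrow> 'x \<Rightarrow> real"
  obtains s :: "nat \<Rightarrow> real" where "\<And>i. \<bar>s i\<bar> = 1"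
    "(\<Sum>x\<in>X. (\<Sum>i<n. s i * w i x)\<^sup>2) \<le> (\<Sum>i<n. \<Sum>x\<in>X. (w i x)\<^sup>2)"
proof (induction n arbitrary: thesis)
  case 0
  show ?case using 0 [of "\<lambda>_. 1"] by simp
next
  case (Suc n)
  obtain s :: "nat \<Rightarrow> real" where s: "\<And>i. \<bar>s i\<bar> = 1"
    "(\<Sum>x\<in>X. (\<Sum>i<n. s i * w i x)\<^sup>2) \<le> (\<Sum>i<n. \<Sum>x\<in>X. (w i x)\<^sup>2)"
    using Suc.IH by blast
  define S where "S x = (\<Sum>i<n. s i * w i x)" for x
  define r :: real where "r = (if (\<Sum>x\<in>X. S x * w n x) \<le> 0 then 1 else -1)"
  define s' where "s' = s(n := r)"
  have r: "r * (\<Sum>x\<in>X. S x * w n x) \<le> 0" "\<bar>r\<bar> = 1" "r\<^sup>2 = 1" by (auto simp: r_def)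
  have "(\<Sum>i<Suc n. s' i * w i x) = S x + r * w n x" for x
    by (simp add: s'_def S_def)
  then have "(\<Sum>x\<in>X. (\<Sum>i<Suc n. s' i * w i x)\<^sup>2) = (\<Sum>x\<in>X. (S x)\<^sup>2 + (w n x)\<^sup>2 + 2 * r * (S x * w n x))"
    by (simp add: power2_sum power_mult_distrib r algebra_simps)
  also have "\<dots> = (\<Sum>x\<in>X. (S x)\<^sup>2) + (\<Sum>x\<in>X. (w n x)\<^sup>2) + 2 * (r * (\<Sum>x\<in>X. S x * w n x))"
    by (simp add: sum.distrib sum_distrib_left mult.assoc)
  also have "\<dots> \<le> (\<Sum>i<Suc n. \<Sum>x\<in>X. (w i x)\<^sup>2)"
    using s(2) r(1) by (simp add: S_def)
  finally show ?case using Suc.prems [of s'] s(1) r(2) by (auto simp: s'_def)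
qed

text \<open>View \<open>y\<close> as the vector of the values \<open>f i y\<close> in R^n. In a set
  \<open>X\<close> separated at scale e * sqrt n, a pairing with card X - 1 pairs has total squared
  increment at least (card X - 1) * e^2 * n, and at most n * C^2 by the bounds on the n functions.
  The factor n cancels, so the size is bounded independently of n; a maximal such set is then a
  net.\<close>

lemma pairing_covering:
  fixes f :: "nat \<Rightarrow> 'a \<Rightarrow> real"
  assumes f: "\<And>i P. P \<in> pairings D \<Longrightarrow> qvariation P (f i) \<le> C" and e: "0 < e" and n: "0 < n"
  obtains X where "finite X" "real (card X) \<le> C\<^sup>2 / e\<^sup>2 + 1"
    "\<And>y. y \<in> topspace D \<Longrightarrow> \<exists>x\<in>X. (\<Sum>i<n. (f i y - f i x)\<^sup>2) \<le> e\<^sup>2 * real n"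
proof -
  define d where "d x y = (\<Sum>i<n. (f i x - f i y)\<^sup>2)" for x y
  have sym: "d x y = d y x" for x y by (simp add: d_def power2_commute)
  define S where "S X \<longleftrightarrow> finite X \<and> X \<subseteq> topspace D \<and> (\<forall>x\<in>X. \<forall>y\<in>X. x \<noteq> y \<longrightarrow> e\<^sup>2 * real n < d x y)" for X
  have card: "real (card X) \<le> C\<^sup>2 / e\<^sup>2 + 1" if X: "S X" for X
  proof -
    have "finite X" "X \<subseteq> topspace D" using X by (auto simp: S_def)
    then obtain P where P: "P \<in> pairings D" "card P = card X - 1"
      "\<And>p. p \<in> P \<Longrightarrow> fst p \<in> X \<and> snd p \<in> X \<and> fst p \<noteq> snd p"
      using finite_set_pairing by blast
    have "real (card P) * (e\<^sup>2 * real n) = (\<Sum>p\<in>P. e\<^sup>2 * real n)" by simp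
    also have "\<dots> \<le> (\<Sum>p\<in>P. d (fst p) (snd p))"
      using X P(3) by (intro sum_mono) (auto simp: S_def less_imp_le)
    also have "\<dots> = (\<Sum>i<n. (qvariation P (f i))\<^sup>2)"
      unfolding d_def qvariation_square by (rule sum.swap)
    also have "\<dots> \<le> (\<Sum>i<n. C\<^sup>2)"
      using f [OF P(1)] by (intro sum_mono power_mono qvariation_nonneg)
    finally have "(real (card P) * e\<^sup>2) * real n \<le> C\<^sup>2 * real n"
      by (simp add: algebra_simps)
    then have "real (card P) * e\<^sup>2 \<le> C\<^sup>2" using n by simp
    then have "real (card P) \<le> C\<^sup>2 / e\<^sup>2" using e by (simp add: field_simps)
    then show ?thesis using P(2) by linarith
  qed
  have "\<forall>X. S X \<longrightarrow> card X < Suc (nat \<lfloor>C\<^sup>2 / e\<^sup>2 + 1\<rfloor>)"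
    using le_nat_floor [OF card] less_Suc_eq_le by blast
  moreover have "S {}" by (simp add: S_def)
  ultimately obtain X where X: "S X" and max: "\<And>Y. S Y \<Longrightarrow> card Y \<le> card X"
    using ex_has_greatest_nat [of S "{}" card] by blast
  have "\<exists>x\<in>X. d y x \<le> e\<^sup>2 * real n" if y: "y \<in> topspace D" for y
  proof (rule ccontr)
    assume "\<not> ?thesis"
    then have far: "\<And>x. x \<in> X \<Longrightarrow> e\<^sup>2 * real n < d y x" by auto
    have "d y y = 0" "0 < e\<^sup>2 * real n" using e n by (simp_all add: d_def)
    then have "y \<notin> X" using far [of y] by auto
    have "S (insert y X)" using X far sym y by (auto simp: S_def)
    then have "card (insert y X) \<le> card X" by (rule max)
    then show False using X \<open>y \<notin> X\<close> by (simp add: S_def)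
  qed
  then show thesis using that [of X] X card [OF X] by (auto simp: S_def d_def)
qed

text \<open>At the boundedly many net points, balanced signs make the sum of order sqrt n. Between a
  point and its nearest net point, Cauchy-Schwarz loses at most
  \<open>e / 2 * real n\<close>.\<close>

lemma small_signed_average:
  fixes f :: "nat \<Rightarrow> 'a \<Rightarrow> real"
  assumes f: "\<And>i. bv_bounded D (f i) C" and off: "\<And>i x. x \<notin> topspace D \<Longrightarrow> f i x = 0"
    and e: "0 < e"
  obtains n s where "0 < n" "\<And>i::nat. \<bar>s i\<bar> = 1" "\<And>x. \<bar>\<Sum>i<n. s i * f i x\<bar> \<le> e * real n"
proof -
  \<comment> \<open>\<open>K\<close> bounds the number of net points at scale \<open>e / 2\<close>.
    It does not depend on \<open>n\<close>, so \<open>n\<close> can be chosen after it, large enough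
    that K * C^2 * n is below (e / 2)^2 * n^2.\<close>
  define K where "K = C\<^sup>2 / (e / 2)\<^sup>2 + 1"
  obtain n :: nat where n: "K * C\<^sup>2 / (e / 2)\<^sup>2 < real n" using reals_Archimedean2 by blast
  have "0 \<le> K * C\<^sup>2 / (e / 2)\<^sup>2" by (simp add: K_def)
  then have n0: "0 < n" using n by linarith
  have q: "qvariation P (f i) \<le> C" if "P \<in> pairings D" for i P
    using bv_bounded_qvariation [OF f that] .
  have e2: "0 < e / 2" using e by simp
  obtain X where X: "finite X" "real (card X) \<le> K"
    "\<And>y. y \<in> topspace D \<Longrightarrow> \<exists>x\<in>X. (\<Sum>i<n. (f i y - f i x)\<^sup>2) \<le> (e / 2)\<^sup>2 * real n"
    unfolding K_def by (rule pairing_covering [of D f C, OF q e2 n0]) (assumption | rule that [unfolded K_def])+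
  obtain s :: "nat \<Rightarrow> real" where s: "\<And>i. \<bar>s i\<bar> = 1"
    "(\<Sum>x\<in>X. (\<Sum>i<n. s i * f i x)\<^sup>2) \<le> (\<Sum>i<n. \<Sum>x\<in>X. (f i x)\<^sup>2)"
    using balanced_signs [where X = X and n = n and w = f] by blast
  have s2: "(s i)\<^sup>2 = 1" for i using s(1) [of i] by (metis power2_abs power_one)
  have at_X: "\<bar>\<Sum>i<n. s i * f i x\<bar> \<le> e / 2 * real n" if x: "x \<in> X" for x
  proof (rule power2_le_imp_le)
    have "\<bar>\<Sum>i<n. s i * f i x\<bar>\<^sup>2 \<le> (\<Sum>x\<in>X. (\<Sum>i<n. s i * f i x)\<^sup>2)"
      using member_le_sum [OF x, of "\<lambda>x. (\<Sum>i<n. s i * f i x)\<^sup>2"] X(1) by simp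
    also have "\<dots> \<le> (\<Sum>i<n. \<Sum>x\<in>X. C\<^sup>2)"
      using bv_bounded_abs [OF f]
      by (intro order_trans [OF s(2)] sum_mono) (metis abs_ge_zero power2_abs power_mono)
    also have "\<dots> = real n * (real (card X) * C\<^sup>2)" by simp
    also have "\<dots> \<le> real n * (K * C\<^sup>2)"
      using X(2) by (intro mult_left_mono mult_right_mono) auto
    also have "\<dots> \<le> real n * ((e / 2)\<^sup>2 * real n)"
      using n e by (intro mult_left_mono) (auto simp: field_simps)
    finally show "\<bar>\<Sum>i<n. s i * f i x\<bar>\<^sup>2 \<le> (e / 2 * real n)\<^sup>2"
      by (simp add: power2_eq_square algebra_simps)
  qed (use e in simp)
  have "\<bar>\<Sum>i<n. s i * f i y\<bar> \<le> e * real n" for y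
  proof (cases "y \<in> topspace D")
    case False
    then show ?thesis using off e by simp
  next
    case True
    then obtain x where x: "x \<in> X" "(\<Sum>i<n. (f i y - f i x)\<^sup>2) \<le> (e / 2)\<^sup>2 * real n"
      using X(3) by blast
    have "\<bar>\<Sum>i<n. s i * (f i y - f i x)\<bar> \<le> e / 2 * real n"
    proof (rule power2_le_imp_le)
      have "\<bar>\<Sum>i<n. s i * (f i y - f i x)\<bar>\<^sup>2 \<le> (\<Sum>i<n. (s i)\<^sup>2) * (\<Sum>i<n. (f i y - f i x)\<^sup>2)"
        using Cauchy_Schwarz_ineq_sum [of s "\<lambda>i. f i y - f i x" "{..<n}"] by simp
      also have "\<dots> \<le> real n * ((e / 2)\<^sup>2 * real n)"
        using x(2) by (simp add: s2 mult_left_mono)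
      finally show "\<bar>\<Sum>i<n. s i * (f i y - f i x)\<bar>\<^sup>2 \<le> (e / 2 * real n)\<^sup>2"
        by (simp add: power2_eq_square algebra_simps)
    qed (use e in simp)
    moreover have "(\<Sum>i<n. s i * (f i y - f i x)) = (\<Sum>i<n. s i * f i y) - (\<Sum>i<n. s i * f i x)"
      by (simp add: right_diff_distrib sum_subtractf)
    ultimately show ?thesis using at_X [OF x(1)] by (simp add: field_simps)
  qed
  then show thesis using that [OF n0, of s] s(1) by blast
qed

lemma bv_bounded_sum:
  assumes f: "\<And>i. bv_bounded D (f i) C"
  shows "bv_bounded D (\<lambda>t. \<Sum>i<(n::nat). c i * f i t) ((\<Sum>i<n. \<bar>c i\<bar>) * C)"
proof (induction n)
  case 0
  then show ?case by (simp add: bv_bounded_zero)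
next
  case (Suc n)
  show ?case
    using bv_bounded_add [OF Suc bv_bounded_scale [OF f, of "c n"]] by (simp add: distrib_right)
qed

lemma bv_functions_sum:
  assumes f: "\<And>i. f i \<in> bv_functions D"
  shows "(\<lambda>t. \<Sum>i<(n::nat). c i * f i t) \<in> bv_functions D"
proof (induction n)
  case 0
  then show ?case by (simp add: zero_bv_function)
next
  case (Suc n)
  show ?case
    using bv_functions_add [OF Suc bv_functions_scale [OF f, of "c n"]] by simp
qed

lemma sum_lessThan_plus:
  fixes g :: "nat \<Rightarrow> 'b::comm_monoid_add"
  shows "(\<Sum>i<m + n. g i) = (\<Sum>i<m. g i) + (\<Sum>i<n. g (m + i))"
  by (induction n) (auto simp: add.assoc)

text \<open>A block that is uniformly small compared with the variation of its predecessors is almost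
  orthogonal to them, so the quadratic variation of a sum of \<open>m\<close> blocks is of order \<open>sqrt m\<close>.\<close>

lemma qvariation_square_add_le:
  assumes h: "\<And>x. \<bar>h x\<bar> \<le> s"
  shows "(qvariation P (\<lambda>t. f t + h t))\<^sup>2 \<le>
    (qvariation P f)\<^sup>2 + (qvariation P h)\<^sup>2 + 4 * s * variation P f"
proof -
  have "(\<Sum>p\<in>P. ((f (fst p) + h (fst p)) - (f (snd p) + h (snd p)))\<^sup>2) \<le>
      (\<Sum>p\<in>P. (f (fst p) - f (snd p))\<^sup>2 + (h (fst p) - h (snd p))\<^sup>2 + 4 * s * \<bar>f (fst p) - f (snd p)\<bar>)"
  proof (intro sum_mono)
    fix p
    define a b where "a = f (fst p) - f (snd p)" and "b = h (fst p) - h (snd p)"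
    have "\<bar>b\<bar> \<le> 2 * s" using h [of "fst p"] h [of "snd p"] unfolding b_def by linarith
    then have "\<bar>a\<bar> * \<bar>b\<bar> \<le> \<bar>a\<bar> * (2 * s)" by (intro mult_left_mono) auto
    then have "a * b \<le> 2 * s * \<bar>a\<bar>" using abs_ge_self [of "a * b"] by (simp add: abs_mult algebra_simps)
    then have le: "(a + b)\<^sup>2 \<le> a\<^sup>2 + b\<^sup>2 + 4 * s * \<bar>a\<bar>" by (simp add: power2_sum)
    have eq: "(f (fst p) + h (fst p)) - (f (snd p) + h (snd p)) = a + b" by (simp add: a_def b_def)
    show "((f (fst p) + h (fst p)) - (f (snd p) + h (snd p)))\<^sup>2 \<le>
        (f (fst p) - f (snd p))\<^sup>2 + (h (fst p) - h (snd p))\<^sup>2 + 4 * s * \<bar>f (fst p) - f (snd p)\<bar>"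
      unfolding eq a_def [symmetric] b_def [symmetric] by (rule le)
  qed
  then show ?thesis
    by (simp add: qvariation_square variation_def sum.distrib sum_distrib_left)
qed

text \<open>Induction on \<open>m\<close>, adding one normalised signed average of fresh functions
  at a time. A block adds 1 to the sum of absolute coefficients, at most \<open>e\<close> to the sup
  norm, and at most C^2 + 1 to the squared quadratic variation.\<close>

lemma bv_small_combination:
  fixes f :: "nat \<Rightarrow> 'a \<Rightarrow> real"
  assumes bv: "\<And>i. f i \<in> bv_functions D" and f: "\<And>i. bv_bounded D (f i) C" and e: "0 < e"
  shows "\<exists>N c. (\<Sum>i<(N::nat). \<bar>c i\<bar>) = real m \<and> (\<forall>x. \<bar>\<Sum>i<N. c i * f i x\<bar> \<le> real m * e) \<and>
    (\<forall>P\<in>pairings D. (qvariation P (\<lambda>t. \<Sum>i<N. c i * f i t))\<^sup>2 \<le> real m * (C\<^sup>2 + 1))"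
proof -
  define Q where "Q m N c \<longleftrightarrow> (\<Sum>i<(N::nat). \<bar>c i\<bar>) = real m \<and> (\<forall>x. \<bar>\<Sum>i<N. c i * f i x\<bar> \<le> real m * e) \<and>
    (\<forall>P\<in>pairings D. (qvariation P (\<lambda>t. \<Sum>i<N. c i * f i t))\<^sup>2 \<le> real m * (C\<^sup>2 + 1))" for m N c
  have "\<exists>N c. Q m N c"
  proof (induction m)
    case 0
    have "qvariation P (\<lambda>t. 0) = 0" for P :: "('a \<times> 'a) set" by (simp add: qvariation_def L2_set_def)
    then have "Q 0 0 (\<lambda>_. 0)" unfolding Q_def by simp
    then show ?case by blast
  next
    case (Suc m)
    then obtain N c where "Q m N c" by blast
    then have c: "(\<Sum>i<N. \<bar>c i\<bar>) = real m"
      "\<And>x. \<bar>\<Sum>i<N. c i * f i x\<bar> \<le> real m * e"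
      "\<And>P. P \<in> pairings D \<Longrightarrow> (qvariation P (\<lambda>t. \<Sum>i<N. c i * f i t))\<^sup>2 \<le> real m * (C\<^sup>2 + 1)"
      unfolding Q_def by simp_all
    define H where "H t = (\<Sum>i<N. c i * f i t)" for t
    have "H \<in> bv_functions D" unfolding H_def using bv by (rule bv_functions_sum)
    then obtain M where M: "\<And>P. P \<in> pairings D \<Longrightarrow> variation P H \<le> M"
      by (auto simp: bv_functions_def)
    have M0: "0 \<le> M" using M [OF empty_pairing] by (simp add: variation_def)
    \<comment> \<open>Chosen after the variation bound \<open>M\<close> of the sum built so far, so
      that the cross term \<open>4 * \<eta> * M\<close> is at most 1; this is the summand 1 in
      \<open>C\<^sup>2 + 1\<close>. Using \<open>M + 1\<close> avoids division by 0.\<close>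
    define \<eta> where "\<eta> = min e (1 / (4 * (M + 1)))"
    have \<eta>: "0 < \<eta>" "\<eta> \<le> e" using e M0 by (auto simp: \<eta>_def)
    have "4 * \<eta> * M \<le> 4 * (1 / (4 * (M + 1))) * M"
      using M0 by (intro mult_right_mono mult_left_mono) (auto simp: \<eta>_def)
    also have "\<dots> \<le> 1" using M0 by (simp add: field_simps)
    finally have \<eta>M: "4 * \<eta> * M \<le> 1" .
    have "f i x = 0" if "x \<notin> topspace D" for i x
      using bv [of i] that by (auto simp: bv_functions_def cfunctions_def)
    \<comment> \<open>The shift by \<open>N\<close> makes the block use new functions only, so the
      absolute coefficients of old part and block add up exactly.\<close>
    then obtain n s where n: "0 < n" and s: "\<And>i::nat. \<bar>s i\<bar> = 1"
        and small: "\<And>x. \<bar>\<Sum>i<n. s i * f (N + i) x\<bar> \<le> \<eta> * real n"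
      using small_signed_average [of D "\<lambda>i. f (N + i)" C \<eta>] f \<eta>(1) by metis
    define h where "h t = (\<Sum>i<n. s i / real n * f (N + i) t)" for t
    have h_eq: "h t = (\<Sum>i<n. s i * f (N + i) t) / real n" for t
      by (simp add: h_def sum_divide_distrib)
    have h: "\<bar>h x\<bar> \<le> \<eta>" for x
      using small [of x] n by (simp add: h_eq field_simps)
    have abs_sum: "(\<Sum>i<n. \<bar>s i / real n\<bar>) = 1"
      using n s by simp
    have "bv_bounded D h C"
      using bv_bounded_sum [of D "\<lambda>i. f (N + i)" C "\<lambda>i. s i / real n" n] f abs_sum
      by (simp add: h_def [abs_def])
    then have qh: "(qvariation P h)\<^sup>2 \<le> C\<^sup>2" if "P \<in> pairings D" for P
      using that bv_bounded_qvariation by (intro power_mono qvariation_nonneg) blast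
    define c' where "c' i = (if i < N then c i else s (i - N) / real n)" for i
    have split: "(\<Sum>i<N + n. c' i * f i t) = H t + h t" for t
      by (simp add: sum_lessThan_plus c'_def H_def h_def)
    have "(\<Sum>i<N + n. \<bar>c' i\<bar>) = (\<Sum>i<N. \<bar>c i\<bar>) + (\<Sum>i<n. \<bar>s i / real n\<bar>)"
      by (simp add: sum_lessThan_plus c'_def)
    then have "(\<Sum>i<N + n. \<bar>c' i\<bar>) = real (Suc m)" using c(1) abs_sum by simp
    moreover have "\<bar>\<Sum>i<N + n. c' i * f i x\<bar> \<le> real (Suc m) * e" for x
      using c(2) [of x] h [of x] \<eta>(2) unfolding split by (simp add: H_def distrib_right)
    moreover have "(qvariation P (\<lambda>t. \<Sum>i<N + n. c' i * f i t))\<^sup>2 \<le> real (Suc m) * (C\<^sup>2 + 1)"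
      if P: "P \<in> pairings D" for P
    proof -
      have "4 * \<eta> * variation P H \<le> 4 * \<eta> * M"
        using M [OF P] \<eta>(1) by (intro mult_left_mono) auto
      then show ?thesis
        unfolding split
        using qvariation_square_add_le [of h \<eta> P H] h c(3) [OF P] qh [OF P] \<eta>M
        by (simp add: H_def [abs_def] algebra_simps)
    qed
    ultimately have "Q (Suc m) (N + n) c'" unfolding Q_def by blast
    then show ?case by blast
  qed
  then show ?thesis unfolding Q_def .
qed

text \<open>With coefficients of total size m, a copy of l_1 would force norm at least \<delta> m.
  The combination has norm at most m \<delta> / 4 from the sup norm, plus m \<delta> / 4 from
  approximating the images of unit vectors, plus a term of order sqrt m; this is too small for large
  m.\<close>

theorem bv_space_rosenthal:
  assumes D: "compact_space D"
  shows "rosenthal_space (bv_space D)"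
proof -
  note V = bv_space_function_space [of D] bv_space_normed_space [OF D]
  note W = l1_function_space l1_normed_space
  have False if T: "linear_map l1_space (bv_space D) T"
    and emb: "embedding_map (norm_topology l1_space) (norm_topology (bv_space D)) T" for T
  proof -
    obtain \<delta> where \<delta>: "0 < \<delta>"
      "\<And>x. x \<in> carrier l1_space \<Longrightarrow> \<delta> * vnorm l1_space x \<le> vnorm (bv_space D) (T x)"
      using linear_embedding_lower_bound [OF W V T emb] by blast
    have "continuous_map (norm_topology l1_space) (norm_topology (bv_space D)) T"
      using emb unfolding embedding_map_def
      by (meson continuous_map_in_subtopology homeomorphic_imp_continuous_map)
    then obtain C where C: "\<And>x. x \<in> carrier l1_space \<Longrightarrow> vnorm l1_space x \<le> 1 \<Longrightarrow>
        vnorm (bv_space D) (T x) \<le> C"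
      using linear_continuous_upper_bound [OF W V T] by blast
    define e :: "nat \<Rightarrow> nat \<Rightarrow> real" where "e = (\<lambda>i t. if t = i then 1 else 0)"
    have e: "e i \<in> carrier l1_space" "vnorm l1_space (e i) = 1"
        "vnorm l1_space (\<lambda>t. \<Sum>i<n. c i * e i t) = (\<Sum>i<n. \<bar>c i\<bar>)" for i n c
      unfolding e_def by (rule l1_unit_vectors)+
    have Te: "T (e i) \<in> carrier (bv_space D)" for i
      using T e(1) by (auto simp: linear_map_def)
    \<comment> \<open>The block construction needs finite variation, which the vectors
      \<open>T (e i)\<close> may lack; an error of \<open>\<delta> / 4\<close> per unit coefficient
      is affordable.\<close>
    have "\<exists>b. b \<in> bv_functions D \<and> bv_bounded D (\<lambda>x. T (e i) x - b x) (\<delta> / 4)" for i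
      using bv_space_approximable [OF Te, of "\<delta> / 4" i] \<delta>(1) by (metis zero_less_divide_iff zero_less_numeral)
    then obtain b where b: "\<And>i. b i \<in> bv_functions D" "\<And>i. bv_bounded D (\<lambda>x. T (e i) x - b i x) (\<delta> / 4)"
      by metis
    define A where "A = C + \<delta> / 4"
    have bA: "bv_bounded D (b i) A" for i
    proof -
      have "bv_bounded D (T (e i)) C"
        using bv_bounded_mono [OF bv_space_bounded [OF D Te]] C [OF e(1)] e(2) by simp
      then have "bv_bounded D (\<lambda>t. T (e i) t + (- 1) * (T (e i) t - b i t)) (C + \<bar>-1\<bar> * (\<delta> / 4))"
        by (intro bv_bounded_add bv_bounded_scale b(2))
      then show ?thesis by (simp add: A_def)
    qed
    \<comment> \<open>This threshold is exactly what contradicts \<open>(\<delta> / 2 * real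
      m)\<^sup>2 \<le> real m * (A\<^sup>2 + 1)\<close>.\<close>
    obtain m :: nat where m: "4 * (A\<^sup>2 + 1) / \<delta>\<^sup>2 < real m" using reals_Archimedean2 by blast
    have "0 \<le> 4 * (A\<^sup>2 + 1) / \<delta>\<^sup>2" by simp
    then have m0: "0 < real m" using m by linarith
    have "0 < \<delta> / 4" using \<delta>(1) by simp
    obtain N c where Nc: "(\<Sum>i<(N::nat). \<bar>c i\<bar>) = real m \<and> (\<forall>x. \<bar>\<Sum>i<N. c i * b i x\<bar> \<le> real m * (\<delta> / 4)) \<and>
        (\<forall>P\<in>pairings D. (qvariation P (\<lambda>t. \<Sum>i<N. c i * b i t))\<^sup>2 \<le> real m * (A\<^sup>2 + 1))"
      using bv_small_combination [of b D A "\<delta> / 4" m, OF b(1) bA \<open>0 < \<delta> / 4\<close>] by (elim exE)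
    have c: "(\<Sum>i<N. \<bar>c i\<bar>) = real m" "\<And>x. \<bar>\<Sum>i<N. c i * b i x\<bar> \<le> real m * (\<delta> / 4)"
        "\<And>P. P \<in> pairings D \<Longrightarrow> (qvariation P (\<lambda>t. \<Sum>i<N. c i * b i t))\<^sup>2 \<le> real m * (A\<^sup>2 + 1)"
      using Nc by simp_all
    define B where "B = real m * (\<delta> / 4) + sqrt (real m * (A\<^sup>2 + 1))"
    have B: "bv_bounded D (\<lambda>t. \<Sum>i<N. c i * b i t) B"
      unfolding B_def using c by (intro bv_boundedI real_le_rsqrt)
    have "bv_bounded D (\<lambda>t. \<Sum>i<N. c i * (T (e i) t - b i t)) ((\<Sum>i<N. \<bar>c i\<bar>) * (\<delta> / 4))"
      using b(2) by (rule bv_bounded_sum)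
    from bv_bounded_add [OF B this]
    have "bv_bounded D (\<lambda>t. \<Sum>i<N. c i * T (e i) t) (B + real m * (\<delta> / 4))"
      by (simp add: c(1) sum.distrib [symmetric] algebra_simps)
    then have "bv_norm D (\<lambda>t. \<Sum>i<N. c i * T (e i) t) \<le> B + real m * (\<delta> / 4)"
      by (rule bv_norm_le)
    moreover have "\<delta> * real m \<le> bv_norm D (\<lambda>t. \<Sum>i<N. c i * T (e i) t)"
      using \<delta>(2) [of "\<lambda>t. \<Sum>i<N. c i * e i t"] e(3) [where n = N and c = c] c(1)
        function_space_linear_sum [OF W(1) V(1) T, where e = e and c = c and n = N] e(1) by simp
    ultimately have "\<delta> / 2 * real m \<le> sqrt (real m * (A\<^sup>2 + 1))"
      by (simp add: B_def algebra_simps)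
    then have "(\<delta> / 2 * real m)\<^sup>2 \<le> real m * (A\<^sup>2 + 1)"
      using power_mono [of "\<delta> / 2 * real m" "sqrt (real m * (A\<^sup>2 + 1))" 2] \<delta>(1) by simp
    then have "real m * (\<delta>\<^sup>2 / 4 * real m) \<le> real m * (A\<^sup>2 + 1)"
      by (simp add: power2_eq_square algebra_simps)
    then have "\<delta>\<^sup>2 / 4 * real m \<le> A\<^sup>2 + 1"
      using m0 by (rule mult_left_le_imp_le)
    moreover have "A\<^sup>2 + 1 < \<delta>\<^sup>2 / 4 * real m"
      using m \<delta>(1) by (simp add: field_simps)
    ultimately show False by linarith
  qed
  then show ?thesis
    using bv_space_banach [OF D] unfolding rosenthal_space_def by blast
qed

section \<open>Homeomorphisms act by isometries\<close>

text \<open>Composition with \<open>g\<close>, reset to 0 off the space so that the result stays in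
  \<open>cfunctions D\<close>.\<close>

definition pullback :: "'a topology \<Rightarrow> ('a \<Rightarrow> 'a) \<Rightarrow> ('a \<Rightarrow> real) \<Rightarrow> 'a \<Rightarrow> real" where
  "pullback D g v = (\<lambda>x. if x \<in> topspace D then v (g x) else 0)"

lemma halfspace_image:
  assumes g: "homeomorphic_map D D g" and H: "halfspace D H"
  shows "halfspace D (g ` H)"
proof -
  obtain w where H: "openin D H" "connectedin D H" "connectedin D (topspace D - H)"
      "w \<in> topspace D - H" "closedin D (insert w H)"
    using H by (auto simp: halfspace_def halfspace_at_def)
  have HD: "H \<subseteq> topspace D" using H(1) by (rule openin_subset)
  have inj: "inj_on g (topspace D)" and surj: "g ` topspace D = topspace D"
    using g by (simp_all add: homeomorphic_imp_injective_map homeomorphic_imp_surjective_map)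
  have "g ` (topspace D - H) = topspace D - g ` H"
    using inj_on_image_set_diff [OF inj _ HD, of "topspace D"] surj by auto
  then have "connectedin D (topspace D - g ` H)" "g w \<in> topspace D - g ` H"
    using H(3,4) homeomorphic_map_connectedness [OF g, of "topspace D - H"] by auto
  moreover have "openin D (g ` H)" "connectedin D (g ` H)"
    using H homeomorphic_map_openness [OF g HD] homeomorphic_map_connectedness [OF g HD] by auto
  moreover have "closedin D (g ` insert w H)"
    using H(4,5) HD by (subst homeomorphic_map_closedness [OF g]) auto
  ultimately show ?thesis
    unfolding halfspace_def halfspace_at_def by (intro exI [of _ "g w"]) auto
qed

lemma pairings_image:
  assumes g: "homeomorphic_maps D D g g'" and P: "P \<in> pairings D"
  shows "map_prod g g ` P \<in> pairings D"
proof -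
  have g': "homeomorphic_map D D g'" and inv: "\<And>x. x \<in> topspace D \<Longrightarrow> g' (g x) = x"
      "\<And>x. x \<in> topspace D \<Longrightarrow> g (g' x) = x" and gD: "g ` topspace D \<subseteq> topspace D"
    using g homeomorphic_imp_surjective_map [of D D g] by (auto simp: homeomorphic_maps_map)
  have PD: "P \<subseteq> topspace D \<times> topspace D" and fin: "finite P" using P by (auto simp: pairings_def)
  have "card {q \<in> map_prod g g ` P. (fst q \<in> H) \<noteq> (snd q \<in> H)} \<le> 2" if H: "halfspace D H" for H
  proof -
    have HD: "H \<subseteq> topspace D"
      using H by (auto simp: halfspace_def halfspace_at_def dest: openin_subset)
    have iff: "x \<in> g' ` H \<longleftrightarrow> g x \<in> H" if "x \<in> topspace D" for x
      using inv HD that by (metis image_iff subsetD)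
    have "{q \<in> map_prod g g ` P. (fst q \<in> H) \<noteq> (snd q \<in> H)}
        \<subseteq> map_prod g g ` {p \<in> P. (fst p \<in> g' ` H) \<noteq> (snd p \<in> g' ` H)}"
    proof
      fix q assume "q \<in> {q \<in> map_prod g g ` P. (fst q \<in> H) \<noteq> (snd q \<in> H)}"
      then have "q \<in> map_prod g g ` P" and sep: "(fst q \<in> H) \<noteq> (snd q \<in> H)" by simp_all
      then obtain p where p: "q = map_prod g g p" "p \<in> P" by (elim imageE)
      have "(g (fst p) \<in> H) \<noteq> (g (snd p) \<in> H)" using sep unfolding p(1) by simp
      moreover have "fst p \<in> topspace D" "snd p \<in> topspace D" using p(2) PD by auto
      ultimately show "q \<in> map_prod g g ` {p \<in> P. (fst p \<in> g' ` H) \<noteq> (snd p \<in> g' ` H)}"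
        using iff p by auto
    qed
    then have "card {q \<in> map_prod g g ` P. (fst q \<in> H) \<noteq> (snd q \<in> H)}
        \<le> card (map_prod g g ` {p \<in> P. (fst p \<in> g' ` H) \<noteq> (snd p \<in> g' ` H)})"
      using fin by (intro card_mono) auto
    also have "\<dots> \<le> card {p \<in> P. (fst p \<in> g' ` H) \<noteq> (snd p \<in> g' ` H)}"
      using fin by (intro card_image_le) auto
    also have "\<dots> \<le> 2" using P halfspace_image [OF g' H] by (simp add: pairings_def)
    finally show ?thesis .
  qed
  moreover have "map_prod g g ` P \<subseteq> topspace D \<times> topspace D" using PD gD by auto
  ultimately show ?thesis using fin by (simp add: pairings_def)
qed

text \<open>The function \<open>F\<close> of two values is left open so that one reindexing serves
  both kinds of variation.\<close>

lemma sum_pairs_pullback: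
  fixes F :: "real \<Rightarrow> real \<Rightarrow> real"
  assumes g: "homeomorphic_maps D D g g'" and P: "P \<in> pairings D"
  shows "(\<Sum>p\<in>P. F (pullback D g v (fst p)) (pullback D g v (snd p))) =
    (\<Sum>q\<in>map_prod g g ` P. F (v (fst q)) (v (snd q)))"
proof -
  have PD: "P \<subseteq> topspace D \<times> topspace D" using P by (auto simp: pairings_def)
  have "inj_on g (topspace D)"
    using g homeomorphic_imp_injective_map by (auto simp: homeomorphic_maps_map)
  then have "inj_on (map_prod g g) P"
    using inj_on_subset [OF map_prod_inj_on PD] by blast
  then have "(\<Sum>q\<in>map_prod g g ` P. F (v (fst q)) (v (snd q))) = (\<Sum>p\<in>P. F (v (g (fst p))) (v (g (snd p))))"
    by (simp add: sum.reindex)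
  also have "\<dots> = (\<Sum>p\<in>P. F (pullback D g v (fst p)) (pullback D g v (snd p)))"
    using PD by (intro sum.cong) (auto simp: pullback_def)
  finally show ?thesis by simp
qed

lemma variation_pullback:
  assumes "homeomorphic_maps D D g g'" "P \<in> pairings D"
  shows "variation P (pullback D g v) = variation (map_prod g g ` P) v"
  unfolding variation_def using sum_pairs_pullback [OF assms, of "\<lambda>a b. \<bar>a - b\<bar>"] .

lemma qvariation_pullback:
  assumes "homeomorphic_maps D D g g'" "P \<in> pairings D"
  shows "qvariation P (pullback D g v) = qvariation (map_prod g g ` P) v"
  unfolding qvariation_def L2_set_def
  using sum_pairs_pullback [OF assms, of "\<lambda>a b. (a - b)\<^sup>2"] by simp

lemma bv_bounded_pullback:
  assumes g: "homeomorphic_maps D D g g'" and v: "bv_bounded D v C"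
  shows "bv_bounded D (pullback D g v) C"
  unfolding bv_bounded_def
proof (intro allI ballI)
  fix x P assume P: "P \<in> pairings D"
  have "\<bar>v (g x)\<bar> + qvariation (map_prod g g ` P) v \<le> C"
    using v pairings_image [OF g P] by (simp add: bv_bounded_def)
  moreover have "\<bar>pullback D g v x\<bar> \<le> \<bar>v (g x)\<bar>" by (simp add: pullback_def)
  ultimately show "\<bar>pullback D g v x\<bar> + qvariation P (pullback D g v) \<le> C"
    using qvariation_pullback [OF g P] by simp
qed

lemma cfunctions_pullback:
  assumes "continuous_map D D g" "v \<in> cfunctions D"
  shows "pullback D g v \<in> cfunctions D"
proof -
  have "continuous_map D euclideanreal (v \<circ> g)"
    using assms by (intro continuous_map_compose) (auto simp: cfunctions_def)
  then have "continuous_map D euclideanreal (pullback D g v)"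
    by (rule continuous_map_eq) (simp add: pullback_def)
  then show ?thesis by (simp add: cfunctions_def pullback_def)
qed

lemma bv_functions_pullback:
  assumes g: "homeomorphic_maps D D g g'" and v: "v \<in> bv_functions D"
  shows "pullback D g v \<in> bv_functions D"
proof -
  obtain M where M: "\<And>P. P \<in> pairings D \<Longrightarrow> variation P v \<le> M"
    using v by (auto simp: bv_functions_def)
  have "continuous_map D D g" using g by (simp add: homeomorphic_maps_def)
  then have "pullback D g v \<in> cfunctions D"
    using v by (intro cfunctions_pullback) (auto simp: bv_functions_def)
  moreover have "\<forall>P\<in>pairings D. variation P (pullback D g v) \<le> M"
    using M [OF pairings_image [OF g]] variation_pullback [OF g] by simp
  ultimately show ?thesis by (auto simp: bv_functions_def)
qed

lemma pullback_add: "pullback D g (\<lambda>t. u t + v t) = (\<lambda>t. pullback D g u t + pullback D g v t)"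
  by (auto simp: pullback_def)

lemma pullback_diff: "pullback D g (\<lambda>t. u t - v t) = (\<lambda>t. pullback D g u t - pullback D g v t)"
  by (auto simp: pullback_def)

lemma pullback_scale: "pullback D g (\<lambda>t. a * v t) = (\<lambda>t. a * pullback D g v t)"
  by (auto simp: pullback_def)

lemma bv_space_pullback:
  assumes g: "homeomorphic_maps D D g g'" and v: "v \<in> carrier (bv_space D)"
  shows "pullback D g v \<in> carrier (bv_space D)"
proof -
  have "\<exists>b\<in>bv_functions D. bv_bounded D (\<lambda>x. pullback D g v x - b x) e" if e: "0 < e" for e
  proof -
    obtain b where b: "b \<in> bv_functions D" "bv_bounded D (\<lambda>x. v x - b x) e"
      using bv_space_approximable [OF v e] .
    then show ?thesis
      using bv_bounded_pullback [OF g b(2)] bv_functions_pullback [OF g b(1)]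
      by (auto simp: pullback_diff)
  qed
  moreover have "continuous_map D D g" using g by (simp add: homeomorphic_maps_def)
  ultimately show ?thesis using v cfunctions_pullback by (auto simp: bv_space_carrier)
qed

lemma pullback_inverse:
  assumes g: "homeomorphic_maps D D g g'" and v: "v \<in> carrier (bv_space D)"
  shows "pullback D g' (pullback D g v) = v"
proof
  fix x
  show "pullback D g' (pullback D g v) x = v x"
    using g v by (cases "x \<in> topspace D")
      (auto simp: pullback_def homeomorphic_maps_def bv_space_carrier cfunctions_def continuous_map_def Pi_iff)
qed

lemma bv_norm_pullback:
  assumes D: "compact_space D" and g: "homeomorphic_maps D D g g'" and v: "v \<in> carrier (bv_space D)"
  shows "bv_norm D (pullback D g v) = bv_norm D v"
proof (rule antisym)
  show "bv_norm D (pullback D g v) \<le> bv_norm D v"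
    by (rule bv_norm_le [OF bv_bounded_pullback [OF g bv_space_bounded [OF D v]]])
  have g': "homeomorphic_maps D D g' g" using g homeomorphic_maps_sym by blast
  have "bv_norm D (pullback D g' (pullback D g v)) \<le> bv_norm D (pullback D g v)"
    by (rule bv_norm_le [OF bv_bounded_pullback [OF g' bv_space_bounded [OF D bv_space_pullback [OF g v]]]])
  then show "bv_norm D v \<le> bv_norm D (pullback D g v)"
    using pullback_inverse [OF g v] by simp
qed

definition pullback_operator :: "'a topology \<Rightarrow> ('a \<Rightarrow> 'a) \<Rightarrow> ('a \<Rightarrow> real) \<Rightarrow> 'a \<Rightarrow> real" where
  "pullback_operator D g = restrict (pullback D g) (carrier (bv_space D))"

lemma pullback_operator_isometry:
  assumes D: "compact_space D" and g: "homeomorphic_maps D D g g'"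
  shows "pullback_operator D g \<in> carrier (isometry_group (bv_space D))"
proof -
  let ?V = "carrier (bv_space D)"
  have g': "homeomorphic_maps D D g' g" using g homeomorphic_maps_sym by blast
  have "bij_betw (pullback D g) ?V ?V"
    using bv_space_pullback [OF g] bv_space_pullback [OF g'] pullback_inverse [OF g] pullback_inverse [OF g']
    by (intro bij_betwI [where g = "pullback D g'"]) auto
  then have "bij_betw (pullback_operator D g) ?V ?V"
    unfolding pullback_operator_def by (subst bij_betw_restrict_eq)
  moreover have "linear_map (bv_space D) (bv_space D) (pullback_operator D g)"
    unfolding linear_map_def pullback_operator_def
    using bv_space_pullback [OF g] function_space_add_closed [OF bv_space_function_space [of D]]
      function_space_scale_closed [OF bv_space_function_space [of D]]
    by (auto simp: pullback_add pullback_scale)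
  ultimately show ?thesis
    using bv_norm_pullback [OF D g]
    by (auto simp: isometry_group_def Bij_def pullback_operator_def)
qed

section \<open>The representation of a continuous action\<close>

lemma continuous_action_homeomorphic_maps:
  assumes act: "continuous_action G T D act" and T: "topological_group G T" and g: "g \<in> carrier G"
  shows "homeomorphic_maps D D (act g) (act (inv\<^bsub>G\<^esub> g))"
proof -
  interpret group_action G "topspace D" act using act by (simp add: continuous_action_def)
  have cont: "continuous_map D D (act h)" if h: "h \<in> carrier G" for h
  proof -
    have "continuous_map D (prod_topology T D) (\<lambda>x. (h, x))"
      using h T by (intro continuous_map_pairedI) (auto simp: topological_group_def)
    then have "continuous_map D D ((\<lambda>(g, x). act g x) \<circ> (\<lambda>x. (h, x)))"
      using act by (intro continuous_map_compose) (auto simp: continuous_action_def)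
    then show ?thesis by (simp add: o_def)
  qed
  have G: "Group.group G" using group_hom by (rule group_hom.axioms(1))
  have inv: "inv\<^bsub>G\<^esub> g \<in> carrier G" using G g by (rule group.inv_closed)
  have 1: "act (inv\<^bsub>G\<^esub> g) (act g x) = x" if "x \<in> topspace D" for x
    using orbit_sym_aux [OF g that refl] .
  have 2: "act g (act (inv\<^bsub>G\<^esub> g) x) = x" if "x \<in> topspace D" for x
    using orbit_sym_aux [OF inv that refl] group.inv_inv [OF G g] by simp
  show ?thesis
    unfolding homeomorphic_maps_def using cont [OF g] cont [OF inv] 1 2 by blast
qed

text \<open>The points of G x D where the two values differ by less than \<open>e\<close> form an
  open set containing {g} x D. By the tube lemma it contains U x D, since \<open>D\<close> is
  compact.\<close>

lemma continuous_action_uniformly_close: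
  assumes act: "continuous_action G T D act" and T: "topspace T = carrier G" and D: "compact_space D"
    and f: "f \<in> cfunctions D" and g: "g \<in> carrier G" and e: "0 < e"
  obtains U where "openin T U" "g \<in> U"
    "\<And>h x. h \<in> U \<Longrightarrow> \<bar>pullback D (act g) f x - pullback D (act h) f x\<bar> < e"
proof -
  have cf: "continuous_map D euclideanreal f" using f by (simp add: cfunctions_def)
  have a: "continuous_map (prod_topology T D) D (\<lambda>(g, x). act g x)"
    using act by (simp add: continuous_action_def)
  have "continuous_map (prod_topology T D) D ((\<lambda>(g, x). act g x) \<circ> (\<lambda>p. (g, snd p)))"
    using g T by (intro continuous_map_compose [OF _ a] continuous_map_pairedI continuous_map_snd) auto
  from continuous_map_compose [OF this cf]
  have 1: "continuous_map (prod_topology T D) euclideanreal (\<lambda>p. f (act g (snd p)))" by (simp add: o_def)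
  have 2: "continuous_map (prod_topology T D) euclideanreal (\<lambda>p. f (act (fst p) (snd p)))"
    using continuous_map_compose [OF a cf] by (simp add: o_def case_prod_beta)
  define W where "W = {p \<in> topspace (prod_topology T D). \<bar>f (act g (snd p)) - f (act (fst p) (snd p))\<bar> < e}"
  have "continuous_map (prod_topology T D) euclideanreal (\<lambda>p. \<bar>f (act g (snd p)) - f (act (fst p) (snd p))\<bar>)"
    using 1 2 by (intro continuous_map_real_abs continuous_map_diff)
  then have "openin (prod_topology T D) W"
    unfolding W_def continuous_map_upper_lower_semicontinuous_lt by blast
  moreover have "{g} \<times> topspace D \<subseteq> W" using g T e by (auto simp: W_def)
  ultimately obtain U V where U: "openin T U" "openin D V" "g \<in> U" "topspace D \<subseteq> V" "U \<times> V \<subseteq> W"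
    using tube_lemma_right [of T D W "topspace D" g] D g T by (auto simp: compact_space_def)
  have "\<bar>pullback D (act g) f x - pullback D (act h) f x\<bar> < e" if "h \<in> U" for h x
  proof (cases "x \<in> topspace D")
    case True
    then have "(h, x) \<in> W" using U that by blast
    then show ?thesis using True by (simp add: W_def pullback_def)
  qed (use e in \<open>simp add: pullback_def\<close>)
  then show thesis using that U by blast
qed

text \<open>Both translates have variation at most \<open>M\<close>, so their difference has
  variation at most \<open>2 * M\<close> for every \<open>h\<close>. Uniform closeness then controls
  the quadratic variation through \<open>qvariation_square_le\<close>.\<close>

lemma bv_pullback_continuous:
  assumes act: "continuous_action G T D act" and T: "topological_group G T" and D: "compact_space D"
    and b: "b \<in> bv_functions D" and g: "g \<in> carrier G" and e: "0 < e"
  obtains U where "openin T U" "g \<in> U"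
    "\<And>h. h \<in> U \<Longrightarrow> bv_bounded D (\<lambda>x. pullback D (act g) b x - pullback D (act h) b x) e"
proof -
  have topT: "topspace T = carrier G" using T by (simp add: topological_group_def)
  obtain M where M: "\<And>P. P \<in> pairings D \<Longrightarrow> variation P b \<le> M"
    using b by (auto simp: bv_functions_def)
  have M0: "0 \<le> M" using M [OF empty_pairing] by (simp add: variation_def)
  \<comment> \<open>The first bound leaves \<open>e / 2\<close> for the sup norm, the second makes
    \<open>2 * s * (2 * M)\<close> at most \<open>(e / 2)\<^sup>2\<close>; \<open>M + 1\<close>
    avoids division by 0.\<close>
  define s where "s = min (e / 2) ((e / 2)\<^sup>2 / (4 * (M + 1)))"
  have s: "s \<le> e / 2" "s \<le> (e / 2)\<^sup>2 / (4 * (M + 1))"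
    unfolding s_def by (rule min.cobounded1, rule min.cobounded2)
  have s0: "0 < s" using e M0 by (simp add: s_def)
  have "2 * s * (2 * M) = 4 * s * M" by simp
  also have "\<dots> \<le> 4 * ((e / 2)\<^sup>2 / (4 * (M + 1))) * M"
    using M0 s(2) by (intro mult_right_mono mult_left_mono) auto
  also have "\<dots> = (e / 2)\<^sup>2 * (M / (M + 1))" using M0 by (simp add: field_simps)
  also have "\<dots> \<le> (e / 2)\<^sup>2 * 1" using M0 by (intro mult_left_mono) auto
  finally have sM: "2 * s * (2 * M) \<le> (e / 2)\<^sup>2" by simp
  have "b \<in> cfunctions D" using b by (simp add: bv_functions_def)
  then obtain U where U: "openin T U" "g \<in> U"
    "\<And>h x. h \<in> U \<Longrightarrow> \<bar>pullback D (act g) b x - pullback D (act h) b x\<bar> < s"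
    using continuous_action_uniformly_close [OF act topT D _ g s0] by blast
  have "bv_bounded D (\<lambda>x. pullback D (act g) b x - pullback D (act h) b x) e" if h: "h \<in> U" for h
  proof -
    define d where "d x = pullback D (act g) b x - pullback D (act h) b x" for x
    have hG: "h \<in> carrier G" using h openin_subset [OF U(1)] topT by blast
    have var: "variation P (pullback D (act k) b) \<le> M" if "P \<in> pairings D" "k \<in> carrier G" for P k
      using M pairings_image variation_pullback that continuous_action_homeomorphic_maps [OF act T] by metis
    have small: "\<bar>d x\<bar> \<le> s" for x using U(3) [OF h, of x] by (simp add: d_def)
    have "qvariation P d \<le> e / 2" if P: "P \<in> pairings D" for P
    proof (rule power2_le_imp_le)
      have "variation P d \<le> variation P (pullback D (act g) b) + variation P (\<lambda>x. (- 1) * pullback D (act h) b x)"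
        using variation_add [of P "pullback D (act g) b" "\<lambda>x. (- 1) * pullback D (act h) b x"]
        by (simp add: d_def [abs_def])
      also have "\<dots> \<le> 2 * M"
        unfolding variation_scale using var [OF P g] var [OF P hG] by simp
      finally have "variation P d \<le> 2 * M" .
      then have "2 * s * variation P d \<le> 2 * s * (2 * M)"
        using s0 by (intro mult_left_mono) auto
      then show "(qvariation P d)\<^sup>2 \<le> (e / 2)\<^sup>2"
        using qvariation_square_le [of d s P, OF small] sM by linarith
    qed (use e in simp)
    moreover have "\<bar>d x\<bar> \<le> e / 2" for x using small [of x] s(1) by linarith
    ultimately have "bv_bounded D d (e / 2 + e / 2)" by (intro bv_boundedI)
    then show ?thesis by (simp add: d_def [abs_def])
  qed
  then show thesis using that U by blast
qed

text \<open>Translation preserves \<open>bv_bounded\<close>, so one approximant \<open>b\<close>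
  serves all group elements at once: two errors of \<open>e / 4\<close> from approximation and one
  from the movement of \<open>b\<close>.\<close>

lemma pullback_strongly_continuous:
  assumes act: "continuous_action G T D act" and T: "topological_group G T" and D: "compact_space D"
    and v: "v \<in> carrier (bv_space D)" and g: "g \<in> carrier G" and e: "0 < e"
  obtains U where "openin T U" "g \<in> U"
    "\<And>h. h \<in> U \<Longrightarrow> bv_norm D (\<lambda>x. pullback D (act g) v x - pullback D (act h) v x) < e"
proof -
  have e4: "0 < e / 4" using e by simp
  obtain b where b: "b \<in> bv_functions D" "bv_bounded D (\<lambda>x. v x - b x) (e / 4)"
    using bv_space_approximable [OF v e4] .
  obtain U where U: "openin T U" "g \<in> U"
    "\<And>h. h \<in> U \<Longrightarrow> bv_bounded D (\<lambda>x. pullback D (act g) b x - pullback D (act h) b x) (e / 4)"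
    using bv_pullback_continuous [OF act T D b(1) g e4] by blast
  have "bv_norm D (\<lambda>x. pullback D (act g) v x - pullback D (act h) v x) < e" if h: "h \<in> U" for h
  proof -
    have hG: "h \<in> carrier G" using h openin_subset [OF U(1)] T by (auto simp: topological_group_def)
    have pb: "bv_bounded D (pullback D (act k) (\<lambda>x. v x - b x)) (e / 4)" if "k \<in> carrier G" for k
      using bv_bounded_pullback [OF continuous_action_homeomorphic_maps [OF act T that] b(2)] .
    have "bv_bounded D (\<lambda>x. (pullback D (act g) (\<lambda>x. v x - b x) x + (- 1) * pullback D (act h) (\<lambda>x. v x - b x) x)
        + (pullback D (act g) b x - pullback D (act h) b x)) ((e / 4 + \<bar>-1\<bar> * (e / 4)) + e / 4)"
      by (intro bv_bounded_add bv_bounded_scale pb g hG U(3) [OF h])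
    moreover have "(\<lambda>x. (pullback D (act g) (\<lambda>x. v x - b x) x + (- 1) * pullback D (act h) (\<lambda>x. v x - b x) x)
        + (pullback D (act g) b x - pullback D (act h) b x)) = (\<lambda>x. pullback D (act g) v x - pullback D (act h) v x)"
      by (auto simp: pullback_def)
    ultimately have "bv_norm D (\<lambda>x. pullback D (act g) v x - pullback D (act h) v x) \<le> (e / 4 + \<bar>-1\<bar> * (e / 4)) + e / 4"
      using bv_norm_le by metis
    then show ?thesis using e by simp
  qed
  then show thesis using that U by blast
qed

section \<open>Evaluation functionals and the embedding into the weak-star dual\<close>

lemma bv_space_abs_diff_le:
  assumes "compact_space D" "u \<in> carrier (bv_space D)" "v \<in> carrier (bv_space D)"
  shows "\<bar>u x - v x\<bar> \<le> bv_norm D (\<lambda>t. u t - v t)"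
  using bv_bounded_abs [OF bv_space_diff_bounded [OF assms], of x] by simp

definition evaluation :: "'a topology \<Rightarrow> 'a \<Rightarrow> ('a \<Rightarrow> real) \<Rightarrow> real" where
  "evaluation D x = restrict (\<lambda>v. v x) (carrier (bv_space D))"

lemma evaluation_dual:
  assumes D: "compact_space D"
  shows "evaluation D x \<in> dual (bv_space D)"
proof -
  note V = bv_space_function_space [of D]
  have "continuous_map (norm_topology (bv_space D)) euclideanreal (evaluation D x)"
  proof (rule continuous_map_real_norm_topology [OF V bv_space_normed_space [OF D]])
    fix u v assume uv: "u \<in> carrier (bv_space D)" "v \<in> carrier (bv_space D)"
    then show "\<bar>evaluation D x u - evaluation D x v\<bar> \<le> vnorm (bv_space D) (\<lambda>t. u t - v t)"
      using bv_space_abs_diff_le [OF D uv, of x] by (simp add: evaluation_def)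
  qed
  then show ?thesis
    using function_space_add_closed [OF V] function_space_scale_closed [OF V]
    by (auto simp: dual_def evaluation_def)
qed

lemma evaluation_dual_norm:
  assumes D: "compact_space D"
  shows "dual_norm (bv_space D) (evaluation D x) \<le> 1"
  unfolding dual_norm_def
proof (rule cSUP_least)
  have "(\<lambda>t. 0) \<in> carrier (bv_space D)"
    using bv_functions_subset_space zero_bv_function by blast
  moreover have "vnorm (bv_space D) (\<lambda>t. 0) \<le> 1"
    using bv_norm_le [OF bv_bounded_zero [of 1 D]] by simp
  ultimately show "{v \<in> carrier (bv_space D). vnorm (bv_space D) v \<le> 1} \<noteq> {}" by blast
next
  fix v assume "v \<in> {v \<in> carrier (bv_space D). vnorm (bv_space D) v \<le> 1}"
  then have v: "v \<in> carrier (bv_space D)" "bv_norm D v \<le> 1" by auto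
  then have "\<bar>v x\<bar> \<le> 1" using bv_bounded_abs [OF bv_space_bounded [OF D v(1)], of x] by linarith
  then show "\<bar>evaluation D x v\<bar> \<le> 1" using v(1) by (simp add: evaluation_def)
qed

lemma evaluation_continuous:
  assumes D: "compact_space D"
  shows "continuous_map D (weak_star_topology (bv_space D)) (evaluation D)"
proof -
  have "continuous_map D euclideanreal (\<lambda>x. evaluation D x v)" if "v \<in> carrier (bv_space D)" for v
    using that by (simp add: evaluation_def bv_space_carrier cfunctions_def)
  moreover have "evaluation D ` topspace D \<subseteq> extensional (carrier (bv_space D))"
    by (auto simp: evaluation_def)
  ultimately show ?thesis
    unfolding weak_star_topology_def continuous_map_in_subtopology continuous_map_componentwise
    using evaluation_dual [OF D] by blast
qed

text \<open>A continuous injection of a compact space into a Hausdorff space is an embedding;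
  injectivity is the separation of points by \<open>bv_functions\<close>.\<close>

lemma evaluation_embedding:
  assumes D: "dendron D"
  shows "embedding_map D (weak_star_topology (bv_space D)) (evaluation D)"
proof -
  have comp: "compact_space D" using D by (simp add: dendron_def continuum_def)
  have "inj_on (evaluation D) (topspace D)"
  proof (rule inj_onI, rule ccontr)
    fix x y assume xy: "x \<in> topspace D" "y \<in> topspace D" "evaluation D x = evaluation D y" "x \<noteq> y"
    obtain f where f: "f \<in> bv_functions D" "f x \<noteq> f y"
      using bv_functions_separate [OF D xy(1,2,4)] .
    then have "f \<in> carrier (bv_space D)" using bv_functions_subset_space by blast
    moreover have "evaluation D x f = evaluation D y f" using xy(3) by simp
    ultimately show False using f(2) by (simp add: evaluation_def)
  qed
  moreover have "Hausdorff_space (weak_star_topology (bv_space D))"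
    unfolding weak_star_topology_def
    by (intro Hausdorff_space_subtopology) (simp add: Hausdorff_space_product_topology)
  ultimately show ?thesis
    using evaluation_continuous [OF comp] comp by (intro continuous_imp_embedding_map)
qed

lemma isometry_group_mult:
  assumes "S \<in> carrier (isometry_group V)" "T \<in> carrier (isometry_group V)"
  shows "S \<otimes>\<^bsub>isometry_group V\<^esub> T = compose (carrier V) S T"
  using assms by (simp add: isometry_group_def BijGroup_def)

text \<open>Composing a function with \<open>g\<close> after \<open>k\<close> applies the operator
  of \<open>g\<close> first: this is the reversal of order demanded of a co-homomorphism.\<close>

lemma pullback_operator_compose:
  assumes k: "homeomorphic_maps D D k k'" and g: "homeomorphic_maps D D g g'"
    and gk: "\<And>x. x \<in> topspace D \<Longrightarrow> gk x = g (k x)"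
  shows "pullback_operator D gk = compose (carrier (bv_space D)) (pullback_operator D k) (pullback_operator D g)"
proof
  fix v
  show "pullback_operator D gk v = compose (carrier (bv_space D)) (pullback_operator D k) (pullback_operator D g) v"
  proof (cases "v \<in> carrier (bv_space D)")
    case True
    have "k x \<in> topspace D" if "x \<in> topspace D" for x
      using k that by (auto simp: homeomorphic_maps_def continuous_map_def Pi_iff)
    then show ?thesis
      using True bv_space_pullback [OF g True] gk
      by (auto simp: pullback_operator_def compose_def pullback_def)
  qed (simp add: pullback_operator_def compose_def)
qed

lemma continuous_action_representation:
  assumes D: "compact_space D" and T: "topological_group G T" and act: "continuous_action G T D act"
  shows "representation G T D act (bv_space D) (\<lambda>g. pullback_operator D (act g)) (evaluation D)"
proof -
  interpret A: group_action G "topspace D" act using act by (simp add: continuous_action_def)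
  note V = bv_space_function_space [of D]
  have topT: "topspace T = carrier G" using T by (simp add: topological_group_def)
  have hom: "homeomorphic_maps D D (act g) (act (inv\<^bsub>G\<^esub> g))" if "g \<in> carrier G" for g
    using continuous_action_homeomorphic_maps [OF act T that] .
  have iso: "pullback_operator D (act g) \<in> carrier (isometry_group (bv_space D))" if "g \<in> carrier G" for g
    using pullback_operator_isometry [OF D hom [OF that]] .
  have "pullback_operator D (act (g \<otimes>\<^bsub>G\<^esub> k)) =
      pullback_operator D (act k) \<otimes>\<^bsub>isometry_group (bv_space D)\<^esub> pullback_operator D (act g)"
    if "g \<in> carrier G" "k \<in> carrier G" for g k
    unfolding isometry_group_mult [OF iso [OF that(2)] iso [OF that(1)]]
    using A.composition_rule that by (intro pullback_operator_compose [OF hom hom]) auto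
  moreover have "continuous_map T (strong_operator_group_topology (bv_space D)) (\<lambda>g. pullback_operator D (act g))"
  proof -
    have "continuous_map T (norm_topology (bv_space D)) (\<lambda>g. pullback_operator D (act g) v)"
      if v: "v \<in> carrier (bv_space D)" for v
    proof (subst continuous_map_norm_topology [OF V bv_space_normed_space [OF D]])
      have eq: "pullback_operator D (act g) v = pullback D (act g) v" for g
        using v by (simp add: pullback_operator_def)
      show "(\<lambda>g. pullback_operator D (act g) v) \<in> topspace T \<rightarrow> carrier (bv_space D)"
        unfolding eq topT using bv_space_pullback [OF hom v] by blast
      show "\<forall>g\<in>topspace T. \<forall>e>0. \<exists>U. openin T U \<and> g \<in> U \<and>
          (\<forall>k\<in>U. vnorm (bv_space D) (\<lambda>t. pullback_operator D (act g) v t - pullback_operator D (act k) v t) < e)"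
      proof (intro ballI allI impI)
        fix g and e :: real assume g: "g \<in> topspace T" and e: "0 < e"
        then have gG: "g \<in> carrier G" using topT by simp
        obtain U where "openin T U" "g \<in> U"
            "\<And>h. h \<in> U \<Longrightarrow> bv_norm D (\<lambda>x. pullback D (act g) v x - pullback D (act h) v x) < e"
          using pullback_strongly_continuous [OF act T D v gG e] by blast
        then show "\<exists>U. openin T U \<and> g \<in> U \<and>
          (\<forall>k\<in>U. vnorm (bv_space D) (\<lambda>t. pullback_operator D (act g) v t - pullback_operator D (act k) v t) < e)"
          unfolding eq by auto
      qed
    qed
    moreover have "pullback_operator D f \<in> extensional (carrier (bv_space D))" for f
      by (simp add: pullback_operator_def)
    ultimately show ?thesis
      unfolding strong_operator_group_topology_def continuous_map_in_subtopology continuous_map_componentwise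
      using iso topT by blast
  qed
  moreover have "evaluation D (act g x) v = evaluation D x (pullback_operator D (act g) v)"
    if "v \<in> carrier (bv_space D)" "g \<in> carrier G" "x \<in> topspace D" for v g x
    using that bv_space_pullback [OF hom [OF that(2)] that(1)]
    by (simp add: evaluation_def pullback_operator_def pullback_def [of D "act g" v])
  ultimately show ?thesis
    unfolding representation_def
    using iso evaluation_continuous [OF D] evaluation_dual_norm [OF D] by blast
qed

theorem dendron_system_rosenthal:
  fixes D :: "'a topology"
  assumes D: "dendron D" and T: "topological_group G T" and act: "continuous_action G T D act"
  shows "rosenthal_representable_system TYPE('a \<Rightarrow> real) G T D act"
proof -
  have comp: "compact_space D" using D by (simp add: dendron_def continuum_def)
  show ?thesis
    unfolding rosenthal_representable_system_def
    using bv_space_rosenthal [OF comp] continuous_action_representation [OF comp T act]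
      evaluation_embedding [OF D] by blast
qed

section \<open>Tameness\<close>

text \<open>Point separation plus compactness of A x B. It provides the finite set of test functions
  both for tameness and for recovering the compact-open topology.\<close>

lemma bv_functions_separate_closed:
  assumes D: "dendron D" and A: "closedin D A" and B: "closedin D B" and AB: "A \<inter> B = {}"
  obtains F where "finite F" "F \<subseteq> bv_functions D"
    "\<And>y z. y \<in> A \<Longrightarrow> z \<in> B \<Longrightarrow> \<exists>v\<in>F. 1 < \<bar>v y - v z\<bar>"
proof -
  have comp: "compact_space D" using D by (simp add: dendron_def continuum_def)
  define W where "W v = {p \<in> topspace (prod_topology D D). 1 < \<bar>v (fst p) - v (snd p)\<bar>}" for v :: "'a \<Rightarrow> real"
  have open_W: "openin (prod_topology D D) (W v)" if v: "v \<in> bv_functions D" for v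
  proof -
    have cv: "continuous_map D euclideanreal v" using v by (simp add: bv_functions_def cfunctions_def)
    have "continuous_map (prod_topology D D) euclideanreal (\<lambda>p. \<bar>v (fst p) - v (snd p)\<bar>)"
      using continuous_map_compose [OF continuous_map_fst cv] continuous_map_compose [OF continuous_map_snd cv]
      by (intro continuous_map_real_abs continuous_map_diff) (auto simp: o_def)
    then show ?thesis
      unfolding W_def continuous_map_upper_lower_semicontinuous_lt by blast
  qed
  have cover: "A \<times> B \<subseteq> \<Union> (W ` bv_functions D)"
  proof
    fix p assume p: "p \<in> A \<times> B"
    obtain y z where yz: "p = (y, z)" "y \<in> A" "z \<in> B" using p by blast
    then have yzD: "y \<in> topspace D" "z \<in> topspace D" "y \<noteq> z"
      using AB closedin_subset [OF A] closedin_subset [OF B] by auto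
    obtain f where f: "f \<in> bv_functions D" "f y \<noteq> f z" using bv_functions_separate [OF D yzD] .
    \<comment> \<open>The rescaling makes the difference at \<open>(y, z)\<close> equal to 2, safely
      inside the open condition \<open>1 < \<bar>v y - v z\<bar>\<close>.\<close>
    define v where "v = (\<lambda>t. 2 / (f y - f z) * f t)"
    have "v y - v z = 2 / (f y - f z) * (f y - f z)" unfolding v_def by (simp only: right_diff_distrib)
    also have "\<dots> = 2" using f(2) nonzero_divide_eq_eq [of "f y - f z" 2] by (metis eq_iff_diff_eq_0 nonzero_eq_divide_eq)
    finally have "v y - v z = 2" .
    then have "p \<in> W v" using yz yzD by (simp add: W_def)
    moreover have "v \<in> bv_functions D" unfolding v_def using f(1) by (rule bv_functions_scale)
    ultimately show "p \<in> \<Union> (W ` bv_functions D)" by blast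
  qed
  have "compactin (prod_topology D D) (A \<times> B)"
    using A B comp closedin_compact_space by (auto simp: compactin_Times)
  then obtain \<F> where \<F>: "finite \<F>" "\<F> \<subseteq> W ` bv_functions D" "A \<times> B \<subseteq> \<Union>\<F>"
    using compactinD [OF _ _ cover] open_W by (metis (no_types, lifting) imageE)
  obtain F where F: "finite F" "F \<subseteq> bv_functions D" "\<F> = W ` F"
    using finite_subset_image [OF \<F>(1,2)] by blast
  have "\<exists>v\<in>F. 1 < \<bar>v y - v z\<bar>" if "y \<in> A" "z \<in> B" for y z
  proof -
    have "(y, z) \<in> \<Union> (W ` F)" using that \<F>(3) F(3) by blast
    then show ?thesis by (auto simp: W_def)
  qed
  then show thesis using that F by blast
qed

lemma exponential_dominates:
  fixes K :: real
  obtains n :: nat where "real n * K + 1 < 2 ^ n"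
proof -
  \<comment> \<open>The witness is \<open>n = 2 * k\<close>: then 2^n is at least (k + 1)^2, while k
    > 2 |K| keeps 2 k K below k^2.\<close>
  obtain k :: nat where k: "2 * \<bar>K\<bar> < real k" using reals_Archimedean2 by blast
  have "Suc k \<le> 2 ^ k" using less_exp [of k] by (simp add: Suc_le_eq)
  then have "real (Suc k) \<le> real (2 ^ k)" by (rule of_nat_mono)
  then have "(real k + 1) * (real k + 1) \<le> 2 ^ k * 2 ^ k"
    by (intro mult_mono) auto
  moreover have "real (2 * k) * K + 1 < (real k + 1) * (real k + 1)"
  proof -
    have "real k * (2 * K) \<le> real k * real k" using k by (intro mult_left_mono) auto
    moreover have "real (2 * k) * K = real k * (2 * K)" by simp
    moreover have "(real k + 1) * (real k + 1) = real k * real k + 2 * real k + 1"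
      by (simp add: algebra_simps)
    moreover have "0 < real k" using k by linarith
    ultimately show ?thesis by linarith
  qed
  moreover have "(2::real) ^ (2 * k) = 2 ^ k * 2 ^ k"
    by (simp add: power_add [symmetric] mult_2)
  ultimately have "real (2 * k) * K + 1 < 2 ^ (2 * k)"
    by linarith
  then show thesis by (rule that)
qed

text \<open>Independence of \<open>n\<close> translates of \<open>f\<close> gives \<open>2 ^ n\<close> points, consecutive ones being separated
  by one of boundedly many functions composed with one of the translations; the variations of the
  latter grow only linearly in \<open>n\<close>.\<close>

theorem dendron_system_tame:
  assumes D: "dendron D" and T: "topological_group G T" and act: "continuous_action G T D act"
  shows "tame_system G D act"
  unfolding tame_system_def
proof (intro allI impI notI, elim exE conjE)
  fix f F
  assume f: "continuous_map D euclideanreal f" and F: "range F \<subseteq> {\<lambda>x. f (act g x) |g. g \<in> carrier G}"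
    and ind: "independent_sequence (topspace D) F"
  obtain a b where ab: "a < b" and "\<forall>P M. finite P \<and> finite M \<and> P \<inter> M = {} \<longrightarrow>
      {x \<in> topspace D. (\<forall>n\<in>P. F n x < a) \<and> (\<forall>n\<in>M. b < F n x)} \<noteq> {}"
    using ind unfolding independent_sequence_def by (elim exE conjE)
  then have pts: "\<exists>x\<in>topspace D. (\<forall>n\<in>P. F n x < a) \<and> (\<forall>n\<in>M. b < F n x)"
    if "finite P" "finite M" "P \<inter> M = {}" for P M
    using that by fastforce
  have "\<forall>n. \<exists>g. g \<in> carrier G \<and> F n = (\<lambda>x. f (act g x))" using F by blast
  then obtain g where g: "\<And>n. g n \<in> carrier G" "\<And>n. F n = (\<lambda>x. f (act (g n) x))" by metis
  have hom: "homeomorphic_maps D D (act (g n)) (act (inv\<^bsub>G\<^esub> g n))" for n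
    using continuous_action_homeomorphic_maps [OF act T g(1)] .
  have actD: "act (g n) x \<in> topspace D" if "x \<in> topspace D" for n x
    using hom [of n] that by (auto simp: homeomorphic_maps_def continuous_map_def Pi_iff)
  \<comment> \<open>These sets depend on \<open>f\<close> and the two thresholds only. The test
    functions \<open>V\<close> and the bound \<open>K\<close> are therefore fixed before
    \<open>n\<close> is chosen.\<close>
  define A B where "A = {x \<in> topspace D. f x \<le> a}" and "B = {x \<in> topspace D. b \<le> f x}"
  have "closedin D A" "closedin D B" "A \<inter> B = {}"
    using f ab unfolding A_def B_def continuous_map_upper_lower_semicontinuous_le by auto
  then obtain V where V: "finite V" "V \<subseteq> bv_functions D"
      "\<And>y z. y \<in> A \<Longrightarrow> z \<in> B \<Longrightarrow> \<exists>v\<in>V. 1 < \<bar>v y - v z\<bar>"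
    using bv_functions_separate_closed [OF D] by metis
  have "\<forall>v\<in>V. \<exists>M. \<forall>P\<in>pairings D. variation P v \<le> M"
    using V(2) by (auto simp: bv_functions_def)
  then obtain M where M: "\<And>v P. v \<in> V \<Longrightarrow> P \<in> pairings D \<Longrightarrow> variation P v \<le> M v" by metis
  define K where "K = (\<Sum>v\<in>V. M v)"
  obtain n where n: "real n * K + 1 < 2 ^ n" by (rule exponential_dominates)
  \<comment> \<open>Each subset \<open>S\<close> of the first \<open>n\<close> indices prescribes
    which translates are below \<open>a\<close> and which above \<open>b\<close>; distinct subsets
    will give distinct points.\<close>
  have "\<exists>x. x \<in> topspace D \<and> (\<forall>i\<in>S. F i x < a) \<and> (\<forall>i\<in>{..<n} - S. b < F i x)" if "S \<subseteq> {..<n}" for S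
    using pts [of S "{..<n} - S"] finite_subset [OF that] by blast
  then obtain pt where pt: "\<And>S. S \<subseteq> {..<n} \<Longrightarrow> pt S \<in> topspace D"
      "\<And>S i. S \<subseteq> {..<n} \<Longrightarrow> i \<in> S \<Longrightarrow> F i (pt S) < a"
      "\<And>S i. S \<subseteq> {..<n} \<Longrightarrow> i < n \<Longrightarrow> i \<notin> S \<Longrightarrow> b < F i (pt S)"
    by (metis Diff_iff lessThan_iff)
  have sep: "\<exists>i<n. \<exists>v\<in>V. 1 < \<bar>v (act (g i) (pt S)) - v (act (g i) (pt S'))\<bar>"
    if S: "S \<subseteq> {..<n}" "S' \<subseteq> {..<n}" and i: "i \<in> S" "i \<notin> S'" for S S' i
  proof -
    have "i < n" using S i by blast
    then have "act (g i) (pt S) \<in> A" "act (g i) (pt S') \<in> B"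
      using pt(2) [OF S(1) i(1)] pt(3) [OF S(2) \<open>i < n\<close> i(2)] actD pt(1) S
      by (auto simp: A_def B_def g(2))
    then show ?thesis using V(3) \<open>i < n\<close> by blast
  qed
  have sep': "\<exists>i<n. \<exists>v\<in>V. 1 < \<bar>v (act (g i) (pt S)) - v (act (g i) (pt S'))\<bar>"
    if S: "S \<subseteq> {..<n}" "S' \<subseteq> {..<n}" and ne: "S \<noteq> S'" for S S'
  proof -
    obtain i where "i \<in> S \<and> i \<notin> S' \<or> i \<in> S' \<and> i \<notin> S" using ne by blast
    then show ?thesis
      using sep [OF S, of i] sep [OF S(2,1), of i] by (auto simp: abs_minus_commute)
  qed
  have "inj_on pt (Pow {..<n})"
  proof (rule inj_onI, rule ccontr)
    fix S S' assume "S \<in> Pow {..<n}" "S' \<in> Pow {..<n}" "pt S = pt S'" "S \<noteq> S'"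
    then show False using sep' [of S S'] by auto
  qed
  then have card: "card (pt ` Pow {..<n}) = 2 ^ n" by (simp add: card_image card_Pow)
  have "pt ` Pow {..<n} \<subseteq> topspace D" using pt(1) by blast
  then obtain P where P: "P \<in> pairings D" "card P = 2 ^ n - 1"
      "\<And>p. p \<in> P \<Longrightarrow> fst p \<in> pt ` Pow {..<n} \<and> snd p \<in> pt ` Pow {..<n} \<and> fst p \<noteq> snd p"
    using finite_set_pairing [of "pt ` Pow {..<n}" D] card by auto
  define w where "w i v p = \<bar>pullback D (act (g i)) v (fst p) - pullback D (act (g i)) v (snd p)\<bar>" for i v p
  have "1 \<le> (\<Sum>i<n. \<Sum>v\<in>V. w i v p)" if p: "p \<in> P" for p
  proof -
    obtain S S' where S: "S \<subseteq> {..<n}" "S' \<subseteq> {..<n}" "fst p = pt S" "snd p = pt S'" "pt S \<noteq> pt S'"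
      using P(3) [OF p] by auto
    then have "S \<noteq> S'" by blast
    with S obtain i v where iv: "i < n" "v \<in> V" "1 < \<bar>v (act (g i) (fst p)) - v (act (g i) (snd p))\<bar>"
      using sep' [of S S'] by auto
    then have "1 < w i v p" using S pt(1) by (simp add: w_def pullback_def)
    also have "\<dots> \<le> (\<Sum>v\<in>V. w i v p)"
      using iv V(1) by (intro member_le_sum) (auto simp: w_def)
    also have "\<dots> \<le> (\<Sum>i<n. \<Sum>v\<in>V. w i v p)"
      using iv member_le_sum [of i "{..<n}" "\<lambda>i. \<Sum>v\<in>V. w i v p"] by (simp add: w_def sum_nonneg)
    finally show ?thesis by simp
  qed
  \<comment> \<open>Each of the \<open>2 ^ n - 1\<close> pairs contributes at least 1, whereas
    summing first over pairs bounds the total by \<open>real n * K\<close>, since each translate of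
    \<open>v\<close> has variation at most \<open>M v\<close>.\<close>
  then have "(\<Sum>p\<in>P. 1) \<le> (\<Sum>p\<in>P. \<Sum>i<n. \<Sum>v\<in>V. w i v p)" by (rule sum_mono)
  also have "\<dots> = (\<Sum>i<n. \<Sum>p\<in>P. \<Sum>v\<in>V. w i v p)" by (rule sum.swap)
  also have "\<dots> = (\<Sum>i<n. \<Sum>v\<in>V. variation P (pullback D (act (g i)) v))"
    unfolding variation_def w_def by (intro sum.cong refl sum.swap)
  also have "\<dots> \<le> (\<Sum>i<n. \<Sum>v\<in>V. M v)"
    using M pairings_image [OF hom P(1)] variation_pullback [OF hom P(1)] by (intro sum_mono) simp
  also have "\<dots> = real n * K" by (simp add: K_def)
  finally have "real (card P) \<le> real n * K" by simp
  then show False using P(2) n by (simp add: of_nat_diff)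
qed

section \<open>The homeomorphism group\<close>

text \<open>Closure conditions in terms of concrete maps, shared by the isometry group and the
  homeomorphism group.\<close>

lemma BijGroup_subgroupI:
  assumes sub: "C \<subseteq> Bij S" and one: "(\<lambda>x\<in>S. x) \<in> C"
    and mult: "\<And>f g. f \<in> C \<Longrightarrow> g \<in> C \<Longrightarrow> compose S f g \<in> C"
    and inv: "\<And>f. f \<in> C \<Longrightarrow> restrict (inv_into S f) S \<in> C"
  shows "subgroup C (BijGroup S)"
proof (rule group.subgroupI [OF group_BijGroup])
  show "C \<subseteq> carrier (BijGroup S)" using sub by (simp add: BijGroup_def)
  show "C \<noteq> {}" using one by blast
  show "inv\<^bsub>BijGroup S\<^esub> f \<in> C" if "f \<in> C" for f
    using inv [OF that] inv_BijGroup [of f S] sub that by (auto simp: subset_iff)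
  show "f \<otimes>\<^bsub>BijGroup S\<^esub> g \<in> C" if "f \<in> C" "g \<in> C" for f g
    using mult [OF that] sub that by (auto simp: BijGroup_def subset_iff)
qed

lemma isometry_group_subgroup:
  assumes V: "normed_space V"
  shows "subgroup (carrier (isometry_group V)) (BijGroup (carrier V))"
proof (rule BijGroup_subgroupI)
  interpret M: Module.module real_ring V using V by (simp add: normed_space_def)
  have smult: "a \<odot>\<^bsub>V\<^esub> x \<in> carrier V" if "x \<in> carrier V" for a x
    using M.smult_closed [of a x] that by (simp add: real_ring_def)
  have iso: "f \<in> carrier (isometry_group V) \<longleftrightarrow> f \<in> Bij (carrier V) \<and> linear_map V V f \<and>
      (\<forall>x\<in>carrier V. vnorm V (f x) = vnorm V x)" for f
    by (simp add: isometry_group_def)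
  show "carrier (isometry_group V) \<subseteq> Bij (carrier V)" by (auto simp: iso)
  show "(\<lambda>x\<in>carrier V. x) \<in> carrier (isometry_group V)"
    using smult by (auto simp: iso id_Bij linear_map_def)
  fix f assume f: "f \<in> carrier (isometry_group V)"
  have fV: "f x \<in> carrier V" if "x \<in> carrier V" for x
    using f that by (auto simp: iso linear_map_def)
  have f_add: "f (x \<oplus>\<^bsub>V\<^esub> y) = f x \<oplus>\<^bsub>V\<^esub> f y" if "x \<in> carrier V" "y \<in> carrier V" for x y
    using f that by (auto simp: iso linear_map_def)
  have f_smult: "f (a \<odot>\<^bsub>V\<^esub> x) = a \<odot>\<^bsub>V\<^esub> f x" if "x \<in> carrier V" for a x
    using f that by (auto simp: iso linear_map_def)
  have f_norm: "vnorm V (f x) = vnorm V x" if "x \<in> carrier V" for x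
    using f that by (auto simp: iso)
  show "compose (carrier V) f g \<in> carrier (isometry_group V)"
    if g: "g \<in> carrier (isometry_group V)" for g
  proof -
    have gV: "g x \<in> carrier V" if "x \<in> carrier V" for x
      using g that by (auto simp: iso linear_map_def)
    have "linear_map V V (compose (carrier V) f g)"
      using g gV fV f_add f_smult smult by (auto simp: iso linear_map_def compose_eq)
    moreover have "compose (carrier V) f g \<in> Bij (carrier V)"
      using f g by (auto simp: iso intro: compose_Bij)
    ultimately show ?thesis
      using f_norm g gV by (auto simp: iso compose_eq)
  qed
  define k where "k = restrict (inv_into (carrier V) f) (carrier V)"
  have bij: "bij_betw f (carrier V) (carrier V)" using f by (simp add: iso Bij_def)
  have kV: "k y \<in> carrier V" if "y \<in> carrier V" for y
    using that bij by (simp add: k_def bij_betw_def inv_into_into)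
  have fk: "f (k y) = y" if "y \<in> carrier V" for y
    using that bij by (simp add: k_def bij_betw_def f_inv_into_f)
  have kf: "k (f x) = x" if "x \<in> carrier V" for x
    using that bij fV by (simp add: k_def bij_betw_def inv_into_f_f)
  have "linear_map V V k"
    unfolding linear_map_def
  proof (intro conjI ballI allI)
    show "k \<in> carrier V \<rightarrow> carrier V" using kV by blast
    show "k (x \<oplus>\<^bsub>V\<^esub> y) = k x \<oplus>\<^bsub>V\<^esub> k y" if "x \<in> carrier V" "y \<in> carrier V" for x y
      using kf [of "k x \<oplus>\<^bsub>V\<^esub> k y"] f_add [OF kV kV] fk kV that by simp
    show "k (a \<odot>\<^bsub>V\<^esub> x) = a \<odot>\<^bsub>V\<^esub> k x" if "x \<in> carrier V" for a x
      using kf [OF smult [OF kV [OF that]], of a] f_smult [OF kV [OF that]] fk [OF that] by simp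
  qed
  moreover have "vnorm V (k y) = vnorm V y" if "y \<in> carrier V" for y
    using f_norm [OF kV [OF that]] fk [OF that] by simp
  moreover have "k \<in> Bij (carrier V)"
    using f unfolding k_def by (intro restrict_inv_into_Bij) (simp add: iso)
  ultimately show "restrict (inv_into (carrier V) f) (carrier V) \<in> carrier (isometry_group V)"
    by (simp add: iso k_def)
qed

lemma isometry_group_group:
  assumes "normed_space V"
  shows "Group.group (isometry_group V)"
proof -
  have "isometry_group V = (BijGroup (carrier V))\<lparr>carrier := carrier (isometry_group V)\<rparr>"
    by (simp add: isometry_group_def)
  then show ?thesis
    using subgroup.subgroup_is_group [OF isometry_group_subgroup [OF assms] group_BijGroup] by simp
qed

section \<open>The homeomorphism group and its compact-open topology\<close>

lemma homeo_group_carrier: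
  "f \<in> carrier (homeo_group D) \<longleftrightarrow> f \<in> Bij (topspace D) \<and> homeomorphic_map D D f"
  by (simp add: homeo_group_def)

lemma homeomorphic_maps_inv_into:
  assumes f: "homeomorphic_map D D f"
  shows "homeomorphic_maps D D f (restrict (inv_into (topspace D) f) (topspace D))"
proof -
  obtain g where g: "homeomorphic_maps D D f g" using f homeomorphic_map_maps by blast
  have "g y = restrict (inv_into (topspace D) f) (topspace D) y" if "y \<in> topspace D" for y
  proof -
    have "g y \<in> topspace D" "f (g y) = y"
      using g that by (auto simp: homeomorphic_maps_def continuous_map_def Pi_iff)
    then have "inv_into (topspace D) f y = g y"
      using homeomorphic_imp_injective_map [OF f] by (metis inv_into_f_f)
    then show ?thesis using that by simp
  qed
  then show ?thesis using homeomorphic_maps_eq [OF g] by blast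
qed

lemma homeo_group_subgroup: "subgroup (carrier (homeo_group D)) (BijGroup (topspace D))"
proof (rule BijGroup_subgroupI)
  show "carrier (homeo_group D) \<subseteq> Bij (topspace D)" by (auto simp: homeo_group_carrier)
  have "homeomorphic_map D D (\<lambda>x\<in>topspace D. x)"
    by (rule homeomorphic_map_eq [of D D id]) auto
  then show "(\<lambda>x\<in>topspace D. x) \<in> carrier (homeo_group D)"
    by (simp add: homeo_group_carrier id_Bij)
  fix f assume f: "f \<in> carrier (homeo_group D)"
  show "restrict (inv_into (topspace D) f) (topspace D) \<in> carrier (homeo_group D)"
    using f homeomorphic_maps_inv_into [of D f]
    by (auto simp: homeo_group_carrier homeomorphic_maps_map intro: restrict_inv_into_Bij)
  show "compose (topspace D) f g \<in> carrier (homeo_group D)" if g: "g \<in> carrier (homeo_group D)" for g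
  proof -
    have "homeomorphic_map D D (f \<circ> g)"
      using f g homeomorphic_map_compose by (auto simp: homeo_group_carrier)
    then have "homeomorphic_map D D (compose (topspace D) f g)"
      by (rule homeomorphic_map_eq) (simp add: compose_eq)
    then show ?thesis using f g by (auto simp: homeo_group_carrier intro: compose_Bij)
  qed
qed

lemma homeo_group_update: "homeo_group D = (BijGroup (topspace D))\<lparr>carrier := carrier (homeo_group D)\<rparr>"
  by (simp add: homeo_group_def)

lemma homeo_group_group: "Group.group (homeo_group D)"
  using subgroup.subgroup_is_group [OF homeo_group_subgroup group_BijGroup]
  by (simp add: homeo_group_update [symmetric])

lemma homeo_group_mult:
  assumes "f \<in> carrier (homeo_group D)" "g \<in> carrier (homeo_group D)"
  shows "f \<otimes>\<^bsub>homeo_group D\<^esub> g = compose (topspace D) f g"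
  using assms by (simp add: homeo_group_def BijGroup_def)

lemma homeo_group_inv:
  assumes f: "f \<in> carrier (homeo_group D)"
  shows "inv\<^bsub>homeo_group D\<^esub> f = restrict (inv_into (topspace D) f) (topspace D)"
proof -
  have "inv\<^bsub>homeo_group D\<^esub> f = inv\<^bsub>BijGroup (topspace D)\<^esub> f"
    using group.m_inv_consistent [OF group_BijGroup homeo_group_subgroup f]
    by (simp add: homeo_group_update [symmetric])
  then show ?thesis using f by (simp add: homeo_group_carrier inv_BijGroup)
qed

lemma homeo_group_inv_maps:
  assumes f: "f \<in> carrier (homeo_group D)"
  shows "homeomorphic_maps D D f (inv\<^bsub>homeo_group D\<^esub> f)"
  unfolding homeo_group_inv [OF f]
  using f by (intro homeomorphic_maps_inv_into) (simp add: homeo_group_carrier)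

lemma homeo_group_continuous:
  "f \<in> carrier (homeo_group D) \<Longrightarrow> continuous_map D D f"
  by (simp add: homeo_group_carrier homeomorphic_imp_continuous_map)

lemma topspace_homeo_group_topology: "topspace (homeo_group_topology D) = carrier (homeo_group D)"
proof -
  have "carrier (homeo_group D) \<subseteq> topspace (compact_open_topology D D)"
  proof
    fix f assume f: "f \<in> carrier (homeo_group D)"
    \<comment> \<open>For empty \<open>K\<close> and \<open>U\<close> the subbasic condition is
      vacuous, so this member of the subbasis contains every continuous map.\<close>
    then have "f \<in> {f \<in> extensional (topspace D). continuous_map D D f \<and> f ` {} \<subseteq> {}}"
      using homeo_group_continuous [OF f] by (simp add: homeo_group_carrier Bij_imp_extensional)
    moreover have "compactin D {}" "openin D {}" by simp_all
    ultimately show "f \<in> topspace (compact_open_topology D D)"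
      unfolding compact_open_topology_def topology_generated_by_topspace by blast
  qed
  then show ?thesis by (auto simp: homeo_group_topology_def)
qed

lemma openin_homeo_group_topology:
  assumes "compactin D K" "openin D U"
  shows "openin (homeo_group_topology D) {f \<in> carrier (homeo_group D). f ` K \<subseteq> U}"
proof -
  let ?N = "{f \<in> extensional (topspace D). continuous_map D D f \<and> f ` K \<subseteq> U}"
  have "openin (compact_open_topology D D) ?N"
    unfolding compact_open_topology_def using assms by (intro topology_generated_by_Basis) blast
  moreover have "{f \<in> carrier (homeo_group D). f ` K \<subseteq> U} = ?N \<inter> carrier (homeo_group D)"
    using homeo_group_continuous [of _ D] by (auto simp: homeo_group_carrier Bij_imp_extensional)
  ultimately show ?thesis unfolding homeo_group_topology_def openin_subtopology by blast
qed

lemma continuous_map_homeo_group_topologyI: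
  assumes F: "F \<in> topspace X \<rightarrow> carrier (homeo_group D)"
    and op: "\<And>K U. compactin D K \<Longrightarrow> openin D U \<Longrightarrow> openin X {x \<in> topspace X. F x ` K \<subseteq> U}"
  shows "continuous_map X (homeo_group_topology D) F"
proof -
  let ?N = "\<lambda>K U. {f \<in> extensional (topspace D). continuous_map D D f \<and> f ` K \<subseteq> U}"
  have "continuous_map X (topology_generated_by {?N K U |K U. compactin D K \<and> openin D U}) F"
  proof (rule continuous_on_generated_topo)
    fix W assume "W \<in> {?N K U |K U. compactin D K \<and> openin D U}"
    then obtain K U where KU: "W = ?N K U" "compactin D K" "openin D U" by blast
    have "F -` W \<inter> topspace X = {x \<in> topspace X. F x ` K \<subseteq> U}"
      using F homeo_group_continuous [of _ D] by (auto simp: KU(1) homeo_group_carrier Bij_imp_extensional Pi_iff)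
    then show "openin X (F -` W \<inter> topspace X)" using op [OF KU(2,3)] by simp
  next
    have "F ` topspace X \<subseteq> carrier (homeo_group D)" using F by blast
    also have "\<dots> \<subseteq> \<Union> {?N K U |K U. compactin D K \<and> openin D U}"
      using topspace_homeo_group_topology [of D]
      unfolding homeo_group_topology_def compact_open_topology_def topspace_subtopology
        topology_generated_by_topspace by blast
    finally show "F ` topspace X \<subseteq> \<Union> {?N K U |K U. compactin D K \<and> openin D U}" .
  qed
  then show ?thesis
    unfolding homeo_group_topology_def compact_open_topology_def continuous_map_in_subtopology
    using F by blast
qed

text \<open>By normality of \<open>D\<close>, a neighbourhood \<open>W\<close> of \<open>A\<close>
  has closure inside the preimage of \<open>U\<close>. The closure is compact, so sending it into
  \<open>U\<close> is again a subbasic condition; this is what makes composition and evaluation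
  jointly continuous.\<close>

lemma homeo_group_interpose:
  assumes D: "compact_space D" "Hausdorff_space D" and f: "f \<in> carrier (homeo_group D)"
    and A: "compactin D A" and U: "openin D U" and fA: "f ` A \<subseteq> U"
  obtains W where "openin D W" "A \<subseteq> W"
    "openin (homeo_group_topology D) {k \<in> carrier (homeo_group D). k ` (D closure_of W) \<subseteq> U}"
    "f ` (D closure_of W) \<subseteq> U"
proof -
  define O' where "O' = {x \<in> topspace D. f x \<in> U}"
  have "openin D O'"
    unfolding O'_def using homeo_group_continuous [OF f] U by (rule openin_continuous_map_preimage)
  moreover have "closedin D A" using D A by (simp add: compactin_imp_closedin)
  moreover have "A \<subseteq> O'" using fA compactin_subset_topspace [OF A] by (auto simp: O'_def)
  moreover have "normal_space D" using D compact_Hausdorff_or_regular_imp_normal_space by blast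
  ultimately obtain W where W: "openin D W" "A \<subseteq> W" "D closure_of W \<subseteq> O'"
    unfolding normal_space_alt by meson
  have "compactin D (D closure_of W)" using D by (simp add: closedin_compact_space)
  then show thesis
    using that [OF W(1,2) openin_homeo_group_topology [OF _ U]] W(3) by (auto simp: O'_def)
qed

lemma homeo_group_topological_group:
  assumes D: "compact_space D" "Hausdorff_space D"
  shows "topological_group (homeo_group D) (homeo_group_topology D)"
proof -
  let ?G = "homeo_group D" and ?T = "homeo_group_topology D"
  interpret G: Group.group ?G by (rule homeo_group_group)
  note top = topspace_homeo_group_topology [of D]
  have "continuous_map (prod_topology ?T ?T) ?T (\<lambda>(f, g). f \<otimes>\<^bsub>?G\<^esub> g)"
  proof (rule continuous_map_homeo_group_topologyI)
    show "(\<lambda>(f, g). f \<otimes>\<^bsub>?G\<^esub> g) \<in> topspace (prod_topology ?T ?T) \<rightarrow> carrier ?G"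
      by (auto simp: top)
    fix K U assume K: "compactin D K" and U: "openin D U"
    have KD: "K \<subseteq> topspace D" using K by (rule compactin_subset_topspace)
    define Z where "Z = {p \<in> topspace (prod_topology ?T ?T). (\<lambda>(f, g). f \<otimes>\<^bsub>?G\<^esub> g) p ` K \<subseteq> U}"
    have "\<exists>N. openin (prod_topology ?T ?T) N \<and> p \<in> N \<and> N \<subseteq> Z" if p: "p \<in> Z" for p
    proof -
      obtain f g where fg: "p = (f, g)" "f \<in> carrier ?G" "g \<in> carrier ?G" "(f \<otimes>\<^bsub>?G\<^esub> g) ` K \<subseteq> U"
        using p by (auto simp: Z_def top)
      have gK: "compactin D (g ` K)"
        using image_compactin [OF K homeo_group_continuous [OF fg(3)]] .
      have "f ` (g ` K) \<subseteq> U"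
        using fg(4) KD by (auto simp: homeo_group_mult [OF fg(2,3)] compose_eq subset_iff)
      then obtain W where W: "openin D W" "g ` K \<subseteq> W"
        "openin ?T {k \<in> carrier ?G. k ` (D closure_of W) \<subseteq> U}" "f ` (D closure_of W) \<subseteq> U"
        using homeo_group_interpose [OF D fg(2) gK U] by blast
      have WW: "W \<subseteq> D closure_of W" using W(1) by (simp add: closure_of_subset openin_subset)
      define N where "N = {k \<in> carrier ?G. k ` (D closure_of W) \<subseteq> U} \<times> {k \<in> carrier ?G. k ` K \<subseteq> W}"
      have "openin (prod_topology ?T ?T) N"
        unfolding N_def using W(3) openin_homeo_group_topology [OF K W(1)] by (simp add: openin_prod_Times_iff)
      moreover have "p \<in> N" using fg W by (simp add: N_def)
      moreover have "N \<subseteq> Z"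
      proof
        fix q assume "q \<in> N"
        then obtain k l where kl: "q = (k, l)" "k \<in> carrier ?G" "l \<in> carrier ?G"
            "k ` (D closure_of W) \<subseteq> U" "l ` K \<subseteq> W"
          by (auto simp: N_def)
        have "k (l x) \<in> U" if "x \<in> K" for x using kl(4,5) WW that by blast
        then have "(k \<otimes>\<^bsub>?G\<^esub> l) ` K \<subseteq> U"
          using KD by (auto simp: homeo_group_mult [OF kl(2,3)] compose_eq subset_iff)
        then show "q \<in> Z" using kl by (simp add: Z_def top)
      qed
      ultimately show ?thesis by blast
    qed
    then have "openin (prod_topology ?T ?T) Z" by (subst openin_subopen) blast
    then show "openin (prod_topology ?T ?T)
        {p \<in> topspace (prod_topology ?T ?T). (\<lambda>(f, g). f \<otimes>\<^bsub>?G\<^esub> g) p ` K \<subseteq> U}"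
      by (simp add: Z_def)
  qed
  moreover have "continuous_map ?T ?T (\<lambda>f. inv\<^bsub>?G\<^esub> f)"
  proof (rule continuous_map_homeo_group_topologyI)
    show "(\<lambda>f. inv\<^bsub>?G\<^esub> f) \<in> topspace ?T \<rightarrow> carrier ?G" by (simp add: top)
    fix K U assume K: "compactin D K" and U: "openin D U"
    have KD: "K \<subseteq> topspace D" using K by (rule compactin_subset_topspace)
    \<comment> \<open>The right-hand condition is subbasic for \<open>f\<close>: in a compact
      Hausdorff space \<open>topspace D - U\<close> is compact and \<open>topspace D - K\<close> is
      open.\<close>
    have "(inv\<^bsub>?G\<^esub> f) ` K \<subseteq> U \<longleftrightarrow> f ` (topspace D - U) \<subseteq> topspace D - K" if f: "f \<in> carrier ?G" for f
    proof -
      have inv: "\<And>x. x \<in> topspace D \<Longrightarrow> f x \<in> topspace D" "\<And>x. x \<in> topspace D \<Longrightarrow> (inv\<^bsub>?G\<^esub> f) x \<in> topspace D"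
          "\<And>x. x \<in> topspace D \<Longrightarrow> (inv\<^bsub>?G\<^esub> f) (f x) = x" "\<And>x. x \<in> topspace D \<Longrightarrow> f ((inv\<^bsub>?G\<^esub> f) x) = x"
        using homeo_group_inv_maps [OF f] by (auto simp: homeomorphic_maps_def continuous_map_def Pi_iff)
      show ?thesis
      proof
        assume L: "(inv\<^bsub>?G\<^esub> f) ` K \<subseteq> U"
        show "f ` (topspace D - U) \<subseteq> topspace D - K"
        proof
          fix y assume "y \<in> f ` (topspace D - U)"
          then obtain x where x: "y = f x" "x \<in> topspace D" "x \<notin> U" by blast
          then have "y \<notin> K" using L inv(3) by force
          then show "y \<in> topspace D - K" using inv(1) x by blast
        qed
      next
        assume R: "f ` (topspace D - U) \<subseteq> topspace D - K"
        show "(inv\<^bsub>?G\<^esub> f) ` K \<subseteq> U"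
        proof
          fix x assume "x \<in> (inv\<^bsub>?G\<^esub> f) ` K"
          then obtain y where y: "y \<in> K" "x = (inv\<^bsub>?G\<^esub> f) y" by blast
          then have "x \<in> topspace D" "f x = y" using inv KD by auto
          then show "x \<in> U" using R y(1) by blast
        qed
      qed
    qed
    then have "{f \<in> topspace ?T. (inv\<^bsub>?G\<^esub> f) ` K \<subseteq> U} = {f \<in> carrier ?G. f ` (topspace D - U) \<subseteq> topspace D - K}"
      unfolding top by (intro Collect_cong conj_cong refl)
    moreover have "compactin D (topspace D - U)" using D U by (intro closedin_compact_space) auto
    moreover have "openin D (topspace D - K)" using D K by (simp add: compactin_imp_closedin openin_diff)
    ultimately show "openin ?T {f \<in> topspace ?T. (inv\<^bsub>?G\<^esub> f) ` K \<subseteq> U}"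
      using openin_homeo_group_topology by simp
  qed
  ultimately show ?thesis
    unfolding topological_group_def using G.group_axioms top by blast
qed

lemma homeo_group_continuous_action:
  assumes D: "compact_space D" "Hausdorff_space D"
  shows "continuous_action (homeo_group D) (homeo_group_topology D) D (\<lambda>f. f)"
proof -
  let ?G = "homeo_group D" and ?T = "homeo_group_topology D"
  note top = topspace_homeo_group_topology [of D]
  have "(\<lambda>f. f) \<in> hom ?G (BijGroup (topspace D))"
    by (auto simp: hom_def homeo_group_def BijGroup_def)
  then have "group_action ?G (topspace D) (\<lambda>f. f)"
    by (simp add: group_action_def group_hom_def group_hom_axioms_def homeo_group_group group_BijGroup)
  moreover have "continuous_map (prod_topology ?T D) D (\<lambda>(f, x). f x)"
    unfolding continuous_map_def
  proof (intro conjI allI impI)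
    show "(\<lambda>(f, x). f x) \<in> topspace (prod_topology ?T D) \<rightarrow> topspace D"
      using homeo_group_continuous by (fastforce simp: top continuous_map_def)
    fix U assume U: "openin D U"
    define Z where "Z = {p \<in> topspace (prod_topology ?T D). (\<lambda>(f, x). f x) p \<in> U}"
    have "\<exists>N. openin (prod_topology ?T D) N \<and> p \<in> N \<and> N \<subseteq> Z" if p: "p \<in> Z" for p
    proof -
      obtain f x where fx: "p = (f, x)" "f \<in> carrier ?G" "x \<in> topspace D" "f x \<in> U"
        using p by (auto simp: Z_def top)
      then have "compactin D {x}" "f ` {x} \<subseteq> U" by auto
      then obtain W where W: "openin D W" "{x} \<subseteq> W"
        "openin ?T {k \<in> carrier ?G. k ` (D closure_of W) \<subseteq> U}" "f ` (D closure_of W) \<subseteq> U"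
        using homeo_group_interpose [OF D fx(2) _ U] by blast
      have WW: "W \<subseteq> D closure_of W" "W \<subseteq> topspace D"
        using W(1) by (simp_all add: closure_of_subset openin_subset)
      define N where "N = {k \<in> carrier ?G. k ` (D closure_of W) \<subseteq> U} \<times> W"
      have "openin (prod_topology ?T D) N"
        unfolding N_def using W by (simp add: openin_prod_Times_iff)
      moreover have "p \<in> N" using fx W by (simp add: N_def)
      moreover have "N \<subseteq> Z" using WW by (auto simp: N_def Z_def top)
      ultimately show ?thesis by blast
    qed
    then have "openin (prod_topology ?T D) Z" by (subst openin_subopen) blast
    then show "openin (prod_topology ?T D) {p \<in> topspace (prod_topology ?T D). (\<lambda>(f, x). f x) p \<in> U}"
      by (simp add: Z_def)
  qed
  ultimately show ?thesis by (simp add: continuous_action_def)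
qed

lemma pullback_operator_inj:
  assumes D: "dendron D"
  shows "inj_on (pullback_operator D) (carrier (homeo_group D))"
proof (rule inj_onI)
  fix f g assume fg: "f \<in> carrier (homeo_group D)" "g \<in> carrier (homeo_group D)"
    "pullback_operator D f = pullback_operator D g"
  show "f = g"
  proof (rule extensionalityI)
    show "f \<in> extensional (topspace D)" "g \<in> extensional (topspace D)"
      using fg by (auto simp: homeo_group_carrier Bij_imp_extensional)
    fix x assume x: "x \<in> topspace D"
    show "f x = g x"
    proof (rule ccontr)
      assume ne: "f x \<noteq> g x"
      have "f x \<in> topspace D" "g x \<in> topspace D"
        using x fg homeo_group_continuous by (auto simp: continuous_map_def Pi_iff)
      then obtain v where v: "v \<in> bv_functions D" "v (f x) \<noteq> v (g x)"
        using bv_functions_separate [OF D] ne by metis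
      have "v \<in> carrier (bv_space D)" using v(1) bv_functions_subset_space by blast
      moreover have "pullback_operator D f v x = pullback_operator D g v x" using fg(3) by simp
      ultimately show False
        using v(2) x by (simp add: pullback_operator_def pullback_def)
    qed
  qed
qed

text \<open>Uniform closeness on finitely many functions separating \<open>g ` K\<close> from the complement of \<open>U\<close>
  forces a homeomorphism into the subbasic set of maps sending \<open>K\<close> into \<open>U\<close>.\<close>

lemma pullback_operator_inverse_continuous:
  assumes D: "dendron D"
  defines "H \<equiv> pullback_operator D ` carrier (homeo_group D)"
  shows "continuous_map (subtopology (strong_operator_group_topology (bv_space D)) H)
    (homeo_group_topology D) (inv_into (carrier (homeo_group D)) (pullback_operator D))"
proof -
  let ?G = "homeo_group D" and ?V = "bv_space D"
  let ?S = "subtopology (strong_operator_group_topology ?V) H"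
  define \<theta> where "\<theta> = inv_into (carrier ?G) (pullback_operator D)"
  have comp: "compact_space D" and T2: "Hausdorff_space D"
    using D by (auto simp: dendron_def continuum_def)
  note V = bv_space_function_space [of D] bv_space_normed_space [OF comp]
  interpret M: Metric_space "carrier ?V" "norm_dist ?V" using V by (rule function_space_metric)
  have topS: "topspace ?S \<subseteq> H" by simp
  have \<theta>: "\<theta> \<phi> \<in> carrier ?G" "pullback_operator D (\<theta> \<phi>) = \<phi>" if "\<phi> \<in> H" for \<phi>
    using that unfolding \<theta>_def H_def by (simp_all add: inv_into_into f_inv_into_f)
  have HV: "\<phi> v \<in> carrier ?V" if "\<phi> \<in> H" "v \<in> carrier ?V" for \<phi> v
    using bv_space_pullback [OF homeo_group_inv_maps] that
    by (auto simp: H_def pullback_operator_def)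
  have "continuous_map ?S (homeo_group_topology D) \<theta>"
  proof (rule continuous_map_homeo_group_topologyI)
    show "\<theta> \<in> topspace ?S \<rightarrow> carrier ?G" using \<theta> topS by blast
    fix K U assume K: "compactin D K" and U: "openin D U"
    have KD: "K \<subseteq> topspace D" using K by (rule compactin_subset_topspace)
    have "\<exists>N. openin ?S N \<and> \<phi> \<in> N \<and> N \<subseteq> {\<phi> \<in> topspace ?S. \<theta> \<phi> ` K \<subseteq> U}"
      if \<phi>: "\<phi> \<in> topspace ?S" "\<theta> \<phi> ` K \<subseteq> U" for \<phi>
    proof -
      have \<phi>H: "\<phi> \<in> H" using \<phi> topS by blast
      define g where "g = \<theta> \<phi>"
      have g: "g \<in> carrier ?G" using \<theta> \<phi>H by (simp add: g_def)
      have "closedin D (g ` K)"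
        using image_compactin [OF K homeo_group_continuous [OF g]] T2 compactin_imp_closedin by blast
      moreover have "closedin D (topspace D - U)" using U by blast
      moreover have "g ` K \<inter> (topspace D - U) = {}" using \<phi>(2) by (auto simp: g_def)
      ultimately obtain F where F: "finite F" "F \<subseteq> bv_functions D"
          "\<And>y z. y \<in> g ` K \<Longrightarrow> z \<in> topspace D - U \<Longrightarrow> \<exists>v\<in>F. 1 < \<bar>v y - v z\<bar>"
        using bv_functions_separate_closed [OF D] by metis
      have FV: "F \<subseteq> carrier ?V" using F(2) bv_functions_subset_space by blast
      define B where "B v = {\<psi> \<in> topspace ?S. \<psi> v \<in> M.mball (\<phi> v) 1}" for v
      have openB: "openin ?S (B v)" if v: "v \<in> F" for v
      proof -
        have "continuous_map (product_topology (\<lambda>_. norm_topology ?V) (carrier ?V)) (norm_topology ?V) (\<lambda>\<psi>. \<psi> v)"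
          using v FV by (intro continuous_map_product_projection) blast
        then have "continuous_map ?S (norm_topology ?V) (\<lambda>\<psi>. \<psi> v)"
          unfolding strong_operator_group_topology_def by (intro continuous_map_from_subtopology)
        moreover have "openin (norm_topology ?V) (M.mball (\<phi> v) 1)"
          unfolding norm_topology_def by (rule M.openin_mball)
        ultimately show ?thesis unfolding B_def by (rule openin_continuous_map_preimage)
      qed
      \<comment> \<open>The factor \<open>topspace ?S\<close> covers the case of empty
        \<open>F\<close>, where the intersection alone would be the whole type.\<close>
      define N where "N = topspace ?S \<inter> \<Inter> (B ` F)"
      have "openin ?S N"
      proof (cases "F = {}")
        case True
        then have "N = topspace ?S" by (simp only: N_def image_empty Inter_empty Int_UNIV_right)
        then show ?thesis by (simp only: openin_topspace)
      next
        case False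
        then show ?thesis
          unfolding N_def using F(1) openB by (intro openin_Int openin_topspace openin_Inter) blast+
      qed
      moreover have "\<phi> \<in> N"
      proof -
        have "\<phi> \<in> B v" if "v \<in> F" for v
        proof -
          have "v \<in> carrier ?V" using FV that by blast
          then have "\<phi> v \<in> carrier ?V" by (rule HV [OF \<phi>H])
          then have "\<phi> v \<in> M.mball (\<phi> v) 1"
            unfolding M.centre_in_mball_iff by (intro conjI zero_less_one)
          then show ?thesis using \<phi>(1) unfolding B_def by blast
        qed
        then show ?thesis unfolding N_def using \<phi>(1) by blast
      qed
      moreover have "\<theta> \<psi> ` K \<subseteq> U" if \<psi>: "\<psi> \<in> N" for \<psi>
      proof (rule image_subsetI, rule ccontr)
        fix x assume x: "x \<in> K" and nU: "\<theta> \<psi> x \<notin> U"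
        have \<psi>H: "\<psi> \<in> H" using \<psi> topS by (auto simp: N_def)
        have xD: "x \<in> topspace D" using x KD by blast
        have "\<theta> \<psi> x \<in> topspace D"
          using homeo_group_continuous [OF \<theta>(1) [OF \<psi>H]] xD by (auto simp: continuous_map_def Pi_iff)
        then obtain v where v: "v \<in> F" "1 < \<bar>v (g x) - v (\<theta> \<psi> x)\<bar>"
          using F(3) [of "g x" "\<theta> \<psi> x"] x nU by blast
        have vV: "v \<in> carrier ?V" using v FV by blast
        \<comment> \<open>This reads the action of the homeomorphism at \<open>x\<close> off its
          operator, so that norm closeness of operators bounds
          \<open>\<bar>v (g x) - v (\<theta> \<psi> x)\<bar>\<close>.\<close>
        have at: "\<omega> v x = v (\<theta> \<omega> x)" if "\<omega> \<in> H" for \<omega>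
        proof -
          have "\<omega> v x = pullback_operator D (\<theta> \<omega>) v x" using \<theta>(2) [OF that] by simp
          then show ?thesis using vV xD by (simp add: pullback_operator_def pullback_def)
        qed
        have "norm_dist ?V (\<phi> v) (\<psi> v) < 1" using \<psi> v(1) unfolding N_def B_def M.in_mball by blast
        then have "bv_norm D (\<lambda>t. \<phi> v t - \<psi> v t) < 1"
          using function_space_dist [OF V(1) HV [OF \<phi>H vV] HV [OF \<psi>H vV]] by simp
        moreover have "\<bar>\<phi> v x - \<psi> v x\<bar> \<le> bv_norm D (\<lambda>t. \<phi> v t - \<psi> v t)"
          using bv_space_abs_diff_le [OF comp HV [OF \<phi>H vV] HV [OF \<psi>H vV]] .
        ultimately show False using v(2) at [OF \<phi>H] at [OF \<psi>H] by (simp add: g_def)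
      qed
      ultimately show ?thesis by (intro exI [of _ N]) (auto simp: N_def)
    qed
    then show "openin ?S {\<phi> \<in> topspace ?S. \<theta> \<phi> ` K \<subseteq> U}" by (subst openin_subopen) blast
  qed
  then show ?thesis by (simp add: \<theta>_def)
qed

text \<open>The tautological action of the group on \<open>D\<close> yields a co-homomorphism.
  Precomposing with inversion gives the homomorphism \<open>\<psi>\<close> with the same image, and
  inversion is a homeomorphism of the group, so the topological claims carry over.\<close>

theorem homeo_group_rosenthal:
  fixes D :: "'a topology"
  assumes D: "dendron D"
  shows "rosenthal_representable_group TYPE('a \<Rightarrow> real) (homeo_group D) (homeo_group_topology D)"
proof -
  let ?G = "homeo_group D" and ?T = "homeo_group_topology D" and ?V = "bv_space D"
  let ?I = "isometry_group ?V"
  have comp: "compact_space D" and T2: "Hausdorff_space D"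
    using D by (auto simp: dendron_def continuum_def)
  have T: "topological_group ?G ?T" using comp T2 by (rule homeo_group_topological_group)
  have act: "continuous_action ?G ?T D (\<lambda>f. f)" using comp T2 by (rule homeo_group_continuous_action)
  interpret G: Group.group ?G by (rule homeo_group_group)
  interpret I: Group.group ?I by (rule isometry_group_group [OF bv_space_normed_space [OF comp]])
  have rep: "representation ?G ?T D (\<lambda>f. f) ?V (pullback_operator D) (evaluation D)"
    using continuous_action_representation [OF comp T act] .
  have h: "pullback_operator D g \<in> carrier ?I" if "g \<in> carrier ?G" for g
    using rep that by (auto simp: representation_def)
  have h_mult: "pullback_operator D (g \<otimes>\<^bsub>?G\<^esub> k) = pullback_operator D k \<otimes>\<^bsub>?I\<^esub> pullback_operator D g"
    if "g \<in> carrier ?G" "k \<in> carrier ?G" for g k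
    using rep that by (auto simp: representation_def)
  have h_cont: "continuous_map ?T (strong_operator_group_topology ?V) (pullback_operator D)"
    using rep by (simp add: representation_def)
  define \<psi> where "\<psi> g = pullback_operator D (inv\<^bsub>?G\<^esub> g)" for g
  define H where "H = pullback_operator D ` carrier ?G"
  have inv_image: "(\<lambda>g. inv\<^bsub>?G\<^esub> g) ` carrier ?G = carrier ?G"
  proof
    show "carrier ?G \<subseteq> (\<lambda>g. inv\<^bsub>?G\<^esub> g) ` carrier ?G"
    proof
      fix g assume "g \<in> carrier ?G"
      then show "g \<in> (\<lambda>g. inv\<^bsub>?G\<^esub> g) ` carrier ?G"
        using G.inv_inv [of g] by (intro image_eqI [of _ _ "inv\<^bsub>?G\<^esub> g"]) auto
    qed
  qed auto
  have H: "\<psi> ` carrier ?G = H"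
    unfolding H_def \<psi>_def using inv_image by (metis image_image)
  have "\<psi> \<in> hom ?G ?I"
    by (rule homI) (auto simp: \<psi>_def h h_mult G.inv_mult_group)
  then have hom: "group_hom ?G ?I \<psi>"
    by (simp add: group_hom_def group_hom_axioms_def G.group_axioms I.group_axioms)
  have sub: "subgroup H ?I" using group_hom.img_is_subgroup [OF hom] H by simp
  have inj: "inj_on \<psi> (carrier ?G)"
  proof (rule inj_onI)
    fix f g assume fg: "f \<in> carrier ?G" "g \<in> carrier ?G" "\<psi> f = \<psi> g"
    then have "inv\<^bsub>?G\<^esub> f = inv\<^bsub>?G\<^esub> g"
      using pullback_operator_inj [OF D] by (auto simp: \<psi>_def dest: inj_onD)
    then show "f = g" using fg by (metis G.inv_inv)
  qed
  have "\<psi> \<in> iso ?G (?I\<lparr>carrier := H\<rparr>)"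
    using \<open>\<psi> \<in> hom ?G ?I\<close> H inj by (auto simp: iso_def hom_def bij_betw_def)
  moreover have "homeomorphic_map ?T (subtopology (strong_operator_group_topology ?V) H) \<psi>"
  proof -
    let ?S = "subtopology (strong_operator_group_topology ?V) H"
    define \<theta> where "\<theta> = inv_into (carrier ?G) (pullback_operator D)"
    have inv_cont: "continuous_map ?T ?T (\<lambda>g. inv\<^bsub>?G\<^esub> g)" using T by (simp add: topological_group_def)
    have topT: "topspace ?T = carrier ?G" by (rule topspace_homeo_group_topology)
    have "continuous_map ?T (strong_operator_group_topology ?V) \<psi>"
      using continuous_map_compose [OF inv_cont h_cont] by (simp add: \<psi>_def [abs_def] o_def)
    then have 1: "continuous_map ?T ?S \<psi>"
      using H topT by (auto simp: continuous_map_in_subtopology)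
    have "continuous_map ?S ?T \<theta>"
      using pullback_operator_inverse_continuous [OF D] by (simp add: \<theta>_def H_def)
    from continuous_map_compose [OF this inv_cont]
    have 2: "continuous_map ?S ?T (\<lambda>\<phi>. inv\<^bsub>?G\<^esub> (\<theta> \<phi>))" by (simp add: o_def)
    have 3: "inv\<^bsub>?G\<^esub> (\<theta> (\<psi> g)) = g" if "g \<in> carrier ?G" for g
      using that pullback_operator_inj [OF D] by (simp add: \<theta>_def \<psi>_def)
    have 4: "\<psi> (inv\<^bsub>?G\<^esub> (\<theta> \<phi>)) = \<phi>" if "\<phi> \<in> H" for \<phi>
      using that unfolding \<theta>_def \<psi>_def H_def by (simp add: inv_into_into f_inv_into_f)
    have "homeomorphic_maps ?T ?S \<psi> (\<lambda>\<phi>. inv\<^bsub>?G\<^esub> (\<theta> \<phi>))"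
      unfolding homeomorphic_maps_def using 1 2 3 4 topT by auto
    then show ?thesis using homeomorphic_map_maps by blast
  qed
  ultimately show ?thesis
    unfolding rosenthal_representable_group_def
    using T sub bv_space_rosenthal [OF comp] by blast
qed

text \<open>The same space \<open>bv_space D\<close> serves every group and action, which is why the
  carrier type \<open>'a \<Rightarrow> real\<close> depends on the dendron alone.\<close>

theorem theorem3p14:
  fixes D :: "'a topology"
  assumes "dendron D"
  shows "(\<forall>(G :: ('g, 'm) monoid_scheme) T act.
            topological_group G T \<and> continuous_action G T D act \<longrightarrow>
              rosenthal_representable_system TYPE('a \<Rightarrow> real) G T D act \<and>
              tame_system G D act) \<and>
         rosenthal_representable_group TYPE('a \<Rightarrow> real) (homeo_group D) (homeo_group_topology D)"
  using dendron_system_rosenthal [OF assms] dendron_system_tame [OF assms]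
    homeo_group_rosenthal [OF assms] by blast

end
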